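(* Let $\theta=(\alpha,\beta,\gamma,\delta)\in\mathbb{R}^4$ with $\alpha>0$, $\beta>0$, $\gamma\ge0$, and let $\{\varepsilon_t\}_{t\in\mathbb{Z}}$ be i.i.d. real random variables. Assume: (1) (stationarity of VGARCH) $E\log\bigl(\alpha+\gamma(\varepsilon_0-\delta)^2\bigr)<\infty$ and $\beta<1$; (2) (regularity) the distribution of $\varepsilon_0$ is absolutely continuous with respect to Lebesgue measure on $\mathbb{R}$ with continuous density $g$, $E\varepsilon_0=0$, $E\varepsilon_0^2=1$, $g(x)>0$ for all $x\in\mathbb{R}$, and $\sup_{x\in\mathbb{R}}(|x|+1)g(x)<\infty$; (3) $\lambda^y_V:=E\log\bigl|\beta-\gamma\varepsilon_0\overline{\sigma}_0^{-2}(\varepsilon_0-\delta)\bigr|>0$, where $\{\overline{\sigma}_t\}_{t\in\mathbb{Z}}$ is the stationary VGARCH volatility process. Put $H^V(\theta,y,x)=\alpha+\beta x+\gamma(yx^{-1/2}-\delta)^2$ for $y\in\mathbb{R}$, $x>0$. Then the system $$\sigma_t^2=H^V(\theta,\sigma_{t-1}\varepsilon_{t-1},\sigma_{t-1}^2),\qquad \hat\sigma_t^2=H^V(\theta,\sigma_{t-1}\varepsilon_{t-1},\hat\sigma_{t-1}^2),\qquad t\ge1,$$ has a stationary solution $\{(\overline{\sigma}_t^2,\hat{\overline{\sigma}}_t^2)\}_{t\ge0}$ on an extended probability space such that $$P(\overline{\sigma}_0^2=\hat{\overline{\sigma}}_0^2)=0.$$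
   Context: The VGARCH model is $y_t=\sigma_t\varepsilon_t$, $\sigma_t^2=\alpha+\gamma(\varepsilon_{t-1}-\delta)^2+\beta\sigma_{t-1}^2$, $t\in\mathbb{Z}$, with $\sigma_t>0$. Equivalently $\sigma_t^2=H^V(\theta,y_{t-1},\sigma^2_{t-1})$. Under (1) it has a unique strictly stationary solution, denoted $\{\overline{\sigma}_t\}_{t\in\mathbb{Z}}$. The recursive volatility approximation with the true parameter is $\hat\sigma_t^2=H^V(\theta,y_{t-1},\hat\sigma_{t-1}^2)$, $t\ge1$. A stationary solution of the system on an extended probability space means: on an enlargement of the original probability space (for example its product with another probability space, on which the $\varepsilon_t$ are still defined), a strictly stationary process of pairs of positive random variables satisfying both equations of the system for all $t\ge1$, whose first component is the stationary VGARCH volatility $\overline{\sigma}_t^2$ and whose initial pair $(\overline{\sigma}_0^2,\hat{\overline{\sigma}}_0^2)$ is independent of $\{\varepsilon_t,\,t\ge0\}$. *)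

theory Defs
  imports "HOL-Probability.Probability"
begin

text \<open>The time set is a whole type: \<open>int\<close> for two-sided, \<open>nat\<close> for one-sided processes.\<close>

definition strictly_stationary ::
    "'a measure \<Rightarrow> 'b measure \<Rightarrow> ('t::plus \<Rightarrow> 'a \<Rightarrow> 'b) \<Rightarrow> bool" where
  "strictly_stationary M N X \<longleftrightarrow>
     (\<forall>t. X t \<in> measurable M N) \<and>
     (\<forall>h. distr M (\<Pi>\<^sub>M t\<in>UNIV. N) (\<lambda>\<omega> t. X (t + h) \<omega>) =
          distr M (\<Pi>\<^sub>M t\<in>UNIV. N) (\<lambda>\<omega> t. X t \<omega>))"

definition iid :: "'a measure \<Rightarrow> 'b measure \<Rightarrow> ('t::zero \<Rightarrow> 'a \<Rightarrow> 'b) \<Rightarrow> bool" where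
  "iid M N X \<longleftrightarrow>
     prob_space.indep_vars M (\<lambda>_. N) X UNIV \<and>
     (\<forall>t. distr M N (X t) = distr M N (X 0))"

text \<open>
  The library's \<open>indep_var\<close> needs both random variables to have values in the same type; this is the
  same notion for two value types.
\<close>

definition indep_rv ::
    "'a measure \<Rightarrow> 'b measure \<Rightarrow> ('a \<Rightarrow> 'b) \<Rightarrow> 'c measure \<Rightarrow> ('a \<Rightarrow> 'c) \<Rightarrow> bool" where
  "indep_rv M N X K Y \<longleftrightarrow>
     X \<in> measurable M N \<and> Y \<in> measurable M K \<and>
     prob_space.indep_set M
       {X -` A \<inter> space M | A. A \<in> sets N} {Y -` B \<inter> space M | B. B \<in> sets K}"

definition HV :: "real \<times> real \<times> real \<times> real \<Rightarrow> real \<Rightarrow> real \<Rightarrow> real" where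
  "HV = (\<lambda>(\<alpha>, \<beta>, \<gamma>, \<delta>) y x. \<alpha> + \<beta> * x + \<gamma> * (y * x powr (-1/2) - \<delta>)\<^sup>2)"

definition vgarch_stationary_volatility ::
    "'a measure \<Rightarrow> real \<times> real \<times> real \<times> real \<Rightarrow> (int \<Rightarrow> 'a \<Rightarrow> real) \<Rightarrow> (int \<Rightarrow> 'a \<Rightarrow> real) \<Rightarrow> bool" where
  "vgarch_stationary_volatility M = (\<lambda>(\<alpha>, \<beta>, \<gamma>, \<delta>) \<epsilon> \<sigma>.
     strictly_stationary M borel \<sigma> \<and>
     (\<forall>t. AE \<omega> in M. \<sigma> t \<omega> > 0) \<and>
     (\<forall>t. AE \<omega> in M. (\<sigma> t \<omega>)\<^sup>2 = \<alpha> + \<gamma> * (\<epsilon> (t - 1) \<omega> - \<delta>)\<^sup>2 + \<beta> * (\<sigma> (t - 1) \<omega>)\<^sup>2))"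

text \<open>
  \<open>M'\<close> is an enlargement of \<open>M\<close>: random variables \<open>X\<close> on \<open>M\<close> live on \<open>M'\<close> as \<open>X \<circ> \<pi>\<close>, with the
  same joint laws. A product of \<open>M\<close> with a probability space, with \<open>\<pi> = fst\<close>, is the basic example.
\<close>

definition prob_extension :: "'a measure \<Rightarrow> 'b measure \<Rightarrow> ('b \<Rightarrow> 'a) \<Rightarrow> bool" where
  "prob_extension M M' \<pi> \<longleftrightarrow> prob_space M' \<and> \<pi> \<in> measurable M' M \<and> distr M' M \<pi> = M"

text \<open>
  \<open>M'\<close> and \<open>\<pi>\<close> are as in \<open>prob_extension\<close>, and \<open>\<sigma>\<close> is the stationary VGARCH volatility on \<open>M\<close>.
  The processes \<open>S\<close> and \<open>S'\<close> stand for the squared volatilities, so \<open>\<sigma>\<^sub>t\<close> in the system is \<open>sqrt (S t)\<close>.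
\<close>

definition stationary_pair_solution ::
    "'b measure \<Rightarrow> ('b \<Rightarrow> 'a) \<Rightarrow> real \<times> real \<times> real \<times> real \<Rightarrow> (int \<Rightarrow> 'a \<Rightarrow> real) \<Rightarrow>
     (int \<Rightarrow> 'a \<Rightarrow> real) \<Rightarrow> (nat \<Rightarrow> 'b \<Rightarrow> real) \<Rightarrow> (nat \<Rightarrow> 'b \<Rightarrow> real) \<Rightarrow> bool" where
  "stationary_pair_solution M' \<pi> \<theta> \<epsilon> \<sigma> S S' \<longleftrightarrow>
     strictly_stationary M' (borel \<Otimes>\<^sub>M borel) (\<lambda>t \<omega>. (S t \<omega>, S' t \<omega>)) \<and>
     (\<forall>t. AE \<omega> in M'. S t \<omega> > 0 \<and> S' t \<omega> > 0) \<and>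
     (\<forall>t\<ge>1. AE \<omega> in M'.
        S t \<omega> = HV \<theta> (sqrt (S (t - 1) \<omega>) * \<epsilon> (int (t - 1)) (\<pi> \<omega>)) (S (t - 1) \<omega>)) \<and>
     (\<forall>t\<ge>1. AE \<omega> in M'.
        S' t \<omega> = HV \<theta> (sqrt (S (t - 1) \<omega>) * \<epsilon> (int (t - 1)) (\<pi> \<omega>)) (S' (t - 1) \<omega>)) \<and>
     (\<forall>t. AE \<omega> in M'. S t \<omega> = (\<sigma> (int t) (\<pi> \<omega>))\<^sup>2) \<and>
     indep_rv M'
       (borel \<Otimes>\<^sub>M borel) (\<lambda>\<omega>. (S 0 \<omega>, S' 0 \<omega>))
       (\<Pi>\<^sub>M t\<in>(UNIV :: nat set). borel) (\<lambda>\<omega> t. \<epsilon> (int t) (\<pi> \<omega>))"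

text \<open>
  Two remarks on the expectations of logarithms in the hypotheses of the theorem. Since
  \<open>ln (\<alpha> + \<gamma> * (x - \<delta>)\<^sup>2) \<ge> ln \<alpha>\<close>, finiteness of the (a priori extended real) expectation
  in the stationarity condition is integrability. In the definition below, the Bochner integral of
  a non-integrable function is \<open>0\<close>, so positivity already entails integrability. The convention
  \<open>ln 0 = 0\<close> is immaterial: \<open>\<epsilon> 0\<close> has a density and is independent of \<open>\<sigma> 0\<close>, so the argument
  vanishes with probability zero.
\<close>

definition lyapunov_V ::
    "'a measure \<Rightarrow> real \<times> real \<times> real \<times> real \<Rightarrow> (int \<Rightarrow> 'a \<Rightarrow> real) \<Rightarrow> (int \<Rightarrow> 'a \<Rightarrow> real) \<Rightarrow> real" where
  "lyapunov_V M = (\<lambda>(\<alpha>, \<beta>, \<gamma>, \<delta>) \<epsilon> \<sigma>.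
     \<integral>\<omega>. ln \<bar>\<beta> - \<gamma> * \<epsilon> 0 \<omega> * inverse ((\<sigma> 0 \<omega>)\<^sup>2) * (\<epsilon> 0 \<omega> - \<delta>)\<bar> \<partial>M)"

end

theory Submission
  imports Defs
begin

text \<open>
  The pair \<open>(s, x)\<close> of squared volatilities is a Markov chain driven by the noise, its diagonal is
  invariant, and the gap obeys \<open>x' - s' = (x - s) A(s, x, \<epsilon>)\<close>, where \<open>\<lambda>\<^sup>y\<^sub>V\<close> is the mean of
  \<open>ln \<bar>A(s, s, \<epsilon>)\<bar>\<close> under the stationary law of \<open>s\<close>. Started at \<open>(s, s + 1)\<close>, the Cesaro averages of
  the laws of the chain have a weak limit point \<open>\<mu>\<close>, which is invariant. If \<open>\<mu>\<close> were carried by the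
  diagonal, then the mean of \<open>ln \<bar>x - s\<bar>\<close> would grow linearly with rate \<open>\<lambda>\<^sup>y\<^sub>V > 0\<close>, contradicting the
  boundedness of the first moments; here the logarithmic singularity of \<open>ln \<bar>A\<bar>\<close> is harmless because
  \<open>A\<close> is a quadratic polynomial in \<open>\<epsilon>\<close> with two real roots and the noise has a bounded density.
  So \<open>\<mu>\<close> charges the complement of the diagonal, and conditioning on it gives an invariant law
  whose first marginal is still the stationary law of \<open>s\<close>, because that law is unique. Finally \<open>x\<^sub>0\<close> is
  drawn from its conditional law given \<open>s\<^sub>0\<close> with the help of an independent uniform variable.
\<close>

section \<open>Weak compactness of laws on the positive quadrant\<close>

text \<open>The diagonal always carries an invariant law, that of two equal coordinates, so
  invariance alone gives nothing. The obstacle is that growth of the gap concerns the unbounded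
  function ln |A|, whereas weak limits only see bounded continuous functions. So ln |A| is clipped
  to [-3m, 3m], and the mean of what is lost below is bounded, uniformly in time, by a constant
  times exp (- m). The limit in time is taken at fixed m, and m tends to infinity only afterwards,
  under the limit law. The 3 stands for one m per factor of A: leading coefficient and two linear
  factors. Growth excludes only a law carried entirely by the diagonal, whence the conditioning; it
  keeps invariance because A is almost surely nonzero, so the chain neither enters nor leaves the
  diagonal. The hypotheses on \<sigma> are stationarity and the recursion. That its value at time 0
  depends on past noise only, and so is independent of the noise from time 0 on, has to be derived
  from the series obtained by iterating the recursion.\<close>

text \<open>
  Prokhorov's theorem on the quadrant is reduced to Helly's selection theorem on the line by
  Schoenberg's space-filling curve: \<open>square_decode\<close> is continuous on the whole line and
  \<open>square_encode\<close> is a measurable right inverse on \<open>{0..<1} \<times> {0..<1}\<close>.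
\<close>

definition bit_code :: "(nat \<Rightarrow> real) \<Rightarrow> real" where
  "bit_code b = (\<Sum>i. b i / (2 * 4 ^ i))"

text \<open>A \<open>bit_code\<close> is the number with base-4 digits 2 b_i. Leading digit 0 puts
  it into [0, 1/6] and leading digit 2 into [1/2, 2/3]; there the cosine is at least 1/2 or at most
  -1/2 respectively, so the truncated value is exactly 0 or 1.\<close>

definition schoenberg_bump :: "real \<Rightarrow> real" where
  "schoenberg_bump t = max 0 (min 1 (1/2 - cos (2 * pi * t)))"

lemma summable_bit_code:
  fixes b :: "nat \<Rightarrow> real"
  assumes "\<And>i. b i \<in> {0, 1}"
  shows "summable (\<lambda>i. b i / (2 * 4 ^ i))"
proof (rule summable_comparison_test')
  show "summable (\<lambda>i. (1/2) * (1/4 :: real) ^ i)"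
    by (intro summable_mult summable_geometric) auto
  show "norm (b n / (2 * 4 ^ n)) \<le> (1/2) * (1/4) ^ n" for n
    using assms[of n] by (auto simp: power_one_over field_simps)
qed

lemma bit_code_shift:
  assumes "\<And>i. b i \<in> {0, 1}"
  shows "bit_code b = b 0 / 2 + bit_code (\<lambda>i. b (Suc i)) / 4"
proof -
  have s: "summable (\<lambda>i. b (Suc i) / (2 * 4 ^ i))"
    by (rule summable_bit_code) (use assms in auto)
  have "bit_code b = (\<Sum>i. b (Suc i) / (2 * 4 ^ Suc i)) + b 0 / 2"
    using suminf_split_head[OF summable_bit_code[of b, OF assms]] unfolding bit_code_def by simp
  also have "(\<Sum>i. b (Suc i) / (2 * 4 ^ Suc i)) = (\<Sum>i. (b (Suc i) / (2 * 4 ^ i)) / 4)"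
    by (simp add: field_simps)
  also have "\<dots> = bit_code (\<lambda>i. b (Suc i)) / 4"
    unfolding bit_code_def by (rule suminf_divide[OF s])
  finally show ?thesis by simp
qed

lemma bit_code_bounds:
  assumes "\<And>i. b i \<in> {0, 1}"
  shows "0 \<le> bit_code b" "bit_code b \<le> 2/3"
proof -
  show "0 \<le> bit_code b"
    unfolding bit_code_def
  proof (intro suminf_nonneg summable_bit_code assms)
    show "0 \<le> b n / (2 * 4 ^ n)" for n using assms[of n] by auto
  qed
  have "bit_code b \<le> (\<Sum>i. (1/2) * (1/4 :: real) ^ i)"
    unfolding bit_code_def
  proof (intro suminf_le summable_bit_code assms)
    show "b n / (2 * 4 ^ n) \<le> (1/2) * (1/4) ^ n" for n
      using assms[of n] by (auto simp: power_one_over field_simps)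
    show "summable (\<lambda>i. (1/2) * (1/4 :: real) ^ i)"
      by (intro summable_mult summable_geometric) auto
  qed
  also have "\<dots> = 2/3"
    by (subst suminf_mult) (auto simp: suminf_geometric summable_geometric)
  finally show "bit_code b \<le> 2/3" .
qed

text \<open>Multiplication by 4 splits off the first digit, an integer, and shifts the others; an
  integer multiple of 2 pi does not change the cosine.\<close>

lemma cos_2pi_four_power_bit_code:
  assumes "\<And>i. b i \<in> {0, 1}"
  shows "cos (2 * pi * (4 ^ i * bit_code b)) = cos (2 * pi * bit_code (\<lambda>j. b (i + j)))"
  using assms
proof (induction i arbitrary: b)
  case (Suc i)
  have "4 ^ Suc i * bit_code b = 4 ^ i * (2 * b 0) + 4 ^ i * bit_code (\<lambda>i. b (Suc i))"
    by (subst bit_code_shift[OF Suc.prems]) (simp add: algebra_simps)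
  then have "2 * pi * (4 ^ Suc i * bit_code b) =
      2 * pi * (4 ^ i * bit_code (\<lambda>i. b (Suc i))) + 2 * pi * (4 ^ i * (2 * b 0))"
    by (simp add: algebra_simps)
  moreover have "\<exists>m::int. 4 ^ i * (2 * b 0) = of_int m"
    using Suc.prems[of 0] by (auto intro: exI[of _ "4 ^ i * 2"] exI[of _ 0])
  then obtain m :: int where "4 ^ i * (2 * b 0) = of_int m" by blast
  ultimately have "cos (2 * pi * (4 ^ Suc i * bit_code b)) =
      cos (2 * pi * (4 ^ i * bit_code (\<lambda>i. b (Suc i))))"
    by (simp add: cos_add sin_int_2pin cos_int_2pin)
  also have "\<dots> = cos (2 * pi * bit_code (\<lambda>j. b (Suc (i + j))))"
    by (rule Suc.IH) (use Suc.prems in auto)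
  finally show ?case by simp
qed simp

lemma schoenberg_bump_bit_code_0:
  assumes "\<And>i. b i \<in> {0, 1}"
  shows "schoenberg_bump (bit_code b) = b 0"
proof -
  let ?c = "bit_code (\<lambda>i. b (Suc i))"
  have c: "0 \<le> ?c" "?c \<le> 2/3"
    using bit_code_bounds[of "\<lambda>i. b (Suc i)"] assms by auto
  have cos: "1/2 \<le> cos (2 * pi * (?c / 4))"
  proof -
    have "cos (pi / 3) \<le> cos (2 * pi * (?c / 4))"
      using c by (intro cos_monotone_0_pi_le) auto
    then show ?thesis by (simp add: cos_60)
  qed
  have eq: "2 * pi * bit_code b = 2 * pi * (?c / 4) + pi * b 0"
    by (subst bit_code_shift[OF assms]) (simp add: algebra_simps)
  show ?thesis
    using assms[of 0] cos unfolding schoenberg_bump_def eq by (auto simp: cos_add)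
qed

lemma schoenberg_bump_bit_code:
  assumes "\<And>i. b i \<in> {0, 1}"
  shows "schoenberg_bump (4 ^ i * bit_code b) = b i"
  using schoenberg_bump_bit_code_0[of "\<lambda>j. b (i + j)"] assms
  by (simp add: schoenberg_bump_def cos_2pi_four_power_bit_code[OF assms])

section \<open>Binary digits and the coding of the unit square\<close>

definition dyadic_bit :: "real \<Rightarrow> nat \<Rightarrow> real" where
  "dyadic_bit u i = of_int (\<lfloor>2 ^ Suc i * u\<rfloor> - 2 * \<lfloor>2 ^ i * u\<rfloor>)"

lemma dyadic_bit_01: "dyadic_bit u i \<in> {0, 1}"
proof -
  have "\<lfloor>2 ^ Suc i * u\<rfloor> - 2 * \<lfloor>2 ^ i * u\<rfloor> \<in> {0, 1}"
    by (simp add: mult.assoc) linarith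
  then show ?thesis unfolding dyadic_bit_def by auto
qed

lemma dyadic_bit_sums:
  assumes "0 \<le> u" "u < 1"
  shows "(\<lambda>i. dyadic_bit u i / 2 ^ Suc i) sums u"
proof -
  \<comment> \<open>Each term is the difference of two consecutive dyadic truncations, so the sum
    telescopes; the truncation at n = 0 is the floor of u, which is 0 because 0 \<le> u < 1.\<close>
  have "(\<Sum>i<n. dyadic_bit u i / 2 ^ Suc i) = of_int \<lfloor>2 ^ n * u\<rfloor> / 2 ^ n" for n
  proof (induction n)
    case 0
    then show ?case using assms by (simp add: floor_eq_iff)
  next
    case (Suc n)
    then show ?case by (simp add: dyadic_bit_def field_simps)
  qed
  moreover have "(\<lambda>n. of_int \<lfloor>2 ^ n * u\<rfloor> / 2 ^ n) \<longlonglongrightarrow> u"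
  proof (rule tendsto_sandwich)
    show "(\<lambda>n. u - (1/2) ^ n) \<longlonglongrightarrow> u"
      by (rule tendsto_eq_intros LIMSEQ_power_zero refl | simp)+
    show "(\<lambda>n. u) \<longlonglongrightarrow> u" by simp
    show "\<forall>\<^sub>F n in sequentially. u - (1/2) ^ n \<le> of_int \<lfloor>2 ^ n * u\<rfloor> / 2 ^ n"
    proof (rule always_eventually, rule allI)
      fix n
      have "2 ^ n * u - 1 \<le> of_int \<lfloor>2 ^ n * u\<rfloor>" by linarith
      then have "(2 ^ n * u - 1) / 2 ^ n \<le> of_int \<lfloor>2 ^ n * u\<rfloor> / 2 ^ n"
        by (intro divide_right_mono) auto
      then show "u - (1/2) ^ n \<le> of_int \<lfloor>2 ^ n * u\<rfloor> / 2 ^ n"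
        by (simp add: diff_divide_distrib power_one_over)
    qed
    show "\<forall>\<^sub>F n in sequentially. of_int \<lfloor>2 ^ n * u\<rfloor> / 2 ^ n \<le> u"
      by (auto intro!: always_eventually simp: field_simps)
  qed
  ultimately show ?thesis unfolding sums_def by simp
qed

abbreviation plane :: "(real \<times> real) measure" where
  "plane \<equiv> borel \<Otimes>\<^sub>M borel"

definition square_encode :: "real \<times> real \<Rightarrow> real" where
  "square_encode z =
     bit_code (\<lambda>n. if even n then dyadic_bit (fst z) (n div 2) else dyadic_bit (snd z) (n div 2))"

text \<open>Digits are read by the continuous bump instead of by floors, so that decoding is
  continuous also at points that are not codes; a weak limit of laws of codes may charge such
  points.\<close>

definition square_decode :: "real \<Rightarrow> real \<times> real" where
  "square_decode c = (\<Sum>i. schoenberg_bump (4 ^ (2 * i) * c) / 2 ^ Suc i, \<Sum>i. schoenberg_bump (4 ^ (2 * i + 1) * c) / 2 ^ Suc i)"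

lemma square_decode_encode:
  assumes "0 \<le> fst z" "fst z < 1" "0 \<le> snd z" "snd z < 1"
  shows "square_decode (square_encode z) = z"
proof -
  have *: "schoenberg_bump (4 ^ i * square_encode z) =
      (if even i then dyadic_bit (fst z) (i div 2) else dyadic_bit (snd z) (i div 2))" for i
    unfolding square_encode_def by (rule schoenberg_bump_bit_code) (use dyadic_bit_01 in auto)
  show ?thesis
    unfolding square_decode_def *
    using dyadic_bit_sums[OF assms(1,2), THEN sums_unique]
      dyadic_bit_sums[OF assms(3,4), THEN sums_unique]
    by (cases z) simp
qed

lemma continuous_on_schoenberg_bump: "continuous_on UNIV schoenberg_bump"
  unfolding schoenberg_bump_def by (intro continuous_intros)

lemma schoenberg_bump_bounds: "0 \<le> schoenberg_bump t" "schoenberg_bump t \<le> 1"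
  by (auto simp: schoenberg_bump_def)

lemma summable_half_powers: "summable (\<lambda>i. 1 / 2 ^ Suc i :: real)"
  using summable_mult[OF summable_geometric[of "1/2::real"], of "1/2"] by (simp add: power_one_over field_simps)

lemma continuous_on_schoenberg_series:
  "continuous_on UNIV (\<lambda>c::real. \<Sum>i. schoenberg_bump (k i * c) / 2 ^ Suc i)"
proof -
  have "uniform_limit UNIV (\<lambda>n c. \<Sum>i<n. schoenberg_bump (k i * c) / 2 ^ Suc i)
      (\<lambda>c. \<Sum>i. schoenberg_bump (k i * c) / 2 ^ Suc i) sequentially"
  proof (rule Weierstrass_m_test)
    show "norm (schoenberg_bump (k n * x) / 2 ^ Suc n) \<le> 1 / 2 ^ Suc n" for n and x :: real
      using schoenberg_bump_bounds[of "k n * x"] by (auto simp: field_simps)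
  qed (rule summable_half_powers)
  then show ?thesis
    by (rule uniform_limit_theorem[rotated])
       (auto intro!: always_eventually continuous_intros continuous_on_compose2[OF continuous_on_schoenberg_bump])
qed

lemma continuous_on_square_decode: "continuous_on UNIV square_decode"
  unfolding square_decode_def by (intro continuous_on_Pair continuous_on_schoenberg_series)

lemma measurable_square_encode [measurable]: "square_encode \<in> borel_measurable plane"
proof -
  have [measurable]: "(\<lambda>z. dyadic_bit (f z) i) \<in> borel_measurable N"
    if [measurable]: "f \<in> borel_measurable N" for f i and N :: "'b measure"
    unfolding dyadic_bit_def by measurable
  show ?thesis unfolding square_encode_def bit_code_def by measurable
qed

lemma measurable_square_decode [measurable]: "square_decode \<in> borel_measurable borel"
  by (rule borel_measurable_continuous_onI[OF continuous_on_square_decode])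

text \<open>Codes lie in a bounded interval, so tightness of their laws is automatic. What can still
  go wrong is escape of mass to infinity in the quadrant, and the moment bound excludes it.\<close>

theorem prokhorov_positive_quadrant:
  fixes \<nu> :: "nat \<Rightarrow> (real \<times> real) measure"
  assumes prob: "\<And>n. prob_space (\<nu> n)"
    and sets_nu: "\<And>n. sets (\<nu> n) = sets plane"
    and pos: "\<And>n. AE z in \<nu> n. 0 < fst z \<and> 0 < snd z"
    and moment: "\<And>n. integrable (\<nu> n) (\<lambda>z. fst z + snd z)" "\<And>n. (\<integral>z. fst z + snd z \<partial>\<nu> n) \<le> C"
  obtains \<mu> r where "prob_space \<mu>" "sets \<mu> = sets plane" "strict_mono (r :: nat \<Rightarrow> nat)"
    "\<And>f :: real \<times> real \<Rightarrow> real. continuous_on UNIV f \<Longrightarrow> bounded (range f) \<Longrightarrow>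
        (\<lambda>n. \<integral>z. f z \<partial>\<nu> (r n)) \<longlonglongrightarrow> (\<integral>z. f z \<partial>\<mu>)"
proof -
  \<comment> \<open>\<open>e\<close> sends the quadrant into the unit square and infinity to a
    coordinate 0; \<open>e'\<close> undoes it and is discontinuous only where a coordinate is
    0.\<close>
  define e :: "real \<times> real \<Rightarrow> real \<times> real" where "e z = (1 / (1 + fst z), 1 / (1 + snd z))" for z
  define e' :: "real \<times> real \<Rightarrow> real \<times> real" where "e' p = (1 / fst p - 1, 1 / snd p - 1)" for p
  have [measurable]: "e \<in> plane \<rightarrow>\<^sub>M plane"
    unfolding e_def by measurable
  have [measurable]: "e' \<in> plane \<rightarrow>\<^sub>M plane"
    unfolding e'_def by measurable
  have dec[measurable]: "square_decode \<in> borel \<rightarrow>\<^sub>M plane"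
    by (metis borel_prod measurable_square_decode)
  note [measurable_cong] = sets_nu
  define code where "code z = square_encode (e z)" for z
  have [measurable]: "code \<in> borel_measurable plane"
    unfolding code_def by measurable
  have dec_code: "square_decode (code z) = e z" if "0 < fst z" "0 < snd z" for z
    unfolding code_def by (rule square_decode_encode) (use that in \<open>auto simp: e_def\<close>)
  define m where "m n = distr (\<nu> n) borel code" for n
  have m: "real_distribution (m n)" for n
  proof -
    interpret prob_space "\<nu> n" by (rule prob)
    show ?thesis unfolding m_def real_distribution_def real_distribution_axioms_def
      by (auto intro!: prob_space_distr)
  qed
  have "tight m"
    unfolding tight_def
  proof (intro conjI allI impI m exI)
    fix \<epsilon> :: real and n assume "\<epsilon> > 0"
    show "(-1 :: real) < 1" by simp
    interpret real_distribution "m n" by (rule m)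
    have "code z \<in> {-1<..1}" for z
      unfolding code_def square_encode_def
      using bit_code_bounds[of "\<lambda>n. if even n then dyadic_bit (fst (e z)) (n div 2) else dyadic_bit (snd (e z)) (n div 2)"]
        dyadic_bit_01 by fastforce
    then have "AE x in m n. x \<in> {-1<..1}"
      unfolding m_def by (subst AE_distr_iff) auto
    then have "measure (m n) {-1<..1} = 1"
      by (subst prob_eq_1) auto
    then show "1 - \<epsilon> < measure (m n) {-1<..1}" using \<open>\<epsilon> > 0\<close> by simp
  qed
  then obtain r M where r: "strict_mono (r :: nat \<Rightarrow> nat)" and M: "real_distribution M"
    and conv: "weak_conv_m (m \<circ> id \<circ> r) M"
    using tight_imp_convergent_subsubsequence[of m id] by (auto simp: strict_mono_id)
  interpret M: real_distribution M by (rule M)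
  interpret mr: real_distribution "(m \<circ> id \<circ> r) n" for n using m by simp
  \<comment> \<open>Continuity is required only almost everywhere under the limit, because the test
    functions of interest are compositions with \<open>e'\<close>.\<close>
  have lim: "(\<lambda>n. \<integral>z. f (e z) \<partial>\<nu> (r n)) \<longlonglongrightarrow> (\<integral>c. f (square_decode c) \<partial>M)"
    if [measurable]: "f \<in> borel_measurable plane"
      and bdd: "\<And>p. \<bar>f p\<bar> \<le> B"
      and cont: "AE c in M. isCont f (square_decode c)"
    for f :: "real \<times> real \<Rightarrow> real" and B
  proof -
    have "isCont (\<lambda>c. f (square_decode c)) c" if "isCont f (square_decode c)" for c
      using that continuous_on_square_decode
      by (intro isCont_o2[where f=square_decode and g=f]) (auto simp: continuous_on_eq_continuous_at)
    then have "AE c in M. isCont (\<lambda>c. f (square_decode c)) c"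
      using cont by auto
    then obtain N where N: "N \<in> null_sets M" "{c \<in> space M. \<not> isCont (\<lambda>c. f (square_decode c)) c} \<subseteq> N"
      by (auto simp: eventually_ae_filter)
    have "emeasure M {c. \<not> isCont (\<lambda>c. f (square_decode c)) c} \<le> emeasure M N"
      using N by (intro emeasure_mono) auto
    then have "emeasure M {c. \<not> isCont (\<lambda>c. f (square_decode c)) c} = 0"
      using N(1) by (simp add: null_setsD1)
    then have "(\<lambda>n. integral\<^sup>L ((m \<circ> id \<circ> r) n) (\<lambda>c. f (square_decode c))) \<longlonglongrightarrow> (\<integral>c. f (square_decode c) \<partial>M)"
      by (intro weak_conv_imp_bdd_ae_continuous_conv[where B=B] conv mr.real_distribution_axioms M) (use bdd in auto)
    also have "(\<lambda>n. integral\<^sup>L ((m \<circ> id \<circ> r) n) (\<lambda>c. f (square_decode c))) = (\<lambda>n. \<integral>z. f (e z) \<partial>\<nu> (r n))"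
    proof
      fix n
      have "integral\<^sup>L ((m \<circ> id \<circ> r) n) (\<lambda>c. f (square_decode c)) = (\<integral>z. f (square_decode (code z)) \<partial>\<nu> (r n))"
        unfolding m_def by (simp add: integral_distr)
      also have "\<dots> = (\<integral>z. f (e z) \<partial>\<nu> (r n))"
        by (rule integral_cong_AE) (use pos[of "r n"] in \<open>auto simp: dec_code\<close>)
      finally show "integral\<^sup>L ((m \<circ> id \<circ> r) n) (\<lambda>c. f (square_decode c)) = (\<integral>z. f (e z) \<partial>\<nu> (r n))" .
    qed
    finally show ?thesis .
  qed
  have "0 \<le> C"
  proof -
    have "0 \<le> (\<integral>z. fst z + snd z \<partial>\<nu> 0)"
      by (intro integral_nonneg_AE) (use pos[of 0] in auto)
    then show ?thesis using moment(2)[of 0] by simp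
  qed
  \<comment> \<open>Markov's inequality in the limit: \<open>q\<close> is the reciprocal of the
    coordinate capped at K + 1, hence bounded and continuous, and the reciprocal of a coordinate of
    \<open>e z\<close> is one plus that coordinate of z, whose mean is at most C.\<close>
  have tail: "measure M {c. coord (square_decode c) = 0} * (K + 1) \<le> C + 1"
    if coord: "coord = fst \<or> coord = snd" and "K > 0" for coord and K :: real
  proof -
    define q :: "real \<times> real \<Rightarrow> real" where "q p = 1 / max (coord p) (1 / (K + 1))" for p
    have coord_m[measurable]: "coord \<in> borel_measurable plane"
      and coord_i: "isCont coord p" for p
      using coord by (auto intro!: continuous_intros)
    have q_pos: "0 < max (coord p) (1 / (K + 1))" for p
      using \<open>K > 0\<close> by (auto simp: less_max_iff_disj)
    have q_bd: "0 \<le> q p" "q p \<le> K + 1" for p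
    proof -
      show "0 \<le> q p" using q_pos[of p] by (simp add: q_def)
      have "1 / max (coord p) (1 / (K + 1)) \<le> 1 / (1 / (K + 1))"
        using \<open>K > 0\<close> by (intro divide_left_mono mult_pos_pos q_pos) auto
      then show "q p \<le> K + 1" by (simp add: q_def)
    qed
    have [measurable]: "q \<in> borel_measurable plane"
      unfolding q_def by measurable
    have "isCont q p" for p
      unfolding q_def using q_pos[of p] coord_i[of p] by (intro continuous_intros) auto
    then have l: "(\<lambda>n. \<integral>z. q (e z) \<partial>\<nu> (r n)) \<longlonglongrightarrow> (\<integral>c. q (square_decode c) \<partial>M)"
      by (intro lim[of q "K + 1"]) (use q_bd in auto)
    have "(\<integral>z. q (e z) \<partial>\<nu> n) \<le> C + 1" for n
    proof -
      interpret prob_space "\<nu> n" by (rule prob)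
      have "(\<integral>z. q (e z) \<partial>\<nu> n) \<le> (\<integral>z. (fst z + snd z) + 1 \<partial>\<nu> n)"
      proof (rule integral_mono_AE)
        show "integrable (\<nu> n) (\<lambda>z. q (e z))"
          by (intro integrable_const_bound[where B="K+1"]) (use q_bd in auto)
        show "integrable (\<nu> n) (\<lambda>z. (fst z + snd z) + 1)"
          using moment(1) by auto
        show "AE z in \<nu> n. q (e z) \<le> (fst z + snd z) + 1"
          using pos[of n]
        proof eventually_elim
          case (elim z)
          have "q (e z) \<le> 1 / coord (e z)"
            unfolding q_def using elim coord \<open>K > 0\<close>
            by (intro divide_left_mono) (auto simp: e_def less_max_iff_disj intro!: mult_pos_pos divide_pos_pos)
          also have "\<dots> \<le> fst z + snd z + 1" using coord elim by (auto simp: e_def)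
          finally show ?case .
        qed
      qed
      also have "\<dots> = (\<integral>z. fst z + snd z \<partial>\<nu> n) + 1"
        using moment(1)[of n] by (subst Bochner_Integration.integral_add) (auto simp: prob_space)
      finally show ?thesis using moment(2)[of n] by simp
    qed
    then have "(\<integral>c. q (square_decode c) \<partial>M) \<le> C + 1"
      by (intro LIMSEQ_le_const2[OF l]) auto
    moreover have "(\<integral>c. (K + 1) * indicator {c. coord (square_decode c) = 0} c \<partial>M) \<le> (\<integral>c. q (square_decode c) \<partial>M)"
    proof (rule integral_mono)
      show "integrable M (\<lambda>c. q (square_decode c))"
        by (intro M.integrable_const_bound[where B="K+1"]) (use q_bd in auto)
      show "integrable M (\<lambda>c. (K + 1) * indicator {c. coord (square_decode c) = 0} c)"
        by (intro M.integrable_const_bound[where B="K+1"]) (use \<open>K > 0\<close> in \<open>auto split: split_indicator\<close>)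
      show "(K + 1) * indicator {c. coord (square_decode c) = 0} c \<le> q (square_decode c)" for c
        using q_bd(1)[of "square_decode c"] \<open>K > 0\<close> by (cases "coord (square_decode c) = 0") (auto simp: q_def)
    qed
    moreover have "(\<integral>c. (K + 1) * indicator {c. coord (square_decode c) = 0} c \<partial>M) =
        (K + 1) * measure M {c. coord (square_decode c) = 0}"
      by simp
    ultimately show ?thesis by (simp add: mult.commute)
  qed
  have nz: "AE c in M. coord (square_decode c) \<noteq> 0" if coord: "coord = fst \<or> coord = snd" for coord
  proof -
    have [measurable]: "coord \<in> borel_measurable plane"
      using coord by auto
    let ?p = "measure M {c. coord (square_decode c) = 0}"
    have "?p = 0"
    proof (rule ccontr)
      assume "?p \<noteq> 0"
      then have p: "?p > 0" by (simp add: less_le)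
      \<comment> \<open>With this K the estimate \<open>tail\<close> reads C + 1 + ?p \<le> C +
        1.\<close>
      define K where "K = (C + 1) / ?p"
      have "K > 0" using p \<open>0 \<le> C\<close> by (simp add: K_def)
      from tail[OF coord this] have "?p * K + ?p \<le> C + 1" by (simp add: algebra_simps)
      moreover have "?p * K = C + 1" using p by (simp add: K_def)
      ultimately show False using p by simp
    qed
    then show ?thesis
      by (subst (asm) M.prob_eq_0) auto
  qed
  define \<mu> where "\<mu> = distr M plane (\<lambda>c. e' (square_decode c))"
  show ?thesis
  proof (rule that[OF _ _ r])
    show "prob_space \<mu>" unfolding \<mu>_def by (rule M.prob_space_distr) simp
    show "sets \<mu> = sets plane" unfolding \<mu>_def by simp
    fix f :: "real \<times> real \<Rightarrow> real" assume f: "continuous_on UNIV f" "bounded (range f)"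
    have [measurable]: "f \<in> borel_measurable plane"
      using borel_measurable_continuous_onI[OF f(1)] by (simp add: borel_prod)
    obtain B where B: "\<And>z. \<bar>f z\<bar> \<le> B" using f(2) by (auto simp: bounded_iff)
    have "(\<lambda>n. \<integral>z. f (e' (e z)) \<partial>\<nu> (r n)) \<longlonglongrightarrow> (\<integral>c. f (e' (square_decode c)) \<partial>M)"
    proof (rule lim[of "\<lambda>p. f (e' p)" B])
      show "\<bar>f (e' p)\<bar> \<le> B" for p by (rule B)
      show "AE c in M. isCont (\<lambda>p. f (e' p)) (square_decode c)"
        using nz[of fst] nz[of snd]
      proof simp
        assume 1: "AE c in M. fst (square_decode c) \<noteq> 0" and 2: "AE c in M. snd (square_decode c) \<noteq> 0"
        show ?thesis using 1 2
        proof eventually_elim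
          case (elim c)
          have "isCont e' (square_decode c)"
            unfolding e'_def using elim by (intro continuous_intros) auto
          moreover have "isCont f (e' (square_decode c))"
            using f(1) continuous_on_eq_continuous_at open_UNIV by blast
          ultimately show ?case by (rule isCont_o2)
        qed
      qed
    qed measurable
    also have "(\<integral>c. f (e' (square_decode c)) \<partial>M) = (\<integral>z. f z \<partial>\<mu>)"
      unfolding \<mu>_def by (simp add: integral_distr)
    also have "(\<lambda>n. \<integral>z. f (e' (e z)) \<partial>\<nu> (r n)) = (\<lambda>n. \<integral>z. f z \<partial>\<nu> (r n))"
    proof
      fix n
      show "(\<integral>z. f (e' (e z)) \<partial>\<nu> (r n)) = (\<integral>z. f z \<partial>\<nu> (r n))"
        by (rule integral_cong_AE) (use pos[of "r n"] in \<open>auto simp: e_def e'_def\<close>)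
    qed
    finally show "(\<lambda>n. \<integral>z. f z \<partial>\<nu> (r n)) \<longlonglongrightarrow> (\<integral>z. f z \<partial>\<mu>)" .
  qed
qed

section \<open>Disintegration by a uniform variable\<close>

text \<open>The test set is the one where g < f: there f - g is positive but has integral at most 0.
  Finiteness of the integral of g makes the subtraction meaningful.\<close>

lemma AE_le_if_set_nn_integral_le:
  fixes f g :: "'a \<Rightarrow> ennreal"
  assumes [measurable]: "f \<in> borel_measurable M" "g \<in> borel_measurable M"
    and fin: "(\<integral>\<^sup>+x. g x \<partial>M) < \<infinity>"
    and le: "\<And>A. A \<in> sets M \<Longrightarrow> (\<integral>\<^sup>+x\<in>A. f x \<partial>M) \<le> (\<integral>\<^sup>+x\<in>A. g x \<partial>M)"
  shows "AE x in M. f x \<le> g x"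
proof -
  let ?A = "{x \<in> space M. g x < f x}"
  have gA: "(\<integral>\<^sup>+x\<in>?A. g x \<partial>M) < \<infinity>"
    by (rule le_less_trans[OF nn_integral_mono fin]) (auto split: split_indicator)
  have "(\<integral>\<^sup>+x. (f x * indicator ?A x - g x * indicator ?A x) \<partial>M) =
      (\<integral>\<^sup>+x\<in>?A. f x \<partial>M) - (\<integral>\<^sup>+x\<in>?A. g x \<partial>M)"
    using gA by (intro nn_integral_diff) (auto split: split_indicator)
  also have "\<dots> = 0"
    using le[of ?A] gA by (subst diff_eq_0_iff_ennreal) (auto intro: le_less_trans)
  finally have "AE x in M. f x * indicator ?A x - g x * indicator ?A x = 0"
    by (subst (asm) nn_integral_0_iff_AE) auto
  moreover have "AE x in M. g x \<noteq> \<infinity>"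
    using fin by (intro nn_integral_noteq_infinite) auto
  ultimately show ?thesis
    using AE_space
  proof eventually_elim
    case (elim x)
    then show ?case
      by (cases "g x < f x") (auto simp: diff_eq_0_iff_ennreal less_top)
  qed
qed

abbreviation unit_uniform :: "real measure" where
  "unit_uniform \<equiv> uniform_measure lborel {0..1}"

lemma prob_space_unit_uniform: "prob_space unit_uniform"
  by (rule prob_space_uniform_measure) auto

lemma emeasure_unit_uniform_less:
  "emeasure unit_uniform {u. ennreal u < k} = min 1 k"
proof -
  have eq: "{0..1} \<inter> {u. ennreal u < k} = (if k = 0 then {} else if k > 1 then {0..1} else {0..<enn2real k})"
  proof (cases k)
    case (real r)
    then show ?thesis
      by (auto simp: ennreal_less_iff ennreal_eq_0_iff ennreal_1[symmetric] simp del: ennreal_1)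
  qed (auto simp: ennreal_less_top)
  have "{u. ennreal u < k} \<in> sets lborel" by measurable
  then have "emeasure unit_uniform {u. ennreal u < k} = emeasure lborel ({0..1} \<inter> {u. ennreal u < k})"
    by (simp add: divide_ennreal_def)
  also have "\<dots> = min 1 k"
    unfolding eq by (auto simp: min_def not_less ennreal_enn2real_if not_le top.extremum_uniqueI)
  finally show ?thesis .
qed

text \<open>
  \<open>Q (s, u)\<close> is the quantile function of the conditional law of the second coordinate given the
  first, built from the densities \<open>\<kappa> q\<close> of \<open>A \<mapsto> \<mu> (A \<times> {..<q})\<close> for rational \<open>q\<close>.
\<close>

lemma noise_outsourcing:
  fixes \<mu> :: "('s \<times> real) measure"
  assumes "prob_space \<mu>" and sets_mu: "sets \<mu> = sets (N \<Otimes>\<^sub>M borel)"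
  obtains Q where "Q \<in> borel_measurable (N \<Otimes>\<^sub>M borel)"
    "distr (distr \<mu> N fst \<Otimes>\<^sub>M unit_uniform) (N \<Otimes>\<^sub>M borel) (\<lambda>(s, u). (s, Q (s, u))) = \<mu>"
proof -
  interpret mu: prob_space \<mu> by fact
  note [measurable_cong] = sets_mu
  have space_mu: "space \<mu> = space N \<times> UNIV"
    using sets_eq_imp_space_eq[OF sets_mu] by (simp add: space_pair_measure)
  define P where "P = distr \<mu> N fst"
  interpret P: prob_space P unfolding P_def by (rule mu.prob_space_distr) simp
  interpret U: prob_space unit_uniform by (rule prob_space_unit_uniform)
  interpret PU: pair_prob_space P unit_uniform ..
  have [measurable_cong]: "sets P = sets N" by (simp add: P_def)
  have space_P: "space P = space N" by (simp add: P_def)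
  define \<nu> where "\<nu> q = distr (density \<mu> (\<lambda>z. indicator {..<q} (snd z))) N fst" for q :: real
  have nu: "emeasure (\<nu> q) A = emeasure \<mu> (A \<times> {..<q})" if "A \<in> sets N" for A q
  proof -
    have A: "fst -` A \<inter> space \<mu> \<in> sets \<mu>" using that by measurable
    have "emeasure (\<nu> q) A = (\<integral>\<^sup>+z\<in>fst -` A \<inter> space \<mu>. indicator {..<q} (snd z) \<partial>\<mu>)"
      unfolding \<nu>_def using that A by (simp add: emeasure_distr emeasure_density)
    also have "\<dots> = (\<integral>\<^sup>+z. indicator (A \<times> {..<q}) z \<partial>\<mu>)"
      using sets.sets_into_space[OF that] by (intro nn_integral_cong) (auto simp: space_mu split: split_indicator)
    also have "\<dots> = emeasure \<mu> (A \<times> {..<q})"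
      using that by (intro nn_integral_indicator) (simp add: sets_mu)
    finally show ?thesis .
  qed
  have P: "emeasure P A = emeasure \<mu> (A \<times> UNIV)" if "A \<in> sets N" for A
    unfolding P_def using that sets.sets_into_space[OF that]
    by (subst emeasure_distr) (auto simp: space_mu intro!: arg_cong[where f="emeasure \<mu>"])
  have nu_le_P: "emeasure (\<nu> q) A \<le> emeasure P A" if "A \<in> sets N" for A q
    using that by (simp only: nu P) (auto intro!: emeasure_mono simp: sets_mu)
  \<comment> \<open>\<open>\<kappa> q s\<close> is a version of the conditional probability of
    {..<q} given s. Its properties hold outside null sets that depend on q, so only countably many q
    may be used at once.\<close>
  define \<kappa> where "\<kappa> q = RN_deriv P (\<nu> q)" for q
  have [measurable]: "\<kappa> q \<in> borel_measurable N" for q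
    unfolding \<kappa>_def using borel_measurable_RN_deriv[of P "\<nu> q"]
    by (simp add: measurable_cong_sets[of P N] P_def)
  have dens: "density P (\<kappa> q) = \<nu> q" for q
    unfolding \<kappa>_def
  proof (rule P.density_RN_deriv)
    show "absolutely_continuous P (\<nu> q)"
      unfolding absolutely_continuous_def
    proof (auto simp: null_sets_def \<nu>_def P_def)
    qed (metis \<nu>_def P_def le_zero_eq nu_le_P)
    show "sets (\<nu> q) = sets P" by (simp add: \<nu>_def P_def)
  qed
  have kappa: "(\<integral>\<^sup>+s\<in>A. \<kappa> q s \<partial>P) = emeasure \<mu> (A \<times> {..<q})" if [measurable]: "A \<in> sets N" for A q
    using nu[OF that, of q] unfolding dens[symmetric] by (subst (asm) emeasure_density) auto
  have kappa_mono: "AE s in P. \<kappa> q s \<le> \<kappa> b s" if "q \<le> b" for q b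
  proof (rule AE_le_if_set_nn_integral_le)
    have "(\<integral>\<^sup>+s. \<kappa> b s \<partial>P) = (\<integral>\<^sup>+s\<in>space P. \<kappa> b s \<partial>P)"
      by (intro nn_integral_cong) auto
    also have "\<dots> < \<infinity>" by (subst kappa) (auto simp: space_P mu.emeasure_eq_measure)
    finally show "(\<integral>\<^sup>+s. \<kappa> b s \<partial>P) < \<infinity>" .
    fix A assume "A \<in> sets P"
    then show "(\<integral>\<^sup>+s\<in>A. \<kappa> q s \<partial>P) \<le> (\<integral>\<^sup>+s\<in>A. \<kappa> b s \<partial>P)"
      using \<open>q \<le> b\<close> by (subst (1 2) kappa) (auto intro!: emeasure_mono simp: sets_mu P_def)
  qed auto
  have kappa_le_1: "AE s in P. \<kappa> b s \<le> 1" for b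
  proof (rule AE_le_if_set_nn_integral_le)
    show "(\<integral>\<^sup>+s. 1 \<partial>P) < \<infinity>" by (simp add: P.emeasure_space_1)
    fix A assume "A \<in> sets P"
    then have A[measurable]: "A \<in> sets N" by (simp add: P_def)
    show "(\<integral>\<^sup>+s\<in>A. \<kappa> b s \<partial>P) \<le> (\<integral>\<^sup>+s\<in>A. 1 \<partial>P)"
      using nu_le_P[OF A, of b] by (simp add: kappa nu)
  qed auto
  \<comment> \<open>The generalised inverse of the conditional distribution function. It is extended
    real: plus infinity where no rational q qualifies, minus infinity where arbitrarily small ones
    do.\<close>
  define I where "I z = (INF q\<in>\<rat>. if ennreal (snd z) < \<kappa> q (fst z) then ereal q else \<infinity>)" for z :: "'s \<times> real"
  have [measurable]: "I \<in> borel_measurable (N \<Otimes>\<^sub>M borel)"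
    unfolding I_def by (rule borel_measurable_INF) (auto simp: countable_rat)
  define K where "K b s = (SUP q\<in>{q\<in>\<rat>. q < b}. \<kappa> q s)" for b s
  have count: "countable {q\<in>\<rat>. q < b}" for b :: real
    by (rule countable_subset[OF _ countable_rat]) auto
  have [measurable]: "K b \<in> borel_measurable N" for b
    unfolding K_def by (rule borel_measurable_SUP[OF count]) auto
  \<comment> \<open>Because of the strict inequalities this equivalence holds at every point, also
    where \<open>\<kappa>\<close> fails to be monotone in q.\<close>
  have I_less: "I (s, u) < ereal b \<longleftrightarrow> ennreal u < K b s" for s u b
    unfolding I_def K_def INF_less_iff less_SUP_iff by (auto split: if_splits)
  \<comment> \<open>The upper bound is the almost sure monotonicity of \<open>\<kappa>\<close>. For
    the lower one, {..<b} is exhausted by half-lines with endpoint b - 1 / Suc n, and a rational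
    fits strictly between each endpoint and b.\<close>
  have K_int: "(\<integral>\<^sup>+s\<in>A. K b s \<partial>P) = emeasure \<mu> (A \<times> {..<b})" if A[measurable]: "A \<in> sets N" for A b
  proof (rule antisym)
    have "AE s in P. \<forall>q\<in>{q\<in>\<rat>. q < b}. \<kappa> q s \<le> \<kappa> b s"
      by (subst AE_ball_countable[OF count]) (auto intro: kappa_mono)
    then have "AE s in P. K b s \<le> \<kappa> b s"
      by eventually_elim (auto simp: K_def intro: SUP_least)
    then show "(\<integral>\<^sup>+s\<in>A. K b s \<partial>P) \<le> emeasure \<mu> (A \<times> {..<b})"
      unfolding kappa[OF A, symmetric]
      by (intro nn_integral_mono_AE) (auto split: split_indicator)
    have "(SUP n. emeasure \<mu> (A \<times> {..<b - 1 / Suc n})) = emeasure \<mu> (\<Union>n. A \<times> {..<b - 1 / Suc n})"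
    proof (rule SUP_emeasure_incseq)
      show "incseq (\<lambda>n. A \<times> {..<b - 1 / Suc n})"
        by (auto simp: incseq_def frac_le intro: order.strict_trans2)
    qed (auto simp: sets_mu)
    also have "(\<Union>n. A \<times> {..<b - 1 / Suc n}) = A \<times> {..<b}"
    proof (intro equalityI subsetI)
      fix z assume z: "z \<in> A \<times> {..<b}"
      then obtain n where "1 / Suc n < b - snd z"
        using reals_Archimedean[of "b - snd z"] by (auto simp: inverse_eq_divide)
      then show "z \<in> (\<Union>n. A \<times> {..<b - 1 / Suc n})"
        using z by (intro UN_I[of n]) (auto simp: algebra_simps)
    next
      fix z assume "z \<in> (\<Union>n. A \<times> {..<b - 1 / Suc n})"
      then obtain n where "fst z \<in> A" "snd z < b - 1 / Suc n" by auto
      moreover have "0 < 1 / real (Suc n)" by simp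
      ultimately have "fst z \<in> A" "snd z < b" by linarith+
      then show "z \<in> A \<times> {..<b}" by (cases z) auto
    qed
    finally have "emeasure \<mu> (A \<times> {..<b}) = (SUP n. emeasure \<mu> (A \<times> {..<b - 1 / Suc n}))" ..
    also have "\<dots> \<le> (\<integral>\<^sup>+s\<in>A. K b s \<partial>P)"
    proof (rule SUP_least)
      fix n
      obtain q where q: "b - 1 / Suc n < q" "q < b" "q \<in> \<rat>"
        using Rats_dense_in_real[of "b - 1 / Suc n" b] by auto
      have "emeasure \<mu> (A \<times> {..<b - 1 / Suc n}) \<le> emeasure \<mu> (A \<times> {..<q})"
        using q by (intro emeasure_mono) (auto simp: sets_mu)
      also have "\<dots> = (\<integral>\<^sup>+s\<in>A. \<kappa> q s \<partial>P)" by (simp add: kappa)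
      also have "\<dots> \<le> (\<integral>\<^sup>+s\<in>A. K b s \<partial>P)"
        using q by (intro nn_integral_mono) (auto simp: K_def split: split_indicator intro: SUP_upper)
      finally show "emeasure \<mu> (A \<times> {..<b - 1 / Suc n}) \<le> (\<integral>\<^sup>+s\<in>A. K b s \<partial>P)" .
    qed
    finally show "emeasure \<mu> (A \<times> {..<b}) \<le> (\<integral>\<^sup>+s\<in>A. K b s \<partial>P)" .
  qed
  have K_le_1: "AE s in P. K b s \<le> 1" for b
  proof -
    have "AE s in P. \<forall>q\<in>{q\<in>\<rat>. q < b}. \<kappa> q s \<le> 1"
      by (subst AE_ball_countable[OF count]) (auto intro: kappa_le_1)
    then show ?thesis by eventually_elim (auto simp: K_def intro: SUP_least)
  qed
  let ?R = "P \<Otimes>\<^sub>M unit_uniform"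
  \<comment> \<open>By \<open>I_less\<close> the section at s has uniform measure
    \<open>K b s\<close>, almost surely at most 1; so rectangles receive the mass that \<mu>
    prescribes.\<close>
  have R: "emeasure ?R {z \<in> space ?R. fst z \<in> A \<and> I z < ereal b} = emeasure \<mu> (A \<times> {..<b})"
    if A[measurable]: "A \<in> sets N" for A b
  proof -
    have m: "{z \<in> space ?R. fst z \<in> A \<and> I z < ereal b} \<in> sets ?R" by measurable
    have "emeasure ?R {z \<in> space ?R. fst z \<in> A \<and> I z < ereal b} =
        (\<integral>\<^sup>+s. emeasure unit_uniform (Pair s -` {z \<in> space ?R. fst z \<in> A \<and> I z < ereal b}) \<partial>P)"
      by (rule U.emeasure_pair_measure_alt[OF m])
    also have "\<dots> = (\<integral>\<^sup>+s\<in>A. min 1 (K b s) \<partial>P)"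
    proof (rule nn_integral_cong)
      fix s assume "s \<in> space P"
      then have "Pair s -` {z \<in> space ?R. fst z \<in> A \<and> I z < ereal b} = (if s \<in> A then {u. ennreal u < K b s} else {})"
        by (auto simp: I_less space_pair_measure)
      then show "emeasure unit_uniform (Pair s -` {z \<in> space ?R. fst z \<in> A \<and> I z < ereal b}) = min 1 (K b s) * indicator A s"
        by (simp del: emeasure_uniform_measure add: emeasure_unit_uniform_less)
    qed
    also have "\<dots> = (\<integral>\<^sup>+s\<in>A. K b s \<partial>P)"
      using K_le_1[of b] by (intro nn_integral_cong_AE) (auto simp: min_absorb2 split: split_indicator)
    finally show ?thesis by (simp add: K_int)
  qed
  have Ib: "emeasure ?R {z \<in> space ?R. I z < ereal b} = emeasure \<mu> (space N \<times> {..<b})" for b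
  proof -
    have "{z \<in> space ?R. I z < ereal b} = {z \<in> space ?R. fst z \<in> space N \<and> I z < ereal b}"
      by (auto simp: space_pair_measure space_P)
    then show ?thesis using R[of "space N" b] by simp
  qed
  \<comment> \<open>No mass of \<mu> sits at infinity: the masses of the strips below n tend to 1,
    and those of the strips below - n tend to 0.\<close>
  have not_top: "AE z in ?R. I z < \<infinity>"
  proof -
    have "emeasure ?R {z \<in> space ?R. I z < \<infinity>} = emeasure ?R (\<Union>n. {z \<in> space ?R. I z < ereal (real n)})"
    proof (intro arg_cong[where f="emeasure ?R"] equalityI subsetI)
      fix z assume z: "z \<in> {z \<in> space ?R. I z < \<infinity>}"
      then obtain n where "I z < ereal (real n)" using less_PInf_Ex_of_nat[of "I z"] by auto
      then show "z \<in> (\<Union>n. {z \<in> space ?R. I z < ereal (real n)})" using z by auto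
    qed auto
    also have "\<dots> = (SUP n. emeasure ?R {z \<in> space ?R. I z < ereal (real n)})"
    proof (rule SUP_emeasure_incseq[symmetric])
      have "{z \<in> space ?R. I z < ereal (real n)} \<in> sets ?R" for n by measurable
      then show "range (\<lambda>n. {z \<in> space ?R. I z < ereal (real n)}) \<subseteq> sets ?R" by blast
    qed (auto simp: incseq_def elim: order.strict_trans2)
    also have "\<dots> = (SUP n. emeasure \<mu> (space N \<times> {..<real n}))" by (simp add: Ib)
    also have "\<dots> = emeasure \<mu> (\<Union>n. space N \<times> {..<real n})"
      by (rule SUP_emeasure_incseq) (auto simp: incseq_def sets_mu)
    also have "(\<Union>n. space N \<times> {..<real n}) = space \<mu>"
      using reals_Archimedean2 by (auto simp: space_mu)
    finally show ?thesis
      by (subst PU.AE_iff_emeasure_eq_1) (auto simp: mu.emeasure_space_1)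
  qed
  have not_bot: "AE z in ?R. -\<infinity> < I z"
  proof -
    have "emeasure ?R {z \<in> space ?R. \<not> -\<infinity> < I z} \<le> (INF n. emeasure \<mu> (space N \<times> {..<- real n}))"
    proof (rule INF_greatest)
      fix n
      have "emeasure ?R {z \<in> space ?R. \<not> -\<infinity> < I z} \<le> emeasure ?R {z \<in> space ?R. I z < ereal (- real n)}"
      proof (rule emeasure_mono)
        show "{z \<in> space ?R. I z < ereal (- real n)} \<in> sets ?R" by measurable
      qed auto
      then show "emeasure ?R {z \<in> space ?R. \<not> -\<infinity> < I z} \<le> emeasure \<mu> (space N \<times> {..<- real n})"
        by (simp only: Ib)
    qed
    also have "\<dots> = emeasure \<mu> (\<Inter>n. space N \<times> {..<- real n})"
      by (rule INF_emeasure_decseq) (auto simp: decseq_def sets_mu)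
    also have "(\<Inter>n. space N \<times> {..<- real n}) = {}"
    proof -
      have False if "\<forall>n::nat. x < - real n" for x
        using reals_Archimedean2[of "- x"] that by (meson less_minus_iff order.asym)
      then show ?thesis by auto
    qed
    finally have "emeasure ?R {z \<in> space ?R. \<not> -\<infinity> < I z} = 0" by simp
    moreover have "{z \<in> space ?R. \<not> -\<infinity> < I z} \<in> sets ?R" by measurable
    ultimately show ?thesis by (rule AE_I[OF order_refl])
  qed
  define Q where "Q z = real_of_ereal (I z)" for z
  have [measurable]: "Q \<in> borel_measurable (N \<Otimes>\<^sub>M borel)" unfolding Q_def by measurable
  let ?D = "distr ?R (N \<Otimes>\<^sub>M borel) (\<lambda>(s, u). (s, Q (s, u)))"
  let ?E = "{A \<times> B |A B. A \<in> sets N \<and> B \<in> range (\<lambda>b::real. {..<b})}"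
  have "?D = \<mu>"
  proof (rule measure_eqI_generator_eq[where E="?E" and \<Omega>="space N \<times> UNIV" and A="\<lambda>n. space N \<times> {..<real n}"])
    show "Int_stable ?E"
    proof (rule Int_stableI, safe)
      fix A B :: "'s set" and a b :: real assume "A \<in> sets N" "B \<in> sets N"
      then show "\<exists>A' B'. A \<times> {..<a} \<inter> B \<times> {..<b} = A' \<times> B' \<and> A' \<in> sets N \<and> B' \<in> range lessThan"
        by (intro exI[of _ "A \<inter> B"] exI[of _ "{..<min a b}"]) auto
    qed
    show "?E \<subseteq> Pow (space N \<times> UNIV)" using sets.sets_into_space by fastforce
    have "sets (N \<Otimes>\<^sub>M borel) = sets (sigma (space N \<times> space borel) ?E)"
    proof (rule sets_pair_eq)
      show "sets N \<subseteq> Pow (space N)" by (rule sets.space_closed)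
      show "sets N = sigma_sets (space N) (sets N)" by (simp add: sets.sigma_sets_eq)
      show "sets borel = sigma_sets (space borel) (range (\<lambda>b::real. {..<b}))"
        by (subst borel_Iio) simp
      show "countable {space N}" "{space N} \<subseteq> sets N" "\<Union> {space N} = space N" by auto
      show "countable (range (\<lambda>n. {..<real n}))" "range (\<lambda>n. {..<real n}) \<subseteq> range (\<lambda>b::real. {..<b})" by auto
      show "\<Union> (range (\<lambda>n. {..<real n})) = space borel" using reals_Archimedean2 by auto
    qed auto
    also have "\<dots> = sigma_sets (space N \<times> UNIV) ?E"
      using sets.sets_into_space by (subst sets_measure_of) fastforce+
    finally show "sets ?D = sigma_sets (space N \<times> UNIV) ?E" "sets \<mu> = sigma_sets (space N \<times> UNIV) ?E"
      by (auto simp: sets_mu)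
    show "range (\<lambda>n. space N \<times> {..<real n}) \<subseteq> ?E" by auto
    show "(\<Union>n. space N \<times> {..<real n}) = space N \<times> UNIV" using reals_Archimedean2 by auto
    show "emeasure ?D (space N \<times> {..<real n}) \<noteq> \<infinity>" for n
      using PU.emeasure_finite by (subst emeasure_distr) auto
    fix X assume "X \<in> ?E"
    then obtain A b where X: "X = A \<times> {..<b}" and A[measurable]: "A \<in> sets N" by auto
    have "emeasure ?D X = emeasure ?R {z \<in> space ?R. fst z \<in> A \<and> Q z < b}"
      unfolding X by (subst emeasure_distr) (auto intro!: arg_cong[where f="emeasure ?R"] simp: case_prod_beta)
    also have "\<dots> = emeasure ?R {z \<in> space ?R. fst z \<in> A \<and> I z < ereal b}"
    proof (rule emeasure_eq_AE)
      show "AE z in ?R. z \<in> {z \<in> space ?R. fst z \<in> A \<and> Q z < b} \<longleftrightarrow>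
          z \<in> {z \<in> space ?R. fst z \<in> A \<and> I z < ereal b}"
        using not_top not_bot
      proof eventually_elim
        case (elim z)
        then show ?case by (cases "I z") (auto simp: Q_def)
      qed
      show "{z \<in> space ?R. fst z \<in> A \<and> Q z < b} \<in> sets ?R" by measurable
      show "{z \<in> space ?R. fst z \<in> A \<and> I z < ereal b} \<in> sets ?R" by measurable
    qed
    finally show "emeasure ?D X = emeasure \<mu> X" unfolding X by (simp add: R)
  qed
  then show ?thesis using that[of Q] by (simp add: P_def)
qed

section \<open>The volatility pair as a Markov chain\<close>

text \<open>
  Since \<open>ln 0 = 0\<close>, the deficit vanishes at \<open>w = 0\<close> when \<open>m \<ge> 0\<close>.
\<close>

definition log_deficit :: "real \<Rightarrow> real \<Rightarrow> real" where
  "log_deficit m w = max 0 (- m - ln \<bar>w\<bar>)"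

text \<open>A layer-cake bound: if the deficit is rounded up to an integer N, the first N indicators
  are all 1. Each indicator is that of a small ball, to which a density bound applies.\<close>

lemma log_deficit_le_suminf:
  assumes "0 \<le> m"
  shows "ennreal (log_deficit m w) \<le> (\<Sum>j. indicator {w. \<bar>w\<bar> < exp (- m - real j)} w)"
proof (cases "log_deficit m w \<le> 0")
  case True
  then show ?thesis by (simp add: ennreal_neg)
next
  case False
  then have pos: "log_deficit m w = - m - ln \<bar>w\<bar>" "- m - ln \<bar>w\<bar> > 0"
    by (auto simp: log_deficit_def max_def split: if_splits)
  then have "w \<noteq> 0" using assms by auto
  define N where "N = nat \<lceil>- m - ln \<bar>w\<bar>\<rceil>"
  have less: "\<bar>w\<bar> < exp (- m - real j)" if "j < N" for j
  proof -
    have "real j < - m - ln \<bar>w\<bar>" using that pos unfolding N_def by linarith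
    then have "exp (ln \<bar>w\<bar>) < exp (- m - real j)" by simp
    then show ?thesis using \<open>w \<noteq> 0\<close> by simp
  qed
  have "ennreal (log_deficit m w) \<le> ennreal (real N)"
    using pos unfolding N_def by (intro ennreal_leI) linarith
  also have "\<dots> = (\<Sum>j<N. indicator {w. \<bar>w\<bar> < exp (- m - real j)} w)"
    using less by (simp add: ennreal_of_nat_eq_real_of_nat)
  also have "\<dots> \<le> (\<Sum>j. indicator {w. \<bar>w\<bar> < exp (- m - real j)} w)"
    by (rule sum_le_suminf) auto
  finally show ?thesis .
qed

text \<open>Dominated convergence. For the one-step kernel this is the Feller property, by which
  weak limits of averages become invariant.\<close>

lemma continuous_on_integral_kernel:
  fixes \<rho> :: "real measure" and f :: "'c::metric_space \<times> real \<Rightarrow> real"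
  assumes "prob_space \<rho>" and [measurable_cong]: "sets \<rho> = sets borel"
    and f: "continuous_on UNIV f" and B: "\<And>w. \<bar>f w\<bar> \<le> B"
  shows "continuous_on UNIV (\<lambda>z. \<integral>y. f (z, y) \<partial>\<rho>)"
proof (rule continuous_on_sequentiallyI)
  interpret prob_space \<rho> by fact
  have [measurable]: "(\<lambda>y. f (z, y)) \<in> borel_measurable borel" for z
    by (intro borel_measurable_continuous_onI continuous_on_compose2[OF f]) (auto intro!: continuous_intros)
  fix u :: "nat \<Rightarrow> 'c" and a assume u: "u \<longlonglongrightarrow> a"
  show "(\<lambda>n. \<integral>y. f (u n, y) \<partial>\<rho>) \<longlonglongrightarrow> (\<integral>y. f (a, y) \<partial>\<rho>)"
  proof (rule integral_dominated_convergence[where w="\<lambda>_. B"])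
    show "AE y :: real in \<rho>. (\<lambda>n. f (u n, y)) \<longlonglongrightarrow> f (a, y)"
    proof (rule AE_I2)
      fix y :: real
      have "(\<lambda>n. (u n, y)) \<longlonglongrightarrow> (a, y)" using u by (intro tendsto_intros)
      then show "(\<lambda>n. f (u n, y)) \<longlonglongrightarrow> f (a, y)"
        by (rule continuous_on_tendsto_compose[OF f]) auto
    qed
  qed (use B in auto)
qed

lemma bounded_integral_kernel:
  assumes "prob_space \<rho>" "\<And>w. \<bar>f w\<bar> \<le> (B :: real)"
  shows "\<bar>\<integral>y. f (z, y) \<partial>\<rho>\<bar> \<le> B"
proof -
  interpret prob_space \<rho> by fact
  have "0 \<le> B" using assms(2)[of undefined] by simp
  then show ?thesis
    using integral_mono_AE'[of \<rho> "\<lambda>_. B" "\<lambda>y. \<bar>f (z, y)\<bar>"] assms(2)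
    by (intro order_trans[OF integral_abs_bound]) (auto simp: prob_space)
qed

text \<open>What is kept of the density is \<open>small_ball\<close>; a density bounded by B gives G
  = 2 B. A vanishing \<gamma> contradicts the positive Lyapunov exponent, which would then be ln
  \<beta> < 0.\<close>

locale vgarch_chain =
  fixes \<alpha> \<beta> \<gamma> \<delta> G :: real and \<rho> :: "real measure"
  assumes alpha_pos: "0 < \<alpha>" and beta_pos: "0 < \<beta>" and beta_less_1: "\<beta> < 1" and gamma_pos: "0 < \<gamma>"
    and prob_rho: "prob_space \<rho>" and sets_rho [measurable_cong]: "sets \<rho> = sets borel"
    and G_nonneg: "0 \<le> G"
    and small_ball: "\<And>r t. 0 < t \<Longrightarrow> emeasure \<rho> {y. \<bar>y - r\<bar> < t} \<le> ennreal (G * t)"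
    and integrable_id: "integrable \<rho> (\<lambda>y. y)" and mean: "(\<integral>y. y \<partial>\<rho>) = 0"
    and integrable_sq: "integrable \<rho> (\<lambda>y. y\<^sup>2)" and second_moment: "(\<integral>y. y\<^sup>2 \<partial>\<rho>) = 1"
begin

sublocale rho: prob_space \<rho> by (rule prob_rho)

text \<open>
  The maxima with \<open>\<alpha>\<close> make all maps continuous on the whole plane. They are immaterial for the
  chain, whose values are at least \<open>\<alpha>\<close>.
\<close>

definition step1 :: "real \<Rightarrow> real \<Rightarrow> real" where
  "step1 s y = \<alpha> + \<beta> * max \<alpha> s + \<gamma> * (y - \<delta>)\<^sup>2"

definition step :: "real \<times> real \<Rightarrow> real \<Rightarrow> real \<times> real" where
  "step z y = (step1 (fst z) y,
     \<alpha> + \<beta> * max \<alpha> (snd z) + \<gamma> * (y * sqrt (max \<alpha> (fst z) / max \<alpha> (snd z)) - \<delta>)\<^sup>2)"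

text \<open>This is the exact difference quotient of the variance update, not a derivative. On the
  diagonal the root is 1 and the expression becomes \<beta> - \<gamma> y (y - \<delta>) / s, the
  argument of the logarithm in the Lyapunov exponent.\<close>

definition factor :: "real \<times> real \<Rightarrow> real \<Rightarrow> real" where
  "factor z y = \<beta> - \<gamma> * y\<^sup>2 / max \<alpha> (snd z) +
     2 * \<gamma> * \<delta> * y / (max \<alpha> (snd z) * (1 + sqrt (max \<alpha> (fst z) / max \<alpha> (snd z))))"

lemma max_alpha_pos: "0 < max \<alpha> u"
  using alpha_pos by (simp add: less_max_iff_disj)

lemma measurable_step1 [measurable]: "(\<lambda>(s, y). step1 s y) \<in> borel_measurable plane"
  unfolding step1_def by measurable

lemma measurable_step [measurable]:
  "(\<lambda>(z, y). step z y) \<in> plane \<Otimes>\<^sub>M borel \<rightarrow>\<^sub>M plane"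
  unfolding step_def step1_def by measurable

lemma measurable_factor [measurable]:
  "(\<lambda>(z, y). factor z y) \<in> borel_measurable (plane \<Otimes>\<^sub>M borel)"
  unfolding factor_def by measurable

lemma continuous_on_step: "continuous_on UNIV (\<lambda>(z, y). step z y)"
proof -
  have "max \<alpha> u \<noteq> 0" for u using max_alpha_pos[of u] by simp
  then show ?thesis unfolding step_def step1_def case_prod_beta
    by (intro continuous_intros) auto
qed

lemma sqrt_denom_pos: "0 < 1 + sqrt (max \<alpha> s / max \<alpha> x)"
  using max_alpha_pos[of s] max_alpha_pos[of x] by (intro add_pos_nonneg) auto

lemma continuous_on_factor: "continuous_on UNIV (\<lambda>(z, y). factor z y)"
proof -
  have 1: "max \<alpha> u \<noteq> 0" for u using max_alpha_pos[of u] by simp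
  have 2: "1 + sqrt (max \<alpha> s / max \<alpha> x) \<noteq> 0" for s x using sqrt_denom_pos[of s x] by simp
  show ?thesis unfolding factor_def case_prod_beta
    by (intro continuous_intros) (use 1 2 in auto)
qed

lemma step_ge: "\<alpha> \<le> fst (step z y)" "\<alpha> \<le> snd (step z y)"
  using alpha_pos beta_pos gamma_pos max_alpha_pos[of "fst z"] max_alpha_pos[of "snd z"]
  unfolding step_def step1_def by auto

text \<open>With r = sqrt (s / x), the difference of the squares (y r - \<delta>)^2 and (y -
  \<delta>)^2 is divisible by 1 - r, and so is x - s = x (1 - r) (1 + r). Hence the gap is
  multiplied exactly, with no error term.\<close>

lemma step_diff:
  "snd (step z y) - fst (step z y) = (max \<alpha> (snd z) - max \<alpha> (fst z)) * factor z y"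
proof -
  define s x where "s = max \<alpha> (fst z)" and "x = max \<alpha> (snd z)"
  define r where "r = sqrt (s / x)"
  have pos: "0 < s" "0 < x" unfolding s_def x_def by (rule max_alpha_pos)+
  then have r: "r\<^sup>2 = s / x" "0 < r" unfolding r_def by auto
  have s: "s = r\<^sup>2 * x" using r(1) pos by simp
  have rn: "1 + r \<noteq> 0" using r(2) by simp
  have "\<gamma> * (y * r - \<delta>)\<^sup>2 - \<gamma> * (y - \<delta>)\<^sup>2 = (x - s) * (- \<gamma> * y\<^sup>2 / x + 2 * \<gamma> * \<delta> * y / (x * (1 + r)))"
  proof -
    have "(x - s) * (- \<gamma> * y\<^sup>2 / x + 2 * \<gamma> * \<delta> * y / (x * (1 + r))) =
        ((1 - r) * (1 + r)) * (- \<gamma> * y\<^sup>2 + 2 * \<gamma> * \<delta> * y / (1 + r))"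
    proof -
      have "x - s = x * ((1 - r) * (1 + r))" unfolding s by (simp add: algebra_simps power2_eq_square)
      moreover have "- \<gamma> * y\<^sup>2 / x + 2 * \<gamma> * \<delta> * y / (x * (1 + r)) =
          (- \<gamma> * y\<^sup>2 + 2 * \<gamma> * \<delta> * y / (1 + r)) / x"
        by (simp add: add_divide_distrib diff_divide_distrib mult.commute)
      ultimately show ?thesis using pos(2) by simp
    qed
    also have "\<dots> = (1 - r) * (- \<gamma> * y\<^sup>2 * (1 + r) + 2 * \<gamma> * \<delta> * y)"
      using rn by (simp add: field_simps)
    also have "\<dots> = \<gamma> * (y * r - \<delta>)\<^sup>2 - \<gamma> * (y - \<delta>)\<^sup>2"
      by (simp add: algebra_simps power2_eq_square)
    finally show ?thesis by simp
  qed
  then show ?thesis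
    unfolding step_def step1_def factor_def s_def[symmetric] x_def[symmetric] r_def[symmetric]
    by (simp add: algebra_simps)
qed

section \<open>Roots of the gap factor and its logarithmic singularities\<close>

definition vertex :: "real \<times> real \<Rightarrow> real" where
  "vertex z = \<delta> / (1 + sqrt (max \<alpha> (fst z) / max \<alpha> (snd z)))"

definition half_width :: "real \<times> real \<Rightarrow> real" where
  "half_width z = sqrt ((vertex z)\<^sup>2 + \<beta> * max \<alpha> (snd z) / \<gamma>)"

text \<open>As a polynomial in y the factor has root product - \<beta> x / \<gamma> < 0, where x =
  \<open>max \<alpha> (snd z)\<close>. So for every state there are two distinct real roots,
  symmetric about \<open>vertex z\<close>.\<close>

lemma factor_eq_roots:
  "factor z y = - (\<gamma> / max \<alpha> (snd z)) *
     ((y - (vertex z + half_width z)) * (y - (vertex z - half_width z)))"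
proof -
  define x where "x = max \<alpha> (snd z)"
  define d h where "d = vertex z" and "h = half_width z"
  define r where "r = 1 + sqrt (max \<alpha> (fst z) / x)"
  have x: "0 < x" unfolding x_def by (rule max_alpha_pos)
  have h: "h * h = d\<^sup>2 + \<beta> * x / \<gamma>"
    unfolding h_def half_width_def d_def x_def[symmetric]
    using x beta_pos gamma_pos by (simp flip: power2_eq_square)
  have d: "d = \<delta> / r" unfolding d_def vertex_def x_def r_def ..
  have "(y - (d + h)) * (y - (d - h)) = (y - d)\<^sup>2 - h * h"
    by (simp add: algebra_simps power2_eq_square)
  also have "\<dots> = y\<^sup>2 - 2 * d * y - \<beta> * x / \<gamma>"
    unfolding h by (simp add: algebra_simps power2_eq_square)
  finally have "- (\<gamma> / x) * ((y - (d + h)) * (y - (d - h))) = - (\<gamma> / x) * (y\<^sup>2 - 2 * d * y - \<beta> * x / \<gamma>)"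
    by simp
  also have "\<dots> = \<beta> - \<gamma> * y\<^sup>2 / x + 2 * \<gamma> * d * y / x"
    using x gamma_pos by (simp add: field_simps)
  also have "2 * \<gamma> * d * y / x = 2 * \<gamma> * \<delta> * y / (x * r)"
    unfolding d by simp
  finally show ?thesis unfolding factor_def x_def[symmetric] d_def[symmetric] h_def[symmetric] r_def ..
qed

text \<open>The level 3m is shared out, one m to the leading coefficient and one to each linear
  factor. For the coefficient, ln t \<le> t at t = x exp (- m) / \<gamma> gives a bound linear in x,
  which first moments can control.\<close>

lemma log_deficit_factor_le:
  assumes "0 \<le> m"
  shows "log_deficit (3 * m) (factor z y) \<le> max \<alpha> (snd z) * exp (- m) / \<gamma> +
    log_deficit m (y - (vertex z + half_width z)) + log_deficit m (y - (vertex z - half_width z))"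
proof -
  define x where "x = max \<alpha> (snd z)"
  define u v where "u = y - (vertex z + half_width z)" and "v = y - (vertex z - half_width z)"
  have x: "0 < x" unfolding x_def by (rule max_alpha_pos)
  have nonneg: "0 \<le> x * exp (- m) / \<gamma>" "0 \<le> log_deficit m u" "0 \<le> log_deficit m v"
    using x gamma_pos by (auto simp: log_deficit_def)
  have eq: "factor z y = - (\<gamma> / x) * (u * v)"
    unfolding factor_eq_roots x_def u_def v_def ..
  have "log_deficit (3 * m) (factor z y) \<le> x * exp (- m) / \<gamma> + log_deficit m u + log_deficit m v"
  proof (cases "u = 0 \<or> v = 0")
    \<comment> \<open>At a root of the factor the convention ln 0 = 0 makes the left-hand side
      0.\<close>
    case True
    then have "log_deficit (3 * m) (factor z y) = 0"
      unfolding eq log_deficit_def using assms by auto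
    then show ?thesis using nonneg by linarith
  next
    case False
    have "ln (x * exp (- m) / \<gamma>) \<le> x * exp (- m) / \<gamma>"
      using ln_le_minus_one[of "x * exp (- m) / \<gamma>"] x gamma_pos by auto
    then have 1: "ln x - m - ln \<gamma> \<le> x * exp (- m) / \<gamma>"
      using x gamma_pos by (simp add: ln_mult ln_div)
    have "ln \<bar>factor z y\<bar> = ln \<gamma> - ln x + ln \<bar>u\<bar> + ln \<bar>v\<bar>"
      unfolding eq using False x gamma_pos by (simp add: abs_mult ln_mult ln_div)
    moreover have "- m - ln \<bar>u\<bar> \<le> log_deficit m u" "- m - ln \<bar>v\<bar> \<le> log_deficit m v"
      by (auto simp: log_deficit_def)
    ultimately show ?thesis
      using 1 nonneg unfolding log_deficit_def[of "3 * m"] by linarith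
  qed
  then show ?thesis unfolding x_def u_def v_def .
qed

definition deficit_const :: real where
  "deficit_const = G / (1 - exp (- 1))"

lemma deficit_const_nonneg: "0 \<le> deficit_const"
  unfolding deficit_const_def using G_nonneg by simp

text \<open>Layer j costs at most G exp (- m - j), and the geometric series over j produces
  \<open>deficit_const\<close>. The bound is free of the centre r, so it serves for roots that move
  with the state.\<close>

lemma nn_integral_log_deficit_le:
  assumes "0 \<le> m"
  shows "(\<integral>\<^sup>+y. log_deficit m (y - r) \<partial>\<rho>) \<le> ennreal (deficit_const * exp (- m))"
proof -
  have "(\<integral>\<^sup>+y. log_deficit m (y - r) \<partial>\<rho>) \<le>
      (\<integral>\<^sup>+y. (\<Sum>j. indicator {w. \<bar>w\<bar> < exp (- m - real j)} (y - r)) \<partial>\<rho>)"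
    by (intro nn_integral_mono log_deficit_le_suminf assms)
  also have "\<dots> = (\<Sum>j. \<integral>\<^sup>+y. indicator {w. \<bar>w\<bar> < exp (- m - real j)} (y - r) \<partial>\<rho>)"
    by (rule nn_integral_suminf) measurable
  also have "\<dots> = (\<Sum>j. emeasure \<rho> {y. \<bar>y - r\<bar> < exp (- m - real j)})"
  proof (intro suminf_cong)
    fix j
    have "(\<integral>\<^sup>+y. indicator {w. \<bar>w\<bar> < exp (- m - real j)} (y - r) \<partial>\<rho>) =
        (\<integral>\<^sup>+y. indicator {y. \<bar>y - r\<bar> < exp (- m - real j)} y \<partial>\<rho>)"
      by (intro nn_integral_cong) (auto split: split_indicator)
    also have "\<dots> = emeasure \<rho> {y. \<bar>y - r\<bar> < exp (- m - real j)}"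
      by (rule nn_integral_indicator) (simp add: sets_rho)
    finally show "(\<integral>\<^sup>+y. indicator {w. \<bar>w\<bar> < exp (- m - real j)} (y - r) \<partial>\<rho>) =
        emeasure \<rho> {y. \<bar>y - r\<bar> < exp (- m - real j)}" .
  qed
  also have "\<dots> \<le> (\<Sum>j. ennreal (G * exp (- m - real j)))"
    by (intro suminf_le small_ball) auto
  also have "\<dots> = ennreal (deficit_const * exp (- m))"
  proof (rule suminf_ennreal_eq)
    have "(\<lambda>j. (G * exp (- m)) * exp (- 1) ^ j) sums ((G * exp (- m)) * (1 / (1 - exp (- 1))))"
      by (intro sums_mult geometric_sums) auto
    moreover have "(G * exp (- m)) * exp (- 1) ^ j = G * exp (- m - real j)" for j
      unfolding exp_of_nat_mult[symmetric] by (simp flip: exp_add)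
    ultimately show "(\<lambda>j. G * exp (- m - real j)) sums (deficit_const * exp (- m))"
      by (simp add: deficit_const_def)
  qed (use G_nonneg in auto)
  finally show ?thesis .
qed

text \<open>The small-ball bound with radius tending to 0 excludes atoms.\<close>

lemma AE_rho_neq: "AE y in \<rho>. y \<noteq> r"
proof -
  have "measure \<rho> {r} \<le> 0 + e" if "0 < e" for e
  proof -
    have "0 < G + 1" using G_nonneg by simp
    then have pos: "0 < e / (G + 1)" using that by simp
    have "{r} \<subseteq> {y. \<bar>y - r\<bar> < e / (G + 1)}" using pos by simp
    then have "emeasure \<rho> {r} \<le> emeasure \<rho> {y. \<bar>y - r\<bar> < e / (G + 1)}"
      by (intro emeasure_mono) (auto simp: sets_rho)
    also have "\<dots> \<le> ennreal (G * (e / (G + 1)))" by (rule small_ball[OF pos])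
    finally have "measure \<rho> {r} \<le> G * (e / (G + 1))"
      using mult_nonneg_nonneg[OF G_nonneg less_imp_le[OF pos]]
      by (simp only: rho.emeasure_eq_measure) (subst (asm) ennreal_le_iff, auto)
    also have "\<dots> \<le> (G + 1) * (e / (G + 1))"
      using pos by (intro mult_right_mono) auto
    also have "\<dots> = e" using \<open>0 < G + 1\<close> by simp
    finally show ?thesis by simp
  qed
  then have "measure \<rho> {r} \<le> 0" by (rule field_le_epsilon)
  then have "emeasure \<rho> {r} = 0"
    by (simp add: rho.emeasure_eq_measure measure_le_0_iff)
  then show ?thesis
    by (intro AE_I[where N="{r}"]) (auto simp: sets_rho)
qed

lemma AE_factor_nonzero: "AE y in \<rho>. factor z y \<noteq> 0"
  using AE_rho_neq[of "vertex z + half_width z"] AE_rho_neq[of "vertex z - half_width z"]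
  by eventually_elim (use gamma_pos max_alpha_pos[of "snd z"] in \<open>auto simp: factor_eq_roots\<close>)

lemma nn_integral_log_deficit_factor_le:
  assumes "0 \<le> m"
  shows "(\<integral>\<^sup>+y. log_deficit (3 * m) (factor z y) \<partial>\<rho>) \<le>
    ennreal (exp (- m) / \<gamma> * max \<alpha> (snd z) + 2 * deficit_const * exp (- m))"
proof -
  have [measurable]: "log_deficit m \<in> borel_measurable borel" for m
    unfolding log_deficit_def by measurable
  have nonneg: "0 \<le> log_deficit m w" for m w by (simp add: log_deficit_def)
  have "(\<integral>\<^sup>+y. log_deficit (3 * m) (factor z y) \<partial>\<rho>) \<le>
     (\<integral>\<^sup>+y. ennreal (max \<alpha> (snd z) * exp (- m) / \<gamma>) +
       ennreal (log_deficit m (y - (vertex z + half_width z))) +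
       ennreal (log_deficit m (y - (vertex z - half_width z))) \<partial>\<rho>)"
  proof (rule nn_integral_mono)
    fix y
    have "0 \<le> max \<alpha> (snd z) * exp (- m) / \<gamma>"
      using max_alpha_pos[of "snd z"] gamma_pos by simp
    then show "ennreal (log_deficit (3 * m) (factor z y)) \<le> ennreal (max \<alpha> (snd z) * exp (- m) / \<gamma>) +
       ennreal (log_deficit m (y - (vertex z + half_width z))) +
       ennreal (log_deficit m (y - (vertex z - half_width z)))"
      using ennreal_leI[OF log_deficit_factor_le[OF assms, of z y]] nonneg
      by (simp add: ennreal_plus)
  qed
  also have "\<dots> = ennreal (max \<alpha> (snd z) * exp (- m) / \<gamma>) +
       (\<integral>\<^sup>+y. log_deficit m (y - (vertex z + half_width z)) \<partial>\<rho>) +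
       (\<integral>\<^sup>+y. log_deficit m (y - (vertex z - half_width z)) \<partial>\<rho>)"
    by (simp add: nn_integral_add rho.emeasure_space_1)
  also have "\<dots> \<le> ennreal (max \<alpha> (snd z) * exp (- m) / \<gamma>) +
       ennreal (deficit_const * exp (- m)) + ennreal (deficit_const * exp (- m))"
    by (intro add_mono nn_integral_log_deficit_le assms order_refl)
  also have "\<dots> = ennreal (exp (- m) / \<gamma> * max \<alpha> (snd z) + 2 * deficit_const * exp (- m))"
  proof -
    have "0 \<le> max \<alpha> (snd z) * exp (- m) / \<gamma>" "0 \<le> deficit_const * exp (- m)"
      using max_alpha_pos[of "snd z"] gamma_pos deficit_const_nonneg by auto
    then have "ennreal (max \<alpha> (snd z) * exp (- m) / \<gamma>) + ennreal (deficit_const * exp (- m)) +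
        ennreal (deficit_const * exp (- m)) =
        ennreal (max \<alpha> (snd z) * exp (- m) / \<gamma> + deficit_const * exp (- m) + deficit_const * exp (- m))"
      by (simp only: ennreal_plus add_nonneg_nonneg)
    also have "max \<alpha> (snd z) * exp (- m) / \<gamma> + deficit_const * exp (- m) + deficit_const * exp (- m) =
        exp (- m) / \<gamma> * max \<alpha> (snd z) + 2 * deficit_const * exp (- m)"
      by simp
    finally show ?thesis .
  qed
  finally show ?thesis .
qed

end

section \<open>Moments and logarithmic growth of the gap\<close>

context vgarch_chain begin

section \<open>The one-step operator on laws of the pair\<close>

definition transition :: "(real \<times> real) measure \<Rightarrow> (real \<times> real) measure" where
  "transition \<mu> = distr (\<mu> \<Otimes>\<^sub>M \<rho>) plane (\<lambda>(z, y). step z y)"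

lemma sets_transition [simp, measurable_cong]: "sets (transition \<mu>) = sets plane"
  by (simp add: transition_def)

lemma measurable_step_kernel:
  assumes [measurable_cong]: "sets \<mu> = sets plane"
  shows "(\<lambda>(z, y). step z y) \<in> \<mu> \<Otimes>\<^sub>M \<rho> \<rightarrow>\<^sub>M plane"
  by measurable

lemma prob_space_transition:
  assumes "prob_space \<mu>" and "sets \<mu> = sets plane"
  shows "prob_space (transition \<mu>)"
proof -
  interpret mu: prob_space \<mu> by fact
  interpret pair_prob_space \<mu> \<rho> ..
  show ?thesis
    unfolding transition_def by (rule prob_space_distr[OF measurable_step_kernel[OF assms(2)]])
qed

lemma nn_integral_transition:
  assumes [measurable_cong]: "sets \<mu> = sets plane"
    and [measurable]: "f \<in> borel_measurable plane"
  shows "(\<integral>\<^sup>+z. f z \<partial>transition \<mu>) = (\<integral>\<^sup>+z. \<integral>\<^sup>+y. f (step z y) \<partial>\<rho> \<partial>\<mu>)"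
proof -
  have "(\<integral>\<^sup>+z. f z \<partial>transition \<mu>) = (\<integral>\<^sup>+w. f (case w of (z, y) \<Rightarrow> step z y) \<partial>(\<mu> \<Otimes>\<^sub>M \<rho>))"
    unfolding transition_def by (rule nn_integral_distr) measurable
  also have "\<dots> = (\<integral>\<^sup>+z. \<integral>\<^sup>+y. f (step z y) \<partial>\<rho> \<partial>\<mu>)"
    by (subst rho.nn_integral_fst[symmetric]) auto
  finally show ?thesis .
qed

lemma integral_transition:
  fixes f :: "real \<times> real \<Rightarrow> real"
  assumes "prob_space \<mu>" and sets_mu [measurable_cong]: "sets \<mu> = sets plane"
    and [measurable]: "f \<in> borel_measurable plane" and B: "\<And>z. \<bar>f z\<bar> \<le> B"
  shows "(\<integral>z. f z \<partial>transition \<mu>) = (\<integral>z. \<integral>y. f (step z y) \<partial>\<rho> \<partial>\<mu>)"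
proof -
  interpret mu: prob_space \<mu> by fact
  interpret pair_prob_space \<mu> \<rho> ..
  have "(\<integral>z. f z \<partial>transition \<mu>) = (\<integral>w. f (case w of (z, y) \<Rightarrow> step z y) \<partial>(\<mu> \<Otimes>\<^sub>M \<rho>))"
    unfolding transition_def by (rule integral_distr) measurable
  also have "\<dots> = (\<integral>z. \<integral>y. f (case (z, y) of (z, y) \<Rightarrow> step z y) \<partial>\<rho> \<partial>\<mu>)"
    by (rule integral_fst'[symmetric], rule integrable_const_bound[where B=B]) (use B in auto)
  finally show ?thesis by simp
qed

lemma AE_transition:
  assumes "prob_space \<mu>" and [measurable_cong]: "sets \<mu> = sets plane"
    and [measurable]: "Measurable.pred plane Q"
    and ae: "AE z in \<mu>. AE y in \<rho>. Q (step z y)"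
  shows "AE z in transition \<mu>. Q z"
proof -
  interpret mu: prob_space \<mu> by fact
  interpret pair_prob_space \<mu> \<rho> ..
  have "AE w in \<mu> \<Otimes>\<^sub>M \<rho>. case w of (z, y) \<Rightarrow> Q (step z y)"
    using ae by (intro AE_pair_measure) (auto simp: case_prod_beta)
  then show ?thesis
    unfolding transition_def
    by (subst AE_distr_iff) (auto simp: case_prod_beta intro: measurable_step_kernel assms)
qed

text \<open>The first coordinate is a Markov chain by itself: its update does not look at the second
  one.\<close>

lemma fst_transition:
  assumes sets_mu [measurable_cong]: "sets \<mu> = sets plane"
  shows "distr (transition \<mu>) borel fst = distr (distr \<mu> borel fst \<Otimes>\<^sub>M \<rho>) borel (\<lambda>(s, y). step1 s y)"
proof -
  have "distr \<mu> borel fst \<Otimes>\<^sub>M distr \<rho> \<rho> (\<lambda>y. y) = distr (\<mu> \<Otimes>\<^sub>M \<rho>) (borel \<Otimes>\<^sub>M \<rho>) (\<lambda>(z, y). (fst z, y))"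
    by (rule pair_measure_distr) (auto simp: rho.sigma_finite_measure_axioms)
  then have "distr (distr \<mu> borel fst \<Otimes>\<^sub>M \<rho>) borel (\<lambda>(s, y). step1 s y) =
      distr (distr (\<mu> \<Otimes>\<^sub>M \<rho>) (borel \<Otimes>\<^sub>M \<rho>) (\<lambda>(z, y). (fst z, y))) borel (\<lambda>(s, y). step1 s y)"
    by simp
  also have "\<dots> = distr (\<mu> \<Otimes>\<^sub>M \<rho>) borel ((\<lambda>(s, y). step1 s y) \<circ> (\<lambda>(z, y). (fst z, y)))"
    by (rule distr_distr) measurable
  also have "\<dots> = distr (\<mu> \<Otimes>\<^sub>M \<rho>) borel (fst \<circ> (\<lambda>(z, y). step z y))"
    by (intro distr_cong) (auto simp: step_def)
  also have "\<dots> = distr (transition \<mu>) borel fst"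
    unfolding transition_def by (rule distr_distr[symmetric]) measurable
  finally show ?thesis by simp
qed

text \<open>Mean 0 of the noise kills the term linear in y, and second moment 1 leaves the ratio of
  the two variances.\<close>

lemma nn_integral_snd_step:
  "(\<integral>\<^sup>+y. ennreal (snd (step z y)) \<partial>\<rho>) =
    ennreal (\<alpha> + \<beta> * max \<alpha> (snd z) + \<gamma> * (max \<alpha> (fst z) / max \<alpha> (snd z) + \<delta>\<^sup>2))"
proof -
  define r where "r = sqrt (max \<alpha> (fst z) / max \<alpha> (snd z))"
  have r2: "r\<^sup>2 = max \<alpha> (fst z) / max \<alpha> (snd z)"
    unfolding r_def using max_alpha_pos[of "fst z"] max_alpha_pos[of "snd z"] by simp
  have eq: "snd (step z y) = (\<alpha> + \<beta> * max \<alpha> (snd z) + \<gamma> * \<delta>\<^sup>2) + (\<gamma> * r\<^sup>2) * y\<^sup>2 - (2 * \<gamma> * \<delta> * r) * y" for y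
    unfolding step_def r_def[symmetric] by (simp add: algebra_simps power2_eq_square)
  have int: "integrable \<rho> (\<lambda>y. snd (step z y))"
    unfolding eq using integrable_id integrable_sq by auto
  have "(\<integral>\<^sup>+y. ennreal (snd (step z y)) \<partial>\<rho>) = ennreal (\<integral>y. snd (step z y) \<partial>\<rho>)"
  proof (rule nn_integral_eq_integral[OF int])
    have "0 \<le> snd (step z y)" for y using step_ge(2)[of z y] alpha_pos by linarith
    then show "AE y in \<rho>. 0 \<le> snd (step z y)" by simp
  qed
  also have "(\<integral>y. snd (step z y) \<partial>\<rho>) = (\<alpha> + \<beta> * max \<alpha> (snd z) + \<gamma> * \<delta>\<^sup>2) + \<gamma> * r\<^sup>2"
    unfolding eq using integrable_id integrable_sq mean second_moment by (simp add: rho.prob_space)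
  finally show ?thesis unfolding r2 by (simp add: algebra_simps)
qed

text \<open>The majorant is free of the state and integrable in y; it controls ln |A| from
  above.\<close>

lemma abs_factor_le: "\<bar>factor z y\<bar> \<le> \<beta> + \<gamma> / \<alpha> * y\<^sup>2 + 2 * \<gamma> * \<bar>\<delta>\<bar> / \<alpha> * \<bar>y\<bar>"
proof -
  define x r where "x = max \<alpha> (snd z)" and "r = 1 + sqrt (max \<alpha> (fst z) / x)"
  have x: "\<alpha> \<le> x" "0 < x" unfolding x_def using max_alpha_pos by auto
  have r: "1 \<le> r" unfolding r_def using x(2) max_alpha_pos[of "fst z"] by simp
  have xr: "\<alpha> \<le> x * r" using x r mult_mono[of \<alpha> x 1 r] alpha_pos by simp
  have "\<bar>factor z y\<bar> \<le> \<bar>\<beta>\<bar> + \<bar>\<gamma> * y\<^sup>2 / x\<bar> + \<bar>2 * \<gamma> * \<delta> * y / (x * r)\<bar>"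
    unfolding factor_def x_def[symmetric] r_def[symmetric]
    by (rule order_trans[OF abs_triangle_ineq add_right_mono[OF abs_triangle_ineq4]])
  also have "\<dots> = \<beta> + \<gamma> * y\<^sup>2 / x + 2 * \<gamma> * \<bar>\<delta>\<bar> * \<bar>y\<bar> / (x * r)"
    using beta_pos gamma_pos x r by (simp add: abs_mult)
  also have "\<dots> \<le> \<beta> + \<gamma> * y\<^sup>2 / \<alpha> + 2 * \<gamma> * \<bar>\<delta>\<bar> * \<bar>y\<bar> / \<alpha>"
    using gamma_pos alpha_pos x xr r by (intro add_mono divide_left_mono order_refl mult_pos_pos) auto
  finally show ?thesis by simp
qed

text \<open>A bounded continuous substitute for ln |w|, finite also at w = 0. The level 3m is the
  one at which \<open>log_deficit_factor_le\<close> estimates the deficit.\<close>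

definition clipped_log :: "real \<Rightarrow> real \<Rightarrow> real" where
  "clipped_log m w = ln (max (exp (- 3 * m)) (min (exp (3 * m)) \<bar>w\<bar>))"

lemma clipped_log_bound:
  assumes "0 \<le> m"
  shows "\<bar>clipped_log m w\<bar> \<le> 3 * m"
proof -
  let ?t = "max (exp (- 3 * m)) (min (exp (3 * m)) \<bar>w\<bar>)"
  have "exp (- 3 * m) \<le> ?t" by simp
  moreover have "?t \<le> exp (3 * m)" using assms by simp
  moreover have "0 < ?t" by (simp add: less_max_iff_disj)
  ultimately have "ln (exp (- 3 * m)) \<le> ln ?t" "ln ?t \<le> ln (exp (3 * m))"
    by (subst ln_le_cancel_iff; simp)+
  then show ?thesis unfolding clipped_log_def abs_le_iff by simp
qed

text \<open>Clipping from above only lowers the logarithm; clipping from below raises it by exactly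
  the deficit.\<close>

lemma clipped_log_le:
  assumes "0 \<le> m"
  shows "clipped_log m w - log_deficit (3 * m) w \<le> ln \<bar>w\<bar>"
proof (cases "w = 0")
  \<comment> \<open>Since ln 0 = 0, the deficit is 0 here and the clipped value is - 3 m \<le>
    0.\<close>
  case True
  then show ?thesis using assms by (simp add: clipped_log_def log_deficit_def min_absorb2)
next
  case False
  show ?thesis
  proof (cases "\<bar>w\<bar> < exp (- 3 * m)")
    case True
    moreover have "exp (- 3 * m) \<le> exp (3 * m)" using assms by simp
    ultimately have "min (exp (3 * m)) \<bar>w\<bar> = \<bar>w\<bar>" "max (exp (- 3 * m)) \<bar>w\<bar> = exp (- 3 * m)" by linarith+
    then have "clipped_log m w = - 3 * m" by (simp add: clipped_log_def)
    then show ?thesis unfolding log_deficit_def by linarith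
  next
    case False
    have "0 < \<bar>w\<bar>" using \<open>w \<noteq> 0\<close> by simp
    then have "clipped_log m w \<le> ln \<bar>w\<bar>"
      unfolding clipped_log_def using False by (subst ln_le_cancel_iff) (auto simp: less_max_iff_disj)
    moreover have "0 \<le> log_deficit (3 * m) w" by (simp add: log_deficit_def)
    ultimately show ?thesis by linarith
  qed
qed

lemma continuous_on_clipped_log: "continuous_on UNIV (clipped_log m)"
proof -
  have "max (exp (- 3 * m)) (min (exp (3 * m)) \<bar>w\<bar>) \<noteq> 0" for w
  proof -
    have "0 < max (exp (- 3 * m)) (min (exp (3 * m)) \<bar>w\<bar>)" by (simp add: less_max_iff_disj)
    then show ?thesis by linarith
  qed
  then show ?thesis
    unfolding clipped_log_def by (intro continuous_intros) auto
qed

text \<open>Weak convergence will be available for laws of the state alone, so the noise is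
  integrated out beforehand.\<close>

definition mean_clipped_log :: "real \<Rightarrow> real \<times> real \<Rightarrow> real" where
  "mean_clipped_log m z = (\<integral>y. clipped_log m (factor z y) \<partial>\<rho>)"

lemma continuous_on_clipped_log_factor: "continuous_on UNIV (\<lambda>w. clipped_log m (factor (fst w) (snd w)))"
  using continuous_on_compose2[OF continuous_on_clipped_log continuous_on_factor] by (simp add: case_prod_beta)

lemma measurable_clipped_log [measurable]: "clipped_log m \<in> borel_measurable borel"
  by (rule borel_measurable_continuous_onI[OF continuous_on_clipped_log])

lemma continuous_on_mean_clipped_log:
  assumes "0 \<le> m"
  shows "continuous_on UNIV (mean_clipped_log m)"
  using continuous_on_integral_kernel[OF prob_rho sets_rho continuous_on_clipped_log_factor,
      of m "3 * m"] clipped_log_bound[OF assms]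
  by (simp add: mean_clipped_log_def[abs_def])

lemma mean_clipped_log_bound:
  assumes "0 \<le> m"
  shows "\<bar>mean_clipped_log m z\<bar> \<le> 3 * m"
  using bounded_integral_kernel[OF prob_rho, of "\<lambda>w. clipped_log m (factor (fst w) (snd w))" "3 * m" z]
    clipped_log_bound[OF assms] by (simp add: mean_clipped_log_def)

lemma measurable_mean_clipped_log [measurable]:
  "mean_clipped_log m \<in> borel_measurable plane"
  unfolding mean_clipped_log_def by measurable

end

text \<open>P stands for the stationary law of the squared volatility. Starting the first coordinate
  from P instead of from a point keeps its law equal to P at all times, so only the moments of the
  second coordinate need an estimate.\<close>

locale vgarch_marginal = vgarch_chain +
  fixes P :: "real measure"
  assumes prob_P: "prob_space P" and sets_P [measurable_cong]: "sets P = sets borel"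
    and P_ge: "AE s in P. \<alpha> \<le> s" and P_mean: "integrable P (\<lambda>s. s)"
    and P_invariant: "distr (P \<Otimes>\<^sub>M \<rho>) borel (\<lambda>(s, y). step1 s y) = P"
begin

sublocale marg: prob_space P by (rule prob_P)

definition admissible :: "(real \<times> real) measure \<Rightarrow> bool" where
  "admissible \<mu> \<longleftrightarrow> prob_space \<mu> \<and> sets \<mu> = sets plane \<and> distr \<mu> borel fst = P \<and>
     (AE z in \<mu>. \<alpha> \<le> fst z \<and> \<alpha> \<le> snd z)"

lemma admissible_transition:
  assumes "admissible \<mu>"
  shows "admissible (transition \<mu>)"
proof -
  have mu: "prob_space \<mu>" "sets \<mu> = sets plane" "distr \<mu> borel fst = P"
    using assms by (auto simp: admissible_def)
  have "AE z in transition \<mu>. \<alpha> \<le> fst z \<and> \<alpha> \<le> snd z"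
    by (rule AE_transition[OF mu(1,2)]) (auto intro!: step_ge)
  then show ?thesis
    unfolding admissible_def using mu
    by (simp add: prob_space_transition fst_transition P_invariant)
qed

definition P_expect :: real where "P_expect = (\<integral>s. s \<partial>P)"

lemma P_expect_nonneg: "0 \<le> P_expect"
  unfolding P_expect_def by (rule integral_nonneg_AE) (use P_ge alpha_pos in auto)

lemma nn_integral_fst_admissible:
  assumes "admissible \<mu>"
  shows "(\<integral>\<^sup>+z. ennreal (fst z) \<partial>\<mu>) = ennreal P_expect"
proof -
  have [measurable_cong]: "sets \<mu> = sets plane" and fst: "distr \<mu> borel fst = P"
    using assms by (auto simp: admissible_def)
  have "(\<integral>\<^sup>+z. ennreal (fst z) \<partial>\<mu>) = (\<integral>\<^sup>+s. ennreal s \<partial>distr \<mu> borel fst)"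
    by (subst nn_integral_distr) auto
  also have "\<dots> = ennreal P_expect"
    unfolding fst P_expect_def using P_ge alpha_pos
    by (intro nn_integral_eq_integral P_mean) auto
  finally show ?thesis .
qed

text \<open>A drift inequality. Since the second coordinate is at least \<alpha>, the term \<gamma>
  s / x is at most \<gamma> s / \<alpha>, whose mean is fixed by the first marginal; what remains
  contracts by \<beta>.\<close>

lemma moment_transition:
  assumes adm: "admissible \<mu>" and m: "(\<integral>\<^sup>+z. ennreal (snd z) \<partial>\<mu>) \<le> ennreal m" "0 \<le> m"
  shows "(\<integral>\<^sup>+z. ennreal (snd z) \<partial>transition \<mu>) \<le>
    ennreal (\<alpha> + \<gamma> * \<delta>\<^sup>2 + \<gamma> / \<alpha> * P_expect + \<beta> * m)"
proof -
  have sets_mu [measurable_cong]: "sets \<mu> = sets plane"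
    and ge: "AE z in \<mu>. \<alpha> \<le> fst z \<and> \<alpha> \<le> snd z" and "prob_space \<mu>"
    using adm by (auto simp: admissible_def)
  interpret mu: prob_space \<mu> by fact
  have c: "0 \<le> \<alpha> + \<gamma> * \<delta>\<^sup>2" "0 \<le> \<gamma> / \<alpha>" "0 \<le> \<beta>" using alpha_pos gamma_pos beta_pos by auto
  have "(\<integral>\<^sup>+z. ennreal (snd z) \<partial>transition \<mu>) =
      (\<integral>\<^sup>+z. ennreal (\<alpha> + \<beta> * max \<alpha> (snd z) + \<gamma> * (max \<alpha> (fst z) / max \<alpha> (snd z) + \<delta>\<^sup>2)) \<partial>\<mu>)"
    by (subst nn_integral_transition) (auto simp: sets_mu nn_integral_snd_step)
  also have "\<dots> \<le> (\<integral>\<^sup>+z. ennreal (\<alpha> + \<gamma> * \<delta>\<^sup>2) + ennreal (\<gamma> / \<alpha>) * ennreal (fst z) + ennreal \<beta> * ennreal (snd z) \<partial>\<mu>)"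
  proof (rule nn_integral_mono_AE)
    show "AE z in \<mu>. ennreal (\<alpha> + \<beta> * max \<alpha> (snd z) + \<gamma> * (max \<alpha> (fst z) / max \<alpha> (snd z) + \<delta>\<^sup>2)) \<le>
      ennreal (\<alpha> + \<gamma> * \<delta>\<^sup>2) + ennreal (\<gamma> / \<alpha>) * ennreal (fst z) + ennreal \<beta> * ennreal (snd z)"
      using ge
    proof eventually_elim
      case (elim z)
      then have pos: "0 < fst z" "0 < snd z" using alpha_pos by auto
      have "fst z / snd z \<le> fst z / \<alpha>"
        using elim pos alpha_pos by (intro divide_left_mono) auto
      then have "\<gamma> * (fst z / snd z) \<le> \<gamma> / \<alpha> * fst z"
        using mult_left_mono[of "fst z / snd z" "fst z / \<alpha>" \<gamma>] gamma_pos by simp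
      then have "\<alpha> + \<beta> * snd z + \<gamma> * (fst z / snd z + \<delta>\<^sup>2) \<le> (\<alpha> + \<gamma> * \<delta>\<^sup>2) + \<gamma> / \<alpha> * fst z + \<beta> * snd z"
        by (simp add: distrib_left)
      then have "ennreal (\<alpha> + \<beta> * snd z + \<gamma> * (fst z / snd z + \<delta>\<^sup>2)) \<le>
          ennreal ((\<alpha> + \<gamma> * \<delta>\<^sup>2) + \<gamma> / \<alpha> * fst z + \<beta> * snd z)"
        by (rule ennreal_leI)
      also have "\<dots> = ennreal (\<alpha> + \<gamma> * \<delta>\<^sup>2) + ennreal (\<gamma> / \<alpha>) * ennreal (fst z) + ennreal \<beta> * ennreal (snd z)"
        using c pos by (simp only: ennreal_plus ennreal_mult add_nonneg_nonneg mult_nonneg_nonneg less_imp_le)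
      finally show ?case using elim by (simp add: max_absorb2)
    qed
  qed
  also have "\<dots> = ennreal (\<alpha> + \<gamma> * \<delta>\<^sup>2) + ennreal (\<gamma> / \<alpha>) * ennreal P_expect + ennreal \<beta> * (\<integral>\<^sup>+z. ennreal (snd z) \<partial>\<mu>)"
    by (simp add: nn_integral_add nn_integral_cmult mu.emeasure_space_1 nn_integral_fst_admissible[OF adm])
  also have "\<dots> \<le> ennreal (\<alpha> + \<gamma> * \<delta>\<^sup>2) + ennreal (\<gamma> / \<alpha>) * ennreal P_expect + ennreal \<beta> * ennreal m"
    by (intro add_mono mult_left_mono m order_refl) auto
  also have "\<dots> = ennreal (\<alpha> + \<gamma> * \<delta>\<^sup>2 + \<gamma> / \<alpha> * P_expect + \<beta> * m)"
    using c m(2) P_expect_nonneg by (simp only: ennreal_plus ennreal_mult add_nonneg_nonneg mult_nonneg_nonneg)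
  finally show ?thesis .
qed

text \<open>The unit initial gap has logarithm 0, so the mean of \<open>log_gap\<close> after k
  steps is exactly a sum of k mean logarithms of the factor.\<close>

primrec chain_law :: "nat \<Rightarrow> (real \<times> real) measure" where
  "chain_law 0 = distr P plane (\<lambda>s. (s, s + 1))"
| "chain_law (Suc k) = transition (chain_law k)"

abbreviation joint_law :: "nat \<Rightarrow> ((real \<times> real) \<times> real) measure" where
  "joint_law k \<equiv> chain_law k \<Otimes>\<^sub>M \<rho>"

lemma admissible_chain_law: "admissible (chain_law k)"
proof (induction k)
  case 0
  have [measurable]: "(\<lambda>s. (s, s + 1)) \<in> P \<rightarrow>\<^sub>M borel \<Otimes>\<^sub>M (borel :: real measure)" by measurable
  have "AE z in chain_law 0. \<alpha> \<le> fst z \<and> \<alpha> \<le> snd z"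
    unfolding chain_law.simps by (subst AE_distr_iff) (use P_ge in auto)
  moreover have "distr (chain_law 0) borel fst = P"
    by (simp add: distr_distr comp_def distr_id2 sets_P)
  ultimately show ?case
    unfolding admissible_def by (auto intro: marg.prob_space_distr)
next
  case (Suc k)
  then show ?case by (simp add: admissible_transition)
qed

lemma prob_chain_law: "prob_space (chain_law k)"
  and sets_chain_law [measurable_cong]: "sets (chain_law k) = sets plane"
  and chain_law_ge: "AE z in chain_law k. \<alpha> \<le> fst z \<and> \<alpha> \<le> snd z"
  using admissible_chain_law[of k] by (auto simp: admissible_def)

text \<open>The first bracket is the initial mean of s + 1; the quotient is the fixed point of the
  affine recursion in \<open>moment_transition\<close>. As \<beta> < 1, that recursion does not lead
  above their sum.\<close>

definition moment_bound :: real where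
  "moment_bound = (P_expect + 1) + (\<alpha> + \<gamma> * \<delta>\<^sup>2 + \<gamma> / \<alpha> * P_expect) / (1 - \<beta>)"

lemma moment_bound_nonneg: "0 \<le> moment_bound"
  unfolding moment_bound_def using P_expect_nonneg alpha_pos beta_less_1 gamma_pos by simp

lemma chain_law_moment: "(\<integral>\<^sup>+z. ennreal (snd z) \<partial>chain_law k) \<le> ennreal moment_bound"
proof (induction k)
  case 0
  have "(\<integral>\<^sup>+z. ennreal (snd z) \<partial>chain_law 0) = (\<integral>\<^sup>+s. ennreal (s + 1) \<partial>P)"
    by (simp add: nn_integral_distr)
  also have "\<dots> = ennreal (\<integral>s. s + 1 \<partial>P)"
    using P_ge alpha_pos by (intro nn_integral_eq_integral) (auto intro: P_mean)
  also have "(\<integral>s. s + 1 \<partial>P) = P_expect + 1"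
    using P_mean by (simp add: P_expect_def marg.prob_space)
  also have "ennreal (P_expect + 1) \<le> ennreal moment_bound"
    unfolding moment_bound_def using P_expect_nonneg alpha_pos beta_less_1 gamma_pos
    by (intro ennreal_leI) simp
  finally show ?case .
next
  case (Suc k)
  define c where "c = \<alpha> + \<gamma> * \<delta>\<^sup>2 + \<gamma> / \<alpha> * P_expect"
  have "c + \<beta> * moment_bound = c + \<beta> * c / (1 - \<beta>) + \<beta> * (P_expect + 1)"
    unfolding moment_bound_def c_def[symmetric] by (simp add: algebra_simps)
  also have "c + \<beta> * c / (1 - \<beta>) = c / (1 - \<beta>)"
    using beta_less_1 by (simp add: field_simps)
  also have "c / (1 - \<beta>) + \<beta> * (P_expect + 1) \<le> moment_bound"
    unfolding moment_bound_def c_def[symmetric]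
    using mult_right_mono[of \<beta> 1 "P_expect + 1"] beta_less_1 P_expect_nonneg by simp
  finally have "c + \<beta> * moment_bound \<le> moment_bound" .
  then show ?case
    using moment_transition[OF admissible_chain_law Suc moment_bound_nonneg]
    unfolding c_def[symmetric] by (auto intro: order_trans ennreal_leI)
qed

definition deficit_bound :: "real \<Rightarrow> real" where
  "deficit_bound m = exp (- m) * (moment_bound / \<gamma> + 2 * deficit_const)"

lemma measurable_log_deficit [measurable]: "log_deficit m \<in> borel_measurable borel"
  unfolding log_deficit_def by measurable

text \<open>The bound is free of k and decays exponentially in m: uniform integrability of the
  negative part of ln |A| along the chain.\<close>

lemma nn_integral_log_deficit_chain:
  assumes "0 \<le> m"
  shows "(\<integral>\<^sup>+z. \<integral>\<^sup>+y. log_deficit (3 * m) (factor z y) \<partial>\<rho> \<partial>chain_law k) \<le> ennreal (deficit_bound m)"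
proof -
  interpret mu: prob_space "chain_law k" by (rule prob_chain_law)
  have c: "0 \<le> exp (- m) / \<gamma>" "0 \<le> 2 * deficit_const * exp (- m)"
    using gamma_pos deficit_const_nonneg by auto
  have "(\<integral>\<^sup>+z. \<integral>\<^sup>+y. log_deficit (3 * m) (factor z y) \<partial>\<rho> \<partial>chain_law k) \<le>
      (\<integral>\<^sup>+z. ennreal (exp (- m) / \<gamma>) * ennreal (snd z) + ennreal (2 * deficit_const * exp (- m)) \<partial>chain_law k)"
  proof (rule nn_integral_mono_AE)
    show "AE z in chain_law k. (\<integral>\<^sup>+y. log_deficit (3 * m) (factor z y) \<partial>\<rho>) \<le>
        ennreal (exp (- m) / \<gamma>) * ennreal (snd z) + ennreal (2 * deficit_const * exp (- m))"
      using chain_law_ge[of k]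
    proof eventually_elim
      case (elim z)
      then have "max \<alpha> (snd z) = snd z" "0 \<le> snd z" using alpha_pos by auto
      then show ?case
        using nn_integral_log_deficit_factor_le[OF assms, of z] c
        by (simp only: ennreal_plus ennreal_mult mult_nonneg_nonneg)
    qed
  qed
  also have "\<dots> = ennreal (exp (- m) / \<gamma>) * (\<integral>\<^sup>+z. ennreal (snd z) \<partial>chain_law k) + ennreal (2 * deficit_const * exp (- m))"
    by (simp add: nn_integral_add nn_integral_cmult mu.emeasure_space_1)
  also have "\<dots> \<le> ennreal (exp (- m) / \<gamma>) * ennreal moment_bound + ennreal (2 * deficit_const * exp (- m))"
    by (intro add_mono mult_left_mono chain_law_moment order_refl) auto
  also have "\<dots> = ennreal (exp (- m) / \<gamma> * moment_bound + 2 * deficit_const * exp (- m))"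
    using c moment_bound_nonneg by (simp only: ennreal_plus ennreal_mult mult_nonneg_nonneg)
  also have "exp (- m) / \<gamma> * moment_bound + 2 * deficit_const * exp (- m) = deficit_bound m"
    by (simp add: deficit_bound_def algebra_simps)
  finally show ?thesis .
qed

lemma deficit_bound_nonneg: "0 \<le> deficit_bound m"
  unfolding deficit_bound_def using moment_bound_nonneg gamma_pos deficit_const_nonneg by simp

lemma integrable_log_deficit_chain:
  assumes "0 \<le> m"
  shows "integrable (joint_law k) (\<lambda>(z, y). log_deficit (3 * m) (factor z y))"
    and "(\<integral>(z, y). log_deficit (3 * m) (factor z y) \<partial>joint_law k) \<le> deficit_bound m"
proof -
  have nonneg: "0 \<le> log_deficit m w" for m w by (simp add: log_deficit_def)
  have "(\<integral>\<^sup>+w. ennreal (case w of (z, y) \<Rightarrow> log_deficit (3 * m) (factor z y)) \<partial>joint_law k) =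
     (\<integral>\<^sup>+z. \<integral>\<^sup>+y. log_deficit (3 * m) (factor z y) \<partial>\<rho> \<partial>chain_law k)"
    by (subst rho.nn_integral_fst[symmetric]) auto
  then have le: "(\<integral>\<^sup>+w. ennreal (case w of (z, y) \<Rightarrow> log_deficit (3 * m) (factor z y)) \<partial>joint_law k) \<le> ennreal (deficit_bound m)"
    using nn_integral_log_deficit_chain[OF assms, of k] by simp
  show "integrable (joint_law k) (\<lambda>(z, y). log_deficit (3 * m) (factor z y))"
    using le by (intro integrableI_nonneg) (auto simp: nonneg intro: le_less_trans)
  show "(\<integral>(z, y). log_deficit (3 * m) (factor z y) \<partial>joint_law k) \<le> deficit_bound m"
    using le deficit_bound_nonneg by (intro integral_real_bounded) auto
qed

text \<open>Above, ln |A| \<le> |A| and A has an integrable majorant in the noise; below, - ln |A|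
  is at most the deficit at level 0.\<close>

lemma integrable_ln_factor_chain:
  "integrable (joint_law k) (\<lambda>(z, y). ln \<bar>factor z y\<bar>)"
proof -
  interpret mu: prob_space "chain_law k" by (rule prob_chain_law)
  interpret pair_prob_space "chain_law k" \<rho> ..
  let ?h = "\<lambda>y. \<beta> + \<gamma> / \<alpha> * y\<^sup>2 + 2 * \<gamma> * \<bar>\<delta>\<bar> / \<alpha> * \<bar>y\<bar>"
  have "integrable \<rho> ?h" using integrable_id integrable_sq by auto
  moreover have "distr (joint_law k) \<rho> snd = \<rho>"
  proof (rule measure_eqI)
    fix A assume "A \<in> sets (distr (joint_law k) \<rho> snd)"
    then have A: "A \<in> sets \<rho>" by simp
    have "snd -` A \<inter> space (joint_law k) = space (chain_law k) \<times> A"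
      using sets.sets_into_space[OF A] by (auto simp: space_pair_measure)
    then show "emeasure (distr (joint_law k) \<rho> snd) A = emeasure \<rho> A"
      using A by (simp add: emeasure_distr rho.emeasure_pair_measure_Times mu.emeasure_space_1)
  qed simp
  ultimately have "integrable (distr (joint_law k) \<rho> snd) ?h" by simp
  then have "integrable (joint_law k) (\<lambda>w. ?h (snd w))"
    by (subst (asm) integrable_distr_eq) auto
  moreover have "integrable (joint_law k) (\<lambda>w. log_deficit 0 (factor (fst w) (snd w)))"
    using integrable_log_deficit_chain(1)[of 0 k] by (simp add: split_beta')
  ultimately have "integrable (joint_law k) (\<lambda>w. ?h (snd w) + log_deficit 0 (factor (fst w) (snd w)))"
    by (rule Bochner_Integration.integrable_add)
  then show ?thesis
  proof (rule Bochner_Integration.integrable_bound)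
    show "AE w in joint_law k. norm (case w of (z, y) \<Rightarrow> ln \<bar>factor z y\<bar>) \<le>
        norm (?h (snd w) + log_deficit 0 (factor (fst w) (snd w)))"
    proof (rule AE_I2)
      fix w
      let ?a = "factor (fst w) (snd w)"
      have "ln \<bar>?a\<bar> \<le> \<bar>?a\<bar>"
        using ln_le_minus_one[of "\<bar>?a\<bar>"] by (cases "?a = 0") auto
      moreover have "- ln \<bar>?a\<bar> \<le> log_deficit 0 ?a" "0 \<le> log_deficit 0 ?a" by (auto simp: log_deficit_def)
      moreover note abs_factor_le[of "fst w" "snd w"]
      ultimately show "norm (case w of (z, y) \<Rightarrow> ln \<bar>factor z y\<bar>) \<le>
          norm (?h (snd w) + log_deficit 0 (factor (fst w) (snd w)))"
        by (simp only: real_norm_def case_prod_beta) linarith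
    qed
  qed measurable
qed

section \<open>Growth of the logarithmic gap\<close>

definition log_gap :: "real \<times> real \<Rightarrow> real" where
  "log_gap z = ln \<bar>snd z - fst z\<bar>"

text \<open>The gap is multiplied by an almost surely nonzero factor. This is what makes the
  logarithm additive along the chain, in view of ln 0 = 0.\<close>

lemma chain_law_off_diagonal: "AE z in chain_law k. fst z \<noteq> snd z"
proof (induction k)
  case 0
  show ?case unfolding chain_law.simps by (subst AE_distr_iff) auto
next
  case (Suc k)
  show ?case
    unfolding chain_law.simps
  proof (rule AE_transition[OF prob_chain_law sets_chain_law])
    show "AE z in chain_law k. AE y in \<rho>. fst (step z y) \<noteq> snd (step z y)"
      using Suc chain_law_ge[of k]
    proof eventually_elim
      case (elim z)
      show ?case using AE_factor_nonzero[of z]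
      proof eventually_elim
        case (elim y)
        then have "snd (step z y) - fst (step z y) \<noteq> 0"
          using \<open>fst z \<noteq> snd z\<close> \<open>\<alpha> \<le> fst z \<and> \<alpha> \<le> snd z\<close> unfolding step_diff by simp
        then show ?case by auto
      qed
    qed
  qed measurable
qed

text \<open>Taking logarithms in \<open>step_diff\<close> turns one step into the addition of ln
  |A|, and both summands are integrable.\<close>

lemma log_gap_chain_law:
  "integrable (chain_law k) log_gap \<and>
   (\<integral>z. log_gap z \<partial>chain_law k) = (\<Sum>i<k. \<integral>(z, y). ln \<bar>factor z y\<bar> \<partial>joint_law i)"
proof (induction k)
  case 0
  have [measurable]: "log_gap \<in> borel_measurable plane" unfolding log_gap_def by measurable
  have eq: "log_gap (s, s + 1) = 0" for s by (simp add: log_gap_def)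
  show ?case by (simp add: integrable_distr_eq integral_distr eq)
next
  case (Suc k)
  interpret mu: prob_space "chain_law k" by (rule prob_chain_law)
  interpret pair_prob_space "chain_law k" \<rho> ..
  have [measurable]: "log_gap \<in> borel_measurable plane" unfolding log_gap_def by measurable
  have g1: "integrable (joint_law k) (\<lambda>w. log_gap (fst w))"
    using Suc by (subst integrable_distr_eq[of fst "joint_law k" "chain_law k", symmetric, unfolded rho.distr_pair_fst]) auto
  have g2: "(\<integral>w. log_gap (fst w) \<partial>joint_law k) = (\<integral>z. log_gap z \<partial>chain_law k)"
    by (subst integral_distr[of fst "joint_law k" "chain_law k", symmetric, unfolded rho.distr_pair_fst]) auto
  have g3: "integrable (joint_law k) (\<lambda>w. ln \<bar>factor (fst w) (snd w)\<bar>)"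
    using integrable_ln_factor_chain[of k] by (simp add: split_beta')
  have "AE w in joint_law k. case w of (z, y) \<Rightarrow>
      log_gap (step z y) = log_gap z + ln \<bar>factor z y\<bar>"
  proof (rule AE_pair_measure)
    show "AE z in chain_law k. AE y in \<rho>. case (z, y) of (z, y) \<Rightarrow>
        log_gap (step z y) = log_gap z + ln \<bar>factor z y\<bar>"
      using chain_law_off_diagonal[of k] chain_law_ge[of k]
    proof eventually_elim
      case (elim z)
      show ?case using AE_factor_nonzero[of z]
      proof eventually_elim
        case (elim y)
        then show ?case
          using \<open>fst z \<noteq> snd z\<close> \<open>\<alpha> \<le> fst z \<and> \<alpha> \<le> snd z\<close>
          unfolding log_gap_def step_diff by (simp add: abs_mult ln_mult max_absorb2)
      qed
    qed
  qed (auto simp: case_prod_beta)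
  then have ae: "AE w in joint_law k. log_gap (case w of (z, y) \<Rightarrow> step z y) =
      log_gap (fst w) + ln \<bar>factor (fst w) (snd w)\<bar>"
    by (simp add: case_prod_beta)
  have i: "integrable (joint_law k) (\<lambda>w. log_gap (case w of (z, y) \<Rightarrow> step z y))"
    by (subst integrable_cong_AE[OF _ _ ae]) (auto intro: g1 g3)
  have "integrable (chain_law (Suc k)) log_gap"
    unfolding chain_law.simps transition_def
    by (subst integrable_distr_eq) (auto intro: i measurable_step_kernel sets_chain_law)
  moreover have "(\<integral>z. log_gap z \<partial>chain_law (Suc k)) = (\<integral>w. log_gap (case w of (z, y) \<Rightarrow> step z y) \<partial>joint_law k)"
    unfolding chain_law.simps transition_def
    by (rule integral_distr) (auto intro: measurable_step_kernel sets_chain_law)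
  moreover have "\<dots> = (\<integral>w. log_gap (fst w) + ln \<bar>factor (fst w) (snd w)\<bar> \<partial>joint_law k)"
    by (rule integral_cong_AE[OF _ _ ae]) measurable
  moreover have "\<dots> = (\<integral>z. log_gap z \<partial>chain_law k) + (\<integral>(z, y). ln \<bar>factor z y\<bar> \<partial>joint_law k)"
    using g1 g3 by (simp add: g2 split_beta')
  ultimately show ?case using Suc by simp
qed

lemma integrable_coordinates_chain_law:
  "integrable (chain_law k) fst" "(\<integral>z. fst z \<partial>chain_law k) = P_expect"
  "integrable (chain_law k) snd" "(\<integral>z. snd z \<partial>chain_law k) \<le> moment_bound"
proof -
  have ge: "AE z in chain_law k. 0 \<le> fst z" "AE z in chain_law k. 0 \<le> snd z"
    using chain_law_ge[of k] alpha_pos by auto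
  have [measurable]: "fst \<in> borel_measurable (chain_law k)" "snd \<in> borel_measurable (chain_law k)"
    by measurable
  show 1: "integrable (chain_law k) fst"
    using ge nn_integral_fst_admissible[OF admissible_chain_law, of k] by (intro integrableI_nonneg) auto
  show "integrable (chain_law k) snd"
    using ge chain_law_moment[of k] by (intro integrableI_nonneg) (auto intro: le_less_trans)
  show "(\<integral>z. fst z \<partial>chain_law k) = P_expect"
    using ge nn_integral_fst_admissible[OF admissible_chain_law, of k] P_expect_nonneg
    by (subst integral_eq_nn_integral) auto
  show "(\<integral>z. snd z \<partial>chain_law k) \<le> moment_bound"
    using moment_bound_nonneg chain_law_moment[of k] by (intro integral_real_bounded) auto
qed

text \<open>The logarithm is at most the gap itself, and first moments are bounded in k; so the
  logarithmic gap cannot grow linearly.\<close>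

lemma log_gap_le: "(\<integral>z. log_gap z \<partial>chain_law k) \<le> P_expect + moment_bound"
proof -
  have "(\<integral>z. log_gap z \<partial>chain_law k) \<le> (\<integral>z. fst z + snd z \<partial>chain_law k)"
  proof (rule integral_mono_AE)
    show "integrable (chain_law k) log_gap" using log_gap_chain_law by simp
    show "integrable (chain_law k) (\<lambda>z. fst z + snd z)"
      using integrable_coordinates_chain_law by (intro Bochner_Integration.integrable_add) auto
    show "AE z in chain_law k. log_gap z \<le> fst z + snd z"
      using chain_law_ge[of k]
    proof eventually_elim
      case (elim z)
      have "log_gap z \<le> \<bar>snd z - fst z\<bar>"
        unfolding log_gap_def using ln_le_minus_one[of "\<bar>snd z - fst z\<bar>"] by (cases "snd z = fst z") auto
      then show ?case using elim alpha_pos by linarith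
    qed
  qed
  also have "\<dots> = (\<integral>z. fst z \<partial>chain_law k) + (\<integral>z. snd z \<partial>chain_law k)"
    using integrable_coordinates_chain_law[of k] by (intro Bochner_Integration.integral_add) auto
  finally show ?thesis using integrable_coordinates_chain_law[of k] by linarith
qed

text \<open>Replacing each logarithm by its clipped version costs \<open>deficit_bound m\<close> per
  step, while the sum of the true logarithms stays bounded. After division by k only the per-step
  cost survives in the limit.\<close>

lemma sum_mean_clipped_log_le:
  assumes "0 \<le> m"
  shows "(\<Sum>i<k. \<integral>z. mean_clipped_log m z \<partial>chain_law i) \<le> real k * deficit_bound m + (P_expect + moment_bound)"
proof -
  have "(\<integral>z. mean_clipped_log m z \<partial>chain_law i) - deficit_bound m \<le>
      (\<integral>(z, y). ln \<bar>factor z y\<bar> \<partial>joint_law i)" for i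
  proof -
    interpret mu: prob_space "chain_law i" by (rule prob_chain_law)
    interpret pair_prob_space "chain_law i" \<rho> ..
    have int: "integrable (joint_law i) (\<lambda>(z, y). clipped_log m (factor z y))"
      by (rule integrable_const_bound[where B="3 * m"]) (use clipped_log_bound[OF assms] in auto)
    have "(\<integral>z. mean_clipped_log m z \<partial>chain_law i) =
        (\<integral>(z, y). clipped_log m (factor z y) \<partial>joint_law i)"
      unfolding mean_clipped_log_def using integral_fst'[OF int] by simp
    then have "(\<integral>z. mean_clipped_log m z \<partial>chain_law i) - deficit_bound m \<le>
        (\<integral>(z, y). clipped_log m (factor z y) \<partial>joint_law i) -
        (\<integral>(z, y). log_deficit (3 * m) (factor z y) \<partial>joint_law i)"
      using integrable_log_deficit_chain(2)[OF assms, of i] by simp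
    also have "\<dots> = (\<integral>w. (case w of (z, y) \<Rightarrow> clipped_log m (factor z y)) -
        (case w of (z, y) \<Rightarrow> log_deficit (3 * m) (factor z y)) \<partial>joint_law i)"
      by (rule Bochner_Integration.integral_diff[symmetric]) (rule int, rule integrable_log_deficit_chain(1)[OF assms])
    also have "\<dots> \<le> (\<integral>(z, y). ln \<bar>factor z y\<bar> \<partial>joint_law i)"
      using clipped_log_le[OF assms]
      by (intro integral_mono Bochner_Integration.integrable_diff int integrable_log_deficit_chain(1)[OF assms]
          integrable_ln_factor_chain) (auto split: prod.split)
    finally show ?thesis .
  qed
  then have "(\<Sum>i<k. (\<integral>z. mean_clipped_log m z \<partial>chain_law i) - deficit_bound m) \<le> (\<integral>z. log_gap z \<partial>chain_law k)"
    using log_gap_chain_law[of k] by (auto intro: sum_mono)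
  then show ?thesis using log_gap_le[of k] by (simp add: sum_subtractf)
qed

end

section \<open>An invariant law off the diagonal\<close>

text \<open>Closed sets form a generator stable under intersection, and their indicators are
  pointwise limits of bounded continuous functions of the distance.\<close>

lemma measure_eq_if_continuous_integrals_eq:
  fixes M N :: "'c::metric_space measure"
  assumes "prob_space M" "prob_space N" and [measurable_cong]: "sets M = sets borel" "sets N = sets borel"
    and eq: "\<And>f :: 'c \<Rightarrow> real. continuous_on UNIV f \<Longrightarrow> bounded (range f) \<Longrightarrow> (\<integral>x. f x \<partial>M) = (\<integral>x. f x \<partial>N)"
  shows "M = N"
proof (rule measure_eqI_generator_eq[where E="Collect closed" and \<Omega>=UNIV and A="\<lambda>_. UNIV"])
  interpret M: prob_space M by fact
  interpret N: prob_space N by fact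
  show "Int_stable (Collect closed :: 'c set set)"
    by (auto simp: Int_stable_def)
  show "sets M = sigma_sets UNIV (Collect closed)" "sets N = sigma_sets UNIV (Collect closed)"
    using assms(3,4) by (simp_all add: borel_eq_closed)
  fix C :: "'c set" assume "C \<in> Collect closed"
  then have "closed C" by simp
  then have [measurable]: "C \<in> sets borel" by simp
  show "emeasure M C = emeasure N C"
  \<comment> \<open>The empty set is treated apart because \<open>infdist x {}\<close> is 0, so the
    functions below would not approximate its indicator.\<close>
  proof (cases "C = {}")
    case False
    define f where "f n x = max 0 (1 - real n * infdist x C)" for n and x :: 'c
    have f: "continuous_on UNIV (f n)" for n
      unfolding f_def by (intro continuous_intros)
    then have [measurable]: "f n \<in> borel_measurable borel" for n
      by (rule borel_measurable_continuous_onI)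
    have bound: "0 \<le> f n x" "f n x \<le> 1" for n x
      by (auto simp: f_def infdist_nonneg)
    have lim: "(\<lambda>n. f n x) \<longlonglongrightarrow> indicator C x" for x
    proof (cases "x \<in> C")
      case True
      then show ?thesis by (simp add: f_def)
    next
      case xC: False
      then have pos: "0 < infdist x C"
        using in_closed_iff_infdist_zero[OF \<open>closed C\<close> False, of x] infdist_nonneg[of x C] by simp
      obtain k :: nat where k: "1 / infdist x C < real k" using reals_Archimedean2 by blast
      have "f n x = 0" if "k \<le> n" for n
      proof -
        have "1 / infdist x C < real n" using k that by simp
        then have "1 < real n * infdist x C" using pos by (simp add: field_simps)
        then show ?thesis by (simp add: f_def)
      qed
      then have "\<forall>\<^sub>F n in sequentially. f n x = indicator C x"
        using xC by (auto simp: eventually_sequentially)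
      then show ?thesis by (rule tendsto_eventually)
    qed
    have "(\<lambda>n. \<integral>x. f n x \<partial>M) \<longlonglongrightarrow> (\<integral>x. indicator C x \<partial>M)"
      by (rule integral_dominated_convergence[where w="\<lambda>_. 1"]) (use bound lim in auto)
    moreover have "(\<lambda>n. \<integral>x. f n x \<partial>N) \<longlonglongrightarrow> (\<integral>x. indicator C x \<partial>N)"
      by (rule integral_dominated_convergence[where w="\<lambda>_. 1"]) (use bound lim in auto)
    moreover have "(\<integral>x. f n x \<partial>M) = (\<integral>x. f n x \<partial>N)" for n
      using bound[of n] by (intro eq f) (auto simp: bounded_iff intro!: exI[of _ 1])
    ultimately have "(\<integral>x. indicator C x \<partial>M :: real) = (\<integral>x. indicator C x \<partial>N)"
      by (simp add: LIMSEQ_unique)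
    then show ?thesis
      by (simp add: M.emeasure_eq_measure N.emeasure_eq_measure)
  qed simp
qed (use assms(3) in \<open>auto simp: prob_space.emeasure_space_1[OF assms(1)] sets_eq_imp_space_eq
       finite_measure.emeasure_finite prob_space.finite_measure[OF assms(1)]\<close>)

context vgarch_marginal begin

text \<open>A mixture over a uniform time in {..n}. This set has Suc n elements and is never empty,
  so every n gives a probability law.\<close>

definition cesaro_law :: "nat \<Rightarrow> (real \<times> real) measure" where
  "cesaro_law n = measure_pmf (pmf_of_set {..n}) \<bind> chain_law"

lemma measurable_chain_law:
  "chain_law \<in> measure_pmf p \<rightarrow>\<^sub>M subprob_algebra plane"
  using prob_chain_law sets_chain_law
  by (auto simp: space_subprob_algebra prob_space_imp_subprob_space)

lemma sets_cesaro_law [measurable_cong]: "sets (cesaro_law n) = sets plane"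
  unfolding cesaro_law_def by (rule sets_bind) (auto simp: sets_chain_law)

lemma prob_cesaro_law: "prob_space (cesaro_law n)"
  unfolding cesaro_law_def
  by (rule measure_pmf.prob_space_bind[OF _ measurable_chain_law]) (auto simp: prob_chain_law)

lemma integral_cesaro_law:
  fixes f :: "real \<times> real \<Rightarrow> real"
  assumes "f \<in> borel_measurable plane" "\<And>z. \<bar>f z\<bar> \<le> B"
  shows "(\<integral>z. f z \<partial>cesaro_law n) = (\<Sum>k\<le>n. \<integral>z. f z \<partial>chain_law k) / real (Suc n)"
proof -
  have "(\<integral>z. f z \<partial>cesaro_law n) = (\<integral>k. (\<integral>z. f z \<partial>chain_law k) \<partial>measure_pmf (pmf_of_set {..n}))"
    unfolding cesaro_law_def
    by (rule integral_bind[OF assms(1) assms(2) measurable_chain_law, where B'=1])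
       (auto simp: prob_space.emeasure_space_1[OF prob_chain_law] measure_pmf.finite_measure)
  also have "\<dots> = (\<Sum>k\<le>n. \<integral>z. f z \<partial>chain_law k) / real (Suc n)"
    by (subst integral_pmf_of_set) auto
  finally show ?thesis .
qed

lemma AE_cesaro_law: "AE z in cesaro_law n. \<alpha> \<le> fst z \<and> \<alpha> \<le> snd z"
proof -
  have "AE k in measure_pmf (pmf_of_set {..n}). AE z in chain_law k. \<alpha> \<le> fst z \<and> \<alpha> \<le> snd z"
    by (intro AE_I2 chain_law_ge)
  moreover have "Measurable.pred plane (\<lambda>z. \<alpha> \<le> fst z \<and> \<alpha> \<le> snd z)"
    by measurable
  ultimately show ?thesis
    unfolding cesaro_law_def using AE_bind[OF measurable_chain_law] by blast
qed

lemma moment_cesaro_law: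
  "integrable (cesaro_law n) (\<lambda>z. fst z + snd z)"
  "(\<integral>z. fst z + snd z \<partial>cesaro_law n) \<le> P_expect + moment_bound"
proof -
  have *: "(\<integral>\<^sup>+z. ennreal (fst z + snd z) \<partial>chain_law k) \<le> ennreal (P_expect + moment_bound)" for k
  proof -
    have "(\<integral>\<^sup>+z. ennreal (fst z + snd z) \<partial>chain_law k) = (\<integral>\<^sup>+z. ennreal (fst z) + ennreal (snd z) \<partial>chain_law k)"
      by (rule nn_integral_cong_AE) (use chain_law_ge[of k] alpha_pos in \<open>auto simp: ennreal_plus\<close>)
    also have "\<dots> = (\<integral>\<^sup>+z. ennreal (fst z) \<partial>chain_law k) + (\<integral>\<^sup>+z. ennreal (snd z) \<partial>chain_law k)"
      by (rule nn_integral_add) measurable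
    also have "\<dots> \<le> ennreal P_expect + ennreal moment_bound"
      using nn_integral_fst_admissible[OF admissible_chain_law] chain_law_moment
      by (intro add_mono) auto
    finally show ?thesis using P_expect_nonneg moment_bound_nonneg by (simp add: ennreal_plus)
  qed
  have "(\<integral>\<^sup>+z. ennreal (fst z + snd z) \<partial>cesaro_law n) =
      (\<integral>\<^sup>+k. \<integral>\<^sup>+z. ennreal (fst z + snd z) \<partial>chain_law k \<partial>measure_pmf (pmf_of_set {..n}))"
    unfolding cesaro_law_def by (rule nn_integral_bind[OF _ measurable_chain_law]) measurable
  also have "\<dots> \<le> (\<integral>\<^sup>+k. ennreal (P_expect + moment_bound) \<partial>measure_pmf (pmf_of_set {..n}))"
    by (intro nn_integral_mono *)
  finally have le: "(\<integral>\<^sup>+z. ennreal (fst z + snd z) \<partial>cesaro_law n) \<le> ennreal (P_expect + moment_bound)"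
    by (simp add: measure_pmf.emeasure_space_1[simplified])
  show "integrable (cesaro_law n) (\<lambda>z. fst z + snd z)"
    using le AE_cesaro_law[of n] alpha_pos by (intro integrableI_nonneg) (auto intro: le_less_trans)
  show "(\<integral>z. fst z + snd z \<partial>cesaro_law n) \<le> P_expect + moment_bound"
    using le P_expect_nonneg moment_bound_nonneg by (intro integral_real_bounded) auto
qed

lemma continuous_on_integral_step:
  fixes f :: "real \<times> real \<Rightarrow> real"
  assumes f: "continuous_on UNIV f" and B: "\<And>z. \<bar>f z\<bar> \<le> B"
  shows "continuous_on UNIV (\<lambda>z. \<integral>y. f (step z y) \<partial>\<rho>)" "\<bar>\<integral>y. f (step z y) \<partial>\<rho>\<bar> \<le> B"
proof -
  have c: "continuous_on UNIV (\<lambda>w. f (step (fst w) (snd w)))"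
    using continuous_on_compose2[OF f continuous_on_step] by (simp add: split_beta')
  show "continuous_on UNIV (\<lambda>z. \<integral>y. f (step z y) \<partial>\<rho>)"
    using continuous_on_integral_kernel[OF prob_rho sets_rho c, of B] B by simp
  show "\<bar>\<integral>y. f (step z y) \<partial>\<rho>\<bar> \<le> B"
    using bounded_integral_kernel[OF prob_rho, of "\<lambda>w. f (step (fst w) (snd w))" B z] B by simp
qed

text \<open>The Krylov-Bogoliubov argument: one step of the chain shifts the times in the average by
  one, and all but the two end terms cancel.\<close>

lemma integral_transition_cesaro_law:
  fixes f :: "real \<times> real \<Rightarrow> real"
  assumes f: "continuous_on UNIV f" and B: "\<And>z. \<bar>f z\<bar> \<le> B"
  shows "\<bar>(\<integral>z. (\<integral>y. f (step z y) \<partial>\<rho>) \<partial>cesaro_law n) - (\<integral>z. f z \<partial>cesaro_law n)\<bar> \<le> 2 * B / real (Suc n)"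
proof -
  have fm[measurable]: "f \<in> borel_measurable plane"
    using borel_measurable_continuous_onI[OF f] by (simp add: borel_prod)
  have bound: "\<bar>\<integral>z. f z \<partial>chain_law k\<bar> \<le> B" for k
    using bounded_integral_kernel[OF prob_chain_law, of "\<lambda>w. f (snd w)" B k undefined] B
    by (simp add: prob_chain_law)
  let ?g = "\<lambda>z. \<integral>y. f (step z y) \<partial>\<rho>"
  have "(\<integral>z. ?g z \<partial>cesaro_law n) = (\<Sum>k\<le>n. \<integral>z. ?g z \<partial>chain_law k) / real (Suc n)"
    by (rule integral_cesaro_law[where B=B]) (use continuous_on_integral_step(2)[OF f B] in auto)
  also have "(\<Sum>k\<le>n. \<integral>z. ?g z \<partial>chain_law k) = (\<Sum>k\<le>n. \<integral>z. f z \<partial>chain_law (Suc k))"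
    by (simp add: integral_transition[OF prob_chain_law sets_chain_law fm B])
  finally have "(\<integral>z. ?g z \<partial>cesaro_law n) - (\<integral>z. f z \<partial>cesaro_law n) =
      (\<Sum>k\<le>n. (\<integral>z. f z \<partial>chain_law (Suc k)) - (\<integral>z. f z \<partial>chain_law k)) / real (Suc n)"
    by (simp only: integral_cesaro_law[OF fm B] sum_subtractf diff_divide_distrib)
  also have "(\<Sum>k\<le>n. (\<integral>z. f z \<partial>chain_law (Suc k)) - (\<integral>z. f z \<partial>chain_law k)) =
      (\<integral>z. f z \<partial>chain_law (Suc n)) - (\<integral>z. f z \<partial>chain_law 0)"
    using sum_lessThan_telescope[of "\<lambda>k. \<integral>z. f z \<partial>chain_law k" "Suc n"] by (simp only: lessThan_Suc_atMost)
  finally have "\<bar>(\<integral>z. ?g z \<partial>cesaro_law n) - (\<integral>z. f z \<partial>cesaro_law n)\<bar> =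
      \<bar>(\<integral>z. f z \<partial>chain_law (Suc n)) - (\<integral>z. f z \<partial>chain_law 0)\<bar> / real (Suc n)"
    by simp
  also have "\<dots> \<le> 2 * B / real (Suc n)"
    using bound[of "Suc n"] bound[of 0] by (intro divide_right_mono) linarith+
  finally show ?thesis .
qed

text \<open>
  If \<open>\<phi>\<close> is the characteristic function of an invariant law and \<open>\<psi>\<close> that of \<open>\<alpha> + \<gamma> (\<epsilon> - \<delta>)\<^sup>2\<close>, then
  \<open>\<phi> t = \<psi> t * \<phi> (\<beta> * t)\<close>, and \<open>\<phi>\<close> is determined by iterating this towards \<open>t = 0\<close>.
\<close>

lemma marginal_law_unique:
  assumes "prob_space N" and [measurable_cong]: "sets N = sets borel" and ge: "AE s in N. \<alpha> \<le> s"
    and inv: "distr (N \<Otimes>\<^sub>M \<rho>) borel (\<lambda>(s, y). step1 s y) = N"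
  shows "N = P"
proof -
  define \<psi> where "\<psi> t = (CLINT y|\<rho>. iexp (t * (\<alpha> + \<gamma> * (y - \<delta>)\<^sup>2)))" for t
  have rd: "real_distribution K" if "prob_space K" "sets K = sets borel" for K :: "real measure"
    using that sets_eq_imp_space_eq[OF that(2)]
    by (simp add: real_distribution_def real_distribution_axioms_def)
  have char: "char K t = \<psi> t * char K (\<beta> * t)"
    if K: "prob_space K" and [measurable_cong]: "sets K = sets borel" and ge: "AE s in K. \<alpha> \<le> s"
      and inv: "distr (K \<Otimes>\<^sub>M \<rho>) borel (\<lambda>(s, y). step1 s y) = K" for K t
  proof -
    interpret K: prob_space K by fact
    interpret pair_prob_space K \<rho> ..
    have "char K t = (CLINT w|K \<Otimes>\<^sub>M \<rho>. iexp (t * (case w of (s, y) \<Rightarrow> step1 s y)))"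
      unfolding char_def by (subst inv[symmetric], rule integral_distr) measurable
    also have "\<dots> = (CLINT s|K. CLINT y|\<rho>. iexp (t * (case (s, y) of (s, y) \<Rightarrow> step1 s y)))"
      by (rule integral_fst'[symmetric], rule integrable_const_bound[where B=1]) auto
    also have "\<dots> = (CLINT s|K. \<psi> t * iexp (\<beta> * t * s))"
    proof (rule integral_cong_AE)
      show "AE s in K. (CLINT y|\<rho>. iexp (t * (case (s, y) of (s, y) \<Rightarrow> step1 s y))) = \<psi> t * iexp (\<beta> * t * s)"
        using ge
      proof eventually_elim
        case (elim s)
        have "iexp (t * step1 s y) = iexp (t * (\<alpha> + \<gamma> * (y - \<delta>)\<^sup>2)) * iexp (\<beta> * t * s)" for y
          unfolding exp_add[symmetric] step1_def using elim by (simp add: max_absorb2 algebra_simps)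
        then show ?case unfolding \<psi>_def by simp
      qed
    qed measurable
    also have "\<dots> = \<psi> t * char K (\<beta> * t)"
      unfolding char_def by (rule integral_mult_right_zero)
    finally show ?thesis .
  qed
  have psi_le: "cmod (\<psi> t) \<le> 1" for t
  proof -
    have "cmod (\<psi> t) \<le> (\<integral>y. cmod (iexp (t * (\<alpha> + \<gamma> * (y - \<delta>)\<^sup>2))) \<partial>\<rho>)"
      unfolding \<psi>_def by (rule integral_norm_bound)
    then show ?thesis by (simp add: rho.prob_space)
  qed
  interpret N: real_distribution N using rd assms by simp
  interpret Pd: real_distribution P using rd prob_P sets_P by simp
  have diff: "cmod (char N t - char P t) \<le> cmod (char N (\<beta> ^ n * t) - char P (\<beta> ^ n * t))" for t n
  proof (induction n arbitrary: t)
    case (Suc n)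
    have "cmod (char N t - char P t) = cmod (\<psi> t) * cmod (char N (\<beta> * t) - char P (\<beta> * t))"
      using char[OF assms(1,2) ge inv, of t] char[OF prob_P sets_P P_ge P_invariant, of t]
      by (simp add: norm_mult flip: right_diff_distrib)
    also have "\<dots> \<le> cmod (char N (\<beta> * t) - char P (\<beta> * t))"
      using psi_le[of t] by (intro mult_left_le_one_le) auto
    also have "\<dots> \<le> cmod (char N (\<beta> ^ Suc n * t) - char P (\<beta> ^ Suc n * t))"
      using Suc[of "\<beta> * t"] by (simp add: mult_ac)
    finally show ?case .
  qed simp
  have "char N t = char P t" for t
  proof -
    \<comment> \<open>Both characteristic functions are continuous with value 1 at 0, so the
      iterated difference vanishes in the limit.\<close>
    have "(\<lambda>n. \<beta> ^ n * t) \<longlonglongrightarrow> 0"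
      using beta_pos beta_less_1 by (intro tendsto_mult_left_zero LIMSEQ_realpow_zero) auto
    then have "(\<lambda>n. cmod (char N (\<beta> ^ n * t) - char P (\<beta> ^ n * t))) \<longlonglongrightarrow> cmod (char N 0 - char P 0)"
      by (intro tendsto_intros isCont_tendsto_compose[OF N.isCont_char] isCont_tendsto_compose[OF Pd.isCont_char])
    then have "(\<lambda>n. cmod (char N (\<beta> ^ n * t) - char P (\<beta> ^ n * t))) \<longlonglongrightarrow> 0"
      by (simp add: N.char_zero Pd.char_zero)
    then have "cmod (char N t - char P t) \<le> 0"
      by (rule LIMSEQ_le_const) (use diff in auto)
    then show ?thesis by simp
  qed
  then show ?thesis
    by (intro Levy_uniqueness N.real_distribution_axioms Pd.real_distribution_axioms) auto
qed

lemma weak_limit_of_cesaro_laws: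
  obtains \<mu> where "admissible \<mu>" "transition \<mu> = \<mu>"
    "\<And>m. 0 \<le> m \<Longrightarrow> (\<integral>z. mean_clipped_log m z \<partial>\<mu>) \<le> deficit_bound m"
proof -
  have pos: "AE z in cesaro_law n. 0 < fst z \<and> 0 < snd z" for n
    using AE_cesaro_law[of n] alpha_pos by auto
  obtain \<mu> r where mu: "prob_space \<mu>" "sets \<mu> = sets plane" and r: "strict_mono (r :: nat \<Rightarrow> nat)"
    and lim: "\<And>f :: real \<times> real \<Rightarrow> real. continuous_on UNIV f \<Longrightarrow> bounded (range f) \<Longrightarrow>
        (\<lambda>n. \<integral>z. f z \<partial>cesaro_law (r n)) \<longlonglongrightarrow> (\<integral>z. f z \<partial>\<mu>)"
    using prokhorov_positive_quadrant[of cesaro_law, OF prob_cesaro_law sets_cesaro_law pos moment_cesaro_law]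
    by metis
  note [measurable_cong] = mu(2)
  interpret mu: prob_space \<mu> by (rule mu)
  have sets_mu: "sets \<mu> = sets borel" using mu(2) by (metis borel_prod)
  have vanish: "(\<lambda>n. c / real (Suc (r n))) \<longlonglongrightarrow> 0" for c
    using LIMSEQ_subseq_LIMSEQ[OF LIMSEQ_Suc[OF lim_const_over_n[of c]] r] by (simp add: comp_def)
  \<comment> \<open>The Feller property makes the one-step integral of f again a legitimate test
    function, so both sides of the asymptotic invariance pass to the limit.\<close>
  have invariant: "transition \<mu> = \<mu>"
  proof (rule measure_eq_if_continuous_integrals_eq)
    show "prob_space (transition \<mu>)" by (rule prob_space_transition[OF mu])
    show "prob_space \<mu>" by (rule mu)
    show "sets (transition \<mu>) = sets borel" by (metis borel_prod sets_transition)
    show "sets \<mu> = sets borel" by (rule sets_mu)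
    fix f :: "real \<times> real \<Rightarrow> real" assume f: "continuous_on UNIV f" "bounded (range f)"
    then obtain B where B: "\<And>z. \<bar>f z\<bar> \<le> B" by (auto simp: bounded_iff)
    have fm[measurable]: "f \<in> borel_measurable plane"
      using borel_measurable_continuous_onI[OF f(1)] by (simp add: borel_prod)
    let ?g = "\<lambda>z. \<integral>y. f (step z y) \<partial>\<rho>"
    have "(\<lambda>n. \<integral>z. ?g z \<partial>cesaro_law (r n)) \<longlonglongrightarrow> (\<integral>z. ?g z \<partial>\<mu>)"
      using continuous_on_integral_step(2)[OF f(1) B]
      by (intro lim continuous_on_integral_step(1)[OF f(1) B]) (auto simp: bounded_iff)
    then have "(\<lambda>n. (\<integral>z. ?g z \<partial>cesaro_law (r n)) - (\<integral>z. f z \<partial>cesaro_law (r n))) \<longlonglongrightarrow> (\<integral>z. ?g z \<partial>\<mu>) - (\<integral>z. f z \<partial>\<mu>)"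
      by (rule tendsto_diff[OF _ lim[OF f]])
    moreover have "(\<lambda>n. (\<integral>z. ?g z \<partial>cesaro_law (r n)) - (\<integral>z. f z \<partial>cesaro_law (r n))) \<longlonglongrightarrow> 0"
      by (rule Lim_null_comparison[OF _ vanish[of "2 * B"]])
         (auto intro!: always_eventually simp del: of_nat_Suc simp: integral_transition_cesaro_law[OF f(1) B])
    ultimately have "(\<integral>z. ?g z \<partial>\<mu>) - (\<integral>z. f z \<partial>\<mu>) = 0"
      by (rule LIMSEQ_unique)
    then show "(\<integral>z. f z \<partial>transition \<mu>) = (\<integral>z. f z \<partial>\<mu>)"
      using integral_transition[OF mu fm B] by simp
  qed
  have marginal: "distr \<mu> borel fst = P"
  proof (rule measure_eq_if_continuous_integrals_eq)
    show "prob_space (distr \<mu> borel fst)" by (rule mu.prob_space_distr) simp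
    fix f :: "real \<Rightarrow> real" assume f: "continuous_on UNIV f" "bounded (range f)"
    then obtain B where B: "\<And>z. \<bar>f z\<bar> \<le> B" by (auto simp: bounded_iff)
    have [measurable]: "f \<in> borel_measurable borel"
      by (rule borel_measurable_continuous_onI[OF f(1)])
    have "(\<integral>z. f (fst z) \<partial>chain_law k) = (\<integral>s. f s \<partial>P)" for k
    proof -
      have "distr (chain_law k) borel fst = P" using admissible_chain_law[of k] by (simp add: admissible_def)
      then show ?thesis using integral_distr[of fst "chain_law k" borel f] by simp
    qed
    then have "(\<integral>z. f (fst z) \<partial>cesaro_law n) = (\<integral>s. f s \<partial>P)" for n
      by (subst integral_cesaro_law[where B=B]) (use B in \<open>auto simp del: of_nat_Suc\<close>)
    moreover have "(\<lambda>n. \<integral>z. f (fst z) \<partial>cesaro_law (r n)) \<longlonglongrightarrow> (\<integral>z. f (fst z) \<partial>\<mu>)"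
      using B by (intro lim continuous_on_compose2[OF f(1)]) (auto intro!: continuous_intros simp: bounded_iff)
    ultimately have "(\<integral>z. f (fst z) \<partial>\<mu>) = (\<integral>s. f s \<partial>P)"
      by (simp add: LIMSEQ_const_iff)
    then show "(\<integral>s. f s \<partial>distr \<mu> borel fst) = (\<integral>s. f s \<partial>P)"
      by (subst integral_distr) auto
  qed (auto simp: prob_P sets_P)
  \<comment> \<open>The lower bounds are read off from invariance: every step lands above \<alpha>
    in both coordinates, whatever the law before it.\<close>
  have "AE z in transition \<mu>. \<alpha> \<le> fst z \<and> \<alpha> \<le> snd z"
    by (rule AE_transition[OF mu]) (auto intro!: step_ge)
  then have "admissible \<mu>"
    using mu marginal unfolding invariant by (simp add: admissible_def)
  moreover have "(\<integral>z. mean_clipped_log m z \<partial>\<mu>) \<le> deficit_bound m" if "0 \<le> m" for m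
  proof -
    have le: "(\<integral>z. mean_clipped_log m z \<partial>cesaro_law n) \<le> deficit_bound m + (P_expect + moment_bound) / real (Suc n)" for n
    proof -
      have "(\<Sum>k\<le>n. \<integral>z. mean_clipped_log m z \<partial>chain_law k) \<le> real (Suc n) * deficit_bound m + (P_expect + moment_bound)"
        using sum_mean_clipped_log_le[OF that, of "Suc n"] by (simp only: lessThan_Suc_atMost)
      then have "(\<Sum>k\<le>n. \<integral>z. mean_clipped_log m z \<partial>chain_law k) / real (Suc n) \<le>
          (real (Suc n) * deficit_bound m + (P_expect + moment_bound)) / real (Suc n)"
        by (rule divide_right_mono) simp
      also have "\<dots> = deficit_bound m + (P_expect + moment_bound) / real (Suc n)"
        by (simp add: add_divide_distrib del: of_nat_Suc)
      finally show ?thesis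
        by (subst integral_cesaro_law[OF measurable_mean_clipped_log mean_clipped_log_bound[OF that]])
    qed
    have "(\<lambda>n. \<integral>z. mean_clipped_log m z \<partial>cesaro_law (r n)) \<longlonglongrightarrow> (\<integral>z. mean_clipped_log m z \<partial>\<mu>)"
      using mean_clipped_log_bound[OF that]
      by (intro lim continuous_on_mean_clipped_log that) (auto simp: bounded_iff)
    moreover have "(\<lambda>n. deficit_bound m + (P_expect + moment_bound) / real (Suc (r n))) \<longlonglongrightarrow> deficit_bound m + 0"
      by (intro tendsto_add tendsto_const vanish)
    ultimately have "(\<integral>z. mean_clipped_log m z \<partial>\<mu>) \<le> deficit_bound m + 0"
      by (rule LIMSEQ_le) (use le in auto)
    then show ?thesis by simp
  qed
  ultimately show ?thesis using that[of \<mu>] invariant by blast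
qed

lemma deficit_bound_tendsto_0: "(\<lambda>n. deficit_bound (real n)) \<longlonglongrightarrow> 0"
proof -
  have "exp (- real n) = exp (- 1) ^ n" for n
    by (simp flip: exp_of_nat_mult)
  moreover have "(\<lambda>n. exp (- 1 :: real) ^ n) \<longlonglongrightarrow> 0"
    by (rule LIMSEQ_realpow_zero) auto
  ultimately show ?thesis
    unfolding deficit_bound_def by (auto intro: tendsto_mult_left_zero)
qed

theorem off_diagonal_invariant_law:
  assumes lyap_int: "integrable (P \<Otimes>\<^sub>M \<rho>) (\<lambda>(s, y). ln \<bar>factor (s, s) y\<bar>)"
    and lyap_pos: "0 < (\<integral>(s, y). ln \<bar>factor (s, s) y\<bar> \<partial>(P \<Otimes>\<^sub>M \<rho>))"
  obtains \<mu> where "admissible \<mu>" "transition \<mu> = \<mu>" "AE z in \<mu>. fst z \<noteq> snd z"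
proof -
  obtain \<mu> where adm: "admissible \<mu>" and inv: "transition \<mu> = \<mu>"
    and upper: "\<And>m. 0 \<le> m \<Longrightarrow> (\<integral>z. mean_clipped_log m z \<partial>\<mu>) \<le> deficit_bound m"
    using weak_limit_of_cesaro_laws by blast
  have sets_mu [measurable_cong]: "sets \<mu> = sets plane" and fst_mu: "distr \<mu> borel fst = P"
    and ge: "AE z in \<mu>. \<alpha> \<le> fst z \<and> \<alpha> \<le> snd z" and "prob_space \<mu>"
    using adm by (auto simp: admissible_def)
  interpret mu: prob_space \<mu> by fact
  interpret P_rho: pair_prob_space P \<rho> ..
  have not_diag: "\<not> (AE z in \<mu>. fst z = snd z)"
  proof
    assume diag: "AE z in \<mu>. fst z = snd z"
    let ?A = "\<lambda>w. factor (fst w, fst w) (snd w)"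
    have [measurable]: "(\<lambda>(s, y). factor (s, s) y) \<in> borel_measurable plane"
      unfolding factor_def by measurable
    have [measurable]: "(\<lambda>s. mean_clipped_log m (s, s)) \<in> borel_measurable borel" for m
      by measurable
    \<comment> \<open>A law carried by the diagonal is determined by its first marginal P, so its
      clipped means become integrals of the diagonal factor.\<close>
    have eq: "(\<integral>z. mean_clipped_log m z \<partial>\<mu>) = (\<integral>(s, y). clipped_log m (factor (s, s) y) \<partial>(P \<Otimes>\<^sub>M \<rho>))"
      if "0 \<le> m" for m
    proof -
      have "(\<integral>z. mean_clipped_log m z \<partial>\<mu>) = (\<integral>z. mean_clipped_log m (fst z, fst z) \<partial>\<mu>)"
      proof (rule integral_cong_AE)
        show "AE z in \<mu>. mean_clipped_log m z = mean_clipped_log m (fst z, fst z)"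
          using diag by eventually_elim (metis prod.collapse)
      qed measurable
      also have "\<dots> = (\<integral>s. mean_clipped_log m (s, s) \<partial>distr \<mu> borel fst)"
        by (subst integral_distr) auto
      also have "\<dots> = (\<integral>s. \<integral>y. (case (s, y) of (s, y) \<Rightarrow> clipped_log m (factor (s, s) y)) \<partial>\<rho> \<partial>P)"
        unfolding fst_mu mean_clipped_log_def by simp
      also have "\<dots> = (\<integral>(s, y). clipped_log m (factor (s, s) y) \<partial>(P \<Otimes>\<^sub>M \<rho>))"
        by (rule P_rho.integral_fst', rule P_rho.integrable_const_bound[where B="3 * m"])
           (use clipped_log_bound[OF that] in auto)
      finally show ?thesis .
    qed
    have nz: "AE w in P \<Otimes>\<^sub>M \<rho>. ?A w \<noteq> 0"
    proof (rule P_rho.AE_pair_measure)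
      show "AE s in P. AE y in \<rho>. factor (fst (s, y), fst (s, y)) (snd (s, y)) \<noteq> 0"
        by (simp add: AE_factor_nonzero)
    qed measurable
    have "(\<lambda>n. \<integral>w. clipped_log (real n) (?A w) \<partial>(P \<Otimes>\<^sub>M \<rho>)) \<longlonglongrightarrow>
        (\<integral>w. ln \<bar>?A w\<bar> \<partial>(P \<Otimes>\<^sub>M \<rho>))"
    \<comment> \<open>Clipping to an interval symmetric about 0 does not increase absolute values,
      so the unclipped logarithm dominates; it is integrable by \<open>lyap_int\<close>.\<close>
    proof (rule integral_dominated_convergence[where w="\<lambda>w. \<bar>ln \<bar>?A w\<bar>\<bar>"])
      show "integrable (P \<Otimes>\<^sub>M \<rho>) (\<lambda>w. \<bar>ln \<bar>?A w\<bar>\<bar>)"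
        using lyap_int by (auto simp: split_beta')
      have clip: "clipped_log m a = max (- 3 * m) (min (3 * m) (ln \<bar>a\<bar>))" if "a \<noteq> 0" "0 \<le> m" for m a
      proof -
        have "max (exp (- 3 * m)) (min (exp (3 * m)) \<bar>a\<bar>) =
            max (exp (- 3 * m)) (min (exp (3 * m)) (exp (ln \<bar>a\<bar>)))"
          using that by simp
        also have "\<dots> = exp (max (- 3 * m) (min (3 * m) (ln \<bar>a\<bar>)))"
          by (auto simp: max_def min_def)
        finally show ?thesis unfolding clipped_log_def by simp
      qed
      show "AE w in P \<Otimes>\<^sub>M \<rho>. (\<lambda>n. clipped_log (real n) (?A w)) \<longlonglongrightarrow>
          ln \<bar>?A w\<bar>"
        using nz
      proof eventually_elim
        case (elim w)
        let ?l = "ln \<bar>?A w\<bar>"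
        obtain k :: nat where k: "\<bar>?l\<bar> < real k" using reals_Archimedean2 by blast
        have "clipped_log (real n) (?A w) = ?l" if "k \<le> n" for n
        proof -
          have "\<bar>?l\<bar> < real n" using k that by linarith
          then show ?thesis using clip[OF elim, of "real n"] by simp
        qed
        then show ?case
          by (intro tendsto_eventually) (auto simp: eventually_sequentially)
      qed
      show "AE w in P \<Otimes>\<^sub>M \<rho>. norm (clipped_log (real n) (?A w)) \<le>
          \<bar>ln \<bar>?A w\<bar>\<bar>" for n
        using nz
      proof eventually_elim
        case (elim w)
        show ?case
          using clip[OF elim, of "real n"] by (auto simp: max_def min_def abs_if)
      qed
    qed measurable
    moreover have "(\<integral>w. clipped_log (real n) (?A w) \<partial>(P \<Otimes>\<^sub>M \<rho>)) \<le> deficit_bound (real n)" for n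
      using upper[of "real n"] eq[of "real n"] by (simp add: split_beta')
    ultimately have "(\<integral>w. ln \<bar>?A w\<bar> \<partial>(P \<Otimes>\<^sub>M \<rho>)) \<le> 0"
      by (intro LIMSEQ_le[OF _ deficit_bound_tendsto_0]) auto
    then show False using lyap_pos by (simp add: split_beta')
  qed
  define D :: "(real \<times> real) set" where "D = {z. fst z \<noteq> snd z}"
  have D [measurable]: "D \<in> sets plane"
  proof -
    have "{z \<in> space plane. fst z \<noteq> (snd z :: real)} \<in> sets plane" by measurable
    then show ?thesis by (simp add: D_def space_pair_measure)
  qed
  have space_mu: "space \<mu> = UNIV" using sets_eq_imp_space_eq[OF sets_mu] by (simp add: space_pair_measure)
  have D_pos: "emeasure \<mu> D \<noteq> 0"
  proof
    assume "emeasure \<mu> D = 0"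
    then have "AE z in \<mu>. fst z = snd z"
      by (intro AE_I[where N=D]) (auto simp: D_def sets_mu[symmetric] D[unfolded sets_mu[symmetric] D_def])
    then show False using not_diag by simp
  qed
  have D_fin: "emeasure \<mu> D \<noteq> \<infinity>" by simp
  define \<mu>' where "\<mu>' = uniform_measure \<mu> D"
  have prob': "prob_space \<mu>'"
    unfolding \<mu>'_def by (rule prob_space_uniform_measure) (use D_pos D_fin in auto)
  have sets' [measurable_cong]: "sets \<mu>' = sets plane"
    unfolding \<mu>'_def by (simp add: sets_mu)
  \<comment> \<open>Both D and its complement are almost surely preserved by a step. Hence the
    indicator of D may be evaluated after the step instead of before it, and conditioning on D
    commutes with the transition.\<close>
  have step_D: "AE z in \<mu>. AE y in \<rho>. step z y \<in> D \<longleftrightarrow> z \<in> D"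
    using ge
  proof eventually_elim
    case (elim z)
    show ?case using AE_factor_nonzero[of z]
    proof eventually_elim
      case (elim y)
      have "snd (step z y) - fst (step z y) = (snd z - fst z) * factor z y"
        unfolding step_diff using \<open>\<alpha> \<le> fst z \<and> \<alpha> \<le> snd z\<close> by (simp add: max_absorb2)
      then show ?case using elim unfolding D_def by auto
    qed
  qed
  have inv': "transition \<mu>' = \<mu>'"
  proof (rule measure_eqI)
    show "sets (transition \<mu>') = sets \<mu>'" by (simp add: sets')
    fix B assume "B \<in> sets (transition \<mu>')"
    then have [measurable]: "B \<in> sets plane" by simp
    have "emeasure (transition \<mu>') B = (\<integral>\<^sup>+z. indicator B z \<partial>transition \<mu>')"
      by simp
    also have "\<dots> = (\<integral>\<^sup>+z. \<integral>\<^sup>+y. indicator B (step z y) \<partial>\<rho> \<partial>\<mu>')"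
      by (rule nn_integral_transition) (auto simp: sets')
    also have "\<dots> = (\<integral>\<^sup>+z. (\<integral>\<^sup>+y. indicator B (step z y) \<partial>\<rho>) * indicator D z \<partial>\<mu>) / emeasure \<mu> D"
      unfolding \<mu>'_def by (rule nn_integral_uniform_measure) measurable
    also have "(\<integral>\<^sup>+z. (\<integral>\<^sup>+y. indicator B (step z y) \<partial>\<rho>) * indicator D z \<partial>\<mu>) =
        (\<integral>\<^sup>+z. \<integral>\<^sup>+y. indicator (D \<inter> B) (step z y) \<partial>\<rho> \<partial>\<mu>)"
    proof (rule nn_integral_cong_AE)
      show "AE z in \<mu>. (\<integral>\<^sup>+y. indicator B (step z y) \<partial>\<rho>) * indicator D z = (\<integral>\<^sup>+y. indicator (D \<inter> B) (step z y) \<partial>\<rho>)"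
        using step_D
      proof eventually_elim
        case (elim z)
        have "(\<integral>\<^sup>+y. indicator (D \<inter> B) (step z y) \<partial>\<rho>) = (\<integral>\<^sup>+y. indicator D z * indicator B (step z y) \<partial>\<rho>)"
          by (rule nn_integral_cong_AE) (use elim in eventually_elim, auto split: split_indicator)
        then show ?case by (cases "z \<in> D") simp_all
      qed
    qed
    also have "\<dots> = (\<integral>\<^sup>+z. indicator (D \<inter> B) z \<partial>transition \<mu>)"
      by (rule nn_integral_transition[symmetric]) (auto simp: sets_mu)
    also have "\<dots> = emeasure \<mu> (D \<inter> B)"
      unfolding inv by (rule nn_integral_indicator) (simp add: sets_mu)
    also have "\<dots> / emeasure \<mu> D = emeasure \<mu>' B"
      unfolding \<mu>'_def by (subst emeasure_uniform_measure) (auto simp: sets_mu)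
    finally show "emeasure (transition \<mu>') B = emeasure \<mu>' B" .
  qed
  have ge': "AE z in \<mu>'. \<alpha> \<le> fst z \<and> \<alpha> \<le> snd z"
    unfolding \<mu>'_def by (rule AE_uniform_measureI) (use ge in \<open>auto simp: sets_mu\<close>)
  \<comment> \<open>Conditioning could have changed the first marginal; it is still invariant, as
    the first coordinate is autonomous, and uniqueness identifies it.\<close>
  have "distr \<mu>' borel fst = P"
  proof (rule marginal_law_unique)
    show "prob_space (distr \<mu>' borel fst)" by (rule prob_space.prob_space_distr[OF prob']) simp
    show "AE s in distr \<mu>' borel fst. \<alpha> \<le> s" by (subst AE_distr_iff) (use ge' in auto)
    show "distr (distr \<mu>' borel fst \<Otimes>\<^sub>M \<rho>) borel (\<lambda>(s, y). step1 s y) = distr \<mu>' borel fst"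
      using fst_transition[OF sets'] unfolding inv' by simp
  qed simp
  then have "admissible \<mu>'" using prob' sets' ge' by (simp add: admissible_def)
  moreover have "AE z in \<mu>'. fst z \<noteq> snd z"
    unfolding \<mu>'_def by (rule AE_uniform_measureI) (auto simp: sets_mu D_def[symmetric] D, simp add: D_def)
  ultimately show ?thesis using that inv' by blast
qed

end

section \<open>The stationary volatility as a function of the past\<close>

lemma strictly_stationary_one_dim:
  fixes X :: "'t::comm_monoid_add \<Rightarrow> 'a \<Rightarrow> 'b"
  assumes "strictly_stationary M N X"
  shows "distr M N (X t) = distr M N (X 0)"
proof -
  have X [measurable]: "X t \<in> M \<rightarrow>\<^sub>M N" for t
    using assms by (auto simp: strictly_stationary_def)
  have shift: "distr M (\<Pi>\<^sub>M t\<in>UNIV. N) (\<lambda>\<omega> s. X (s + t) \<omega>) = distr M (\<Pi>\<^sub>M t\<in>UNIV. N) (\<lambda>\<omega> s. X s \<omega>)"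
    using assms by (auto simp: strictly_stationary_def)
  have path: "(\<lambda>\<omega> s. X (s + h) \<omega>) \<in> M \<rightarrow>\<^sub>M (\<Pi>\<^sub>M t\<in>UNIV. N)" for h
    by (rule measurable_PiM_single') (use measurable_space[OF X] in auto)
  have "distr M N (X (0 + h)) = distr (distr M (\<Pi>\<^sub>M t\<in>UNIV. N) (\<lambda>\<omega> s. X (s + h) \<omega>)) N (\<lambda>x. x 0)" for h
    by (subst distr_distr) (auto simp: comp_def path)
  from this[of t] this[of 0] show ?thesis using shift by simp
qed

locale vgarch_process =
  fixes M :: "'a measure" and \<epsilon> \<sigma> :: "int \<Rightarrow> 'a \<Rightarrow> real" and \<alpha> \<beta> \<gamma> \<delta> :: real
  assumes prob_M: "prob_space M"
    and alpha_pos: "0 < \<alpha>" and beta_pos: "0 < \<beta>" and beta_less_1: "\<beta> < 1" and gamma_nonneg: "0 \<le> \<gamma>"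
    and iid: "iid M borel \<epsilon>"
    and integrable_eps: "integrable M (\<epsilon> 0)" and integrable_eps_sq: "integrable M (\<lambda>\<omega>. (\<epsilon> 0 \<omega>)\<^sup>2)"
    and volatility: "vgarch_stationary_volatility M (\<alpha>, \<beta>, \<gamma>, \<delta>) \<epsilon> \<sigma>"
begin

sublocale prob_space M by (rule prob_M)

lemma measurable_eps [measurable]: "\<epsilon> t \<in> borel_measurable M"
  and indep_eps: "indep_vars (\<lambda>_. borel) \<epsilon> UNIV"
  and distr_eps: "distr M borel (\<epsilon> t) = distr M borel (\<epsilon> 0)"
  using iid by (auto simp: iid_def indep_vars_def)

lemma sigma_stationary: "strictly_stationary M borel \<sigma>"
  and sigma_rec: "AE \<omega> in M. (\<sigma> t \<omega>)\<^sup>2 = \<alpha> + \<gamma> * (\<epsilon> (t - 1) \<omega> - \<delta>)\<^sup>2 + \<beta> * (\<sigma> (t - 1) \<omega>)\<^sup>2"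
  using volatility by (auto simp: vgarch_stationary_volatility_def)

lemma measurable_sigma [measurable]: "\<sigma> t \<in> borel_measurable M"
  using sigma_stationary by (simp add: strictly_stationary_def)

lemma distr_sigma: "distr M borel (\<sigma> t) = distr M borel (\<sigma> 0)"
  by (rule strictly_stationary_one_dim[OF sigma_stationary])

section \<open>The causal series for the stationary variance\<close>

definition innovation :: "nat \<Rightarrow> 'a \<Rightarrow> real" where
  "innovation k \<omega> = \<alpha> + \<gamma> * (\<epsilon> (- 1 - int k) \<omega> - \<delta>)\<^sup>2"

text \<open>The recursion unrolled to the infinite past. It is a function of the noise at negative
  times at every point of the space, not just almost everywhere, which gives the independence from
  later noise; the series converges almost surely.\<close>

definition initial_variance :: "'a \<Rightarrow> real" where
  "initial_variance \<omega> = (\<Sum>k. \<beta> ^ k * innovation k \<omega>)"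

lemma measurable_innovation [measurable]: "innovation k \<in> borel_measurable M"
  unfolding innovation_def by measurable

lemma measurable_initial_variance [measurable]: "initial_variance \<in> borel_measurable M"
  unfolding initial_variance_def by measurable

lemma innovation_ge: "\<alpha> \<le> innovation k \<omega>"
  using gamma_nonneg by (simp add: innovation_def)

lemma sigma_expansion:
  "AE \<omega> in M. \<forall>n. (\<sigma> 0 \<omega>)\<^sup>2 = (\<Sum>k<n. \<beta> ^ k * innovation k \<omega>) + \<beta> ^ n * (\<sigma> (- int n) \<omega>)\<^sup>2"
proof -
  have "AE \<omega> in M. \<forall>t. (\<sigma> t \<omega>)\<^sup>2 = \<alpha> + \<gamma> * (\<epsilon> (t - 1) \<omega> - \<delta>)\<^sup>2 + \<beta> * (\<sigma> (t - 1) \<omega>)\<^sup>2"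
    using sigma_rec by (subst AE_all_countable) auto
  then show ?thesis
  proof eventually_elim
    case (elim \<omega>)
    show ?case
    proof
      fix n
      show "(\<sigma> 0 \<omega>)\<^sup>2 = (\<Sum>k<n. \<beta> ^ k * innovation k \<omega>) + \<beta> ^ n * (\<sigma> (- int n) \<omega>)\<^sup>2"
      proof (induction n)
        case (Suc n)
        have "(\<sigma> (- int n) \<omega>)\<^sup>2 = innovation n \<omega> + \<beta> * (\<sigma> (- int (Suc n)) \<omega>)\<^sup>2"
        proof -
          have "- int n - 1 = - 1 - int n" "- int n - 1 = - int (Suc n)" by auto
          then show ?thesis
            using elim[rule_format, of "- int n"] unfolding innovation_def by metis
        qed
        then show ?case using Suc by (simp add: algebra_simps)
      qed simp
    qed
  qed
qed

lemma summable_innovations: "AE \<omega> in M. summable (\<lambda>k. \<beta> ^ k * innovation k \<omega>)"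
  using sigma_expansion
proof eventually_elim
  case (elim \<omega>)
  show ?case
  proof (rule summableI_nonneg_bounded[where x="(\<sigma> 0 \<omega>)\<^sup>2"])
    show "0 \<le> \<beta> ^ k * innovation k \<omega>" for k
      using beta_pos alpha_pos innovation_ge[of k \<omega>] by simp
    show "(\<Sum>k<n. \<beta> ^ k * innovation k \<omega>) \<le> (\<sigma> 0 \<omega>)\<^sup>2" for n
      using elim[rule_format, of n] beta_pos by simp
  qed
qed

text \<open>The difference lies between 0 and the remainder \<beta> ^ n times a squared volatility
  at time - n. By stationarity the law of the latter is free of n, so the remainder tends to 0 in
  probability; the truncation at 1 gives this without moments of \<sigma>.\<close>

lemma sigma_eq_initial_variance: "AE \<omega> in M. (\<sigma> 0 \<omega>)\<^sup>2 = initial_variance \<omega>"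
proof -
  define Z where "Z \<omega> = (\<sigma> 0 \<omega>)\<^sup>2 - initial_variance \<omega>" for \<omega>
  have Z: "AE \<omega> in M. \<forall>n. 0 \<le> Z \<omega> \<and> Z \<omega> \<le> \<beta> ^ n * (\<sigma> (- int n) \<omega>)\<^sup>2"
    using sigma_expansion summable_innovations
  proof eventually_elim
    case (elim \<omega>)
    have nonneg: "0 \<le> \<beta> ^ k * innovation k \<omega>" for k
      using beta_pos alpha_pos innovation_ge[of k \<omega>] by simp
    have upper: "initial_variance \<omega> \<le> (\<sigma> 0 \<omega>)\<^sup>2"
      unfolding initial_variance_def
    proof (rule suminf_le_const[OF elim(2)])
      show "(\<Sum>k<n. \<beta> ^ k * innovation k \<omega>) \<le> (\<sigma> 0 \<omega>)\<^sup>2" for n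
        using elim(1)[rule_format, of n] beta_pos by simp
    qed
    have lower: "(\<Sum>k<n. \<beta> ^ k * innovation k \<omega>) \<le> initial_variance \<omega>" for n
      unfolding initial_variance_def by (rule sum_le_suminf[OF elim(2)]) (use nonneg in auto)
    have "0 \<le> Z \<omega> \<and> Z \<omega> \<le> \<beta> ^ n * (\<sigma> (- int n) \<omega>)\<^sup>2" for n
      using elim(1)[rule_format, of n] upper lower[of n] unfolding Z_def by linarith
    then show ?case by blast
  qed
  have [measurable]: "Z \<in> borel_measurable M" unfolding Z_def by measurable
  have Z_int: "integrable M (\<lambda>\<omega>. min 1 (Z \<omega>))"
  proof (rule integrable_const_bound[where B=1])
    show "AE \<omega> in M. norm (min 1 (Z \<omega>)) \<le> 1"
      using Z
    proof eventually_elim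
      case (elim \<omega>)
      then have "0 \<le> Z \<omega>" by blast
      then show ?case by simp
    qed
  qed simp
  have le: "(\<integral>\<omega>. min 1 (Z \<omega>) \<partial>M) \<le> (\<integral>\<omega>. min 1 (\<beta> ^ n * (\<sigma> 0 \<omega>)\<^sup>2) \<partial>M)" for n
  proof -
    have "(\<integral>\<omega>. min 1 (Z \<omega>) \<partial>M) \<le> (\<integral>\<omega>. min 1 (\<beta> ^ n * (\<sigma> (- int n) \<omega>)\<^sup>2) \<partial>M)"
    proof (rule integral_mono_AE)
      show "integrable M (\<lambda>\<omega>. min 1 (Z \<omega>))" by (rule Z_int)
      show "integrable M (\<lambda>\<omega>. min 1 (\<beta> ^ n * (\<sigma> (- int n) \<omega>)\<^sup>2))"
      proof (rule integrable_const_bound[where B=1])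
        have "0 \<le> \<beta> ^ n * (\<sigma> (- int n) \<omega>)\<^sup>2" for \<omega> using beta_pos by simp
        then show "AE \<omega> in M. norm (min 1 (\<beta> ^ n * (\<sigma> (- int n) \<omega>)\<^sup>2)) \<le> 1" by simp
      qed measurable
      show "AE \<omega> in M. min 1 (Z \<omega>) \<le> min 1 (\<beta> ^ n * (\<sigma> (- int n) \<omega>)\<^sup>2)"
        using Z
      proof eventually_elim
        case (elim \<omega>)
        then have "Z \<omega> \<le> \<beta> ^ n * (\<sigma> (- int n) \<omega>)\<^sup>2" by blast
        then show ?case by (rule min.mono[OF order_refl])
      qed
    qed
    also have "\<dots> = (\<integral>x. min 1 (\<beta> ^ n * x\<^sup>2) \<partial>distr M borel (\<sigma> (- int n)))"
      by (subst integral_distr) auto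
    also have "\<dots> = (\<integral>\<omega>. min 1 (\<beta> ^ n * (\<sigma> 0 \<omega>)\<^sup>2) \<partial>M)"
      unfolding distr_sigma[of "- int n"] by (subst integral_distr) auto
    finally show ?thesis .
  qed
  have "(\<lambda>n. \<integral>\<omega>. min 1 (\<beta> ^ n * (\<sigma> 0 \<omega>)\<^sup>2) \<partial>M) \<longlonglongrightarrow> (\<integral>\<omega>. min 1 (0 * (\<sigma> 0 \<omega>)\<^sup>2) \<partial>M)"
  proof (rule integral_dominated_convergence[where w="\<lambda>_. 1"])
    have "(\<lambda>n. \<beta> ^ n) \<longlonglongrightarrow> 0"
      using beta_pos beta_less_1 by (intro LIMSEQ_realpow_zero) auto
    then have "(\<lambda>n. min 1 (\<beta> ^ n * (\<sigma> 0 \<omega>)\<^sup>2)) \<longlonglongrightarrow> min 1 (0 * (\<sigma> 0 \<omega>)\<^sup>2)" for \<omega>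
      by (intro tendsto_min tendsto_mult tendsto_const)
    then show "AE \<omega> in M. (\<lambda>n. min 1 (\<beta> ^ n * (\<sigma> 0 \<omega>)\<^sup>2)) \<longlonglongrightarrow> min 1 (0 * (\<sigma> 0 \<omega>)\<^sup>2)" by simp
    have "0 \<le> \<beta> ^ n * (\<sigma> 0 \<omega>)\<^sup>2" for n \<omega> using beta_pos by simp
    then show "AE \<omega> in M. norm (min 1 (\<beta> ^ n * (\<sigma> 0 \<omega>)\<^sup>2)) \<le> 1" for n by simp
  qed auto
  then have "(\<lambda>n. \<integral>\<omega>. min 1 (\<beta> ^ n * (\<sigma> 0 \<omega>)\<^sup>2) \<partial>M) \<longlonglongrightarrow> 0" by simp
  then have "(\<integral>\<omega>. min 1 (Z \<omega>) \<partial>M) \<le> 0"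
    by (rule LIMSEQ_le_const) (use le in auto)
  moreover have "AE \<omega> in M. 0 \<le> min 1 (Z \<omega>)"
    using Z
  proof eventually_elim
    case (elim \<omega>)
    then have "0 \<le> Z \<omega>" by blast
    then show ?case by simp
  qed
  moreover note Z_int
  ultimately have "AE \<omega> in M. min 1 (Z \<omega>) = 0"
    using integral_nonneg_eq_0_iff_AE[of M "\<lambda>\<omega>. min 1 (Z \<omega>)"] integral_nonneg_AE[of "\<lambda>\<omega>. min 1 (Z \<omega>)" M]
    by (simp only: order.antisym)
  then show ?thesis
  proof eventually_elim
    case (elim \<omega>)
    then have "Z \<omega> = 0" by linarith
    then show ?case by (simp add: Z_def)
  qed
qed

lemma initial_variance_ge: "AE \<omega> in M. \<alpha> \<le> initial_variance \<omega>"
  using sigma_eq_initial_variance sigma_rec[of 0]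
proof eventually_elim
  case (elim \<omega>)
  have "0 \<le> \<gamma> * (\<epsilon> (0 - 1) \<omega> - \<delta>)\<^sup>2" "0 \<le> \<beta> * (\<sigma> (0 - 1) \<omega>)\<^sup>2"
    using gamma_nonneg beta_pos by auto
  then show ?case using elim by linarith
qed

text \<open>The terms are nonnegative with means in geometric progression. This supplies the first
  moment of P on which the moment bounds of the chain rest.\<close>

lemma integrable_initial_variance: "integrable M initial_variance"
proof -
  have nonneg: "0 \<le> \<beta> ^ k * innovation k \<omega>" for k \<omega>
    using beta_pos alpha_pos innovation_ge[of k \<omega>] by simp
  define c where "c = (\<integral>\<omega>. \<alpha> + \<gamma> * (\<epsilon> 0 \<omega> - \<delta>)\<^sup>2 \<partial>M)"
  have "(\<epsilon> 0 \<omega> - \<delta>)\<^sup>2 = (\<epsilon> 0 \<omega>)\<^sup>2 - 2 * \<delta> * \<epsilon> 0 \<omega> + \<delta>\<^sup>2" for \<omega>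
    by (simp add: power2_eq_square algebra_simps)
  then have int: "integrable M (\<lambda>\<omega>. \<alpha> + \<gamma> * (\<epsilon> 0 \<omega> - \<delta>)\<^sup>2)"
    using integrable_eps integrable_eps_sq by auto
  have c_nonneg: "0 \<le> c"
    unfolding c_def using alpha_pos gamma_nonneg by (intro integral_nonneg_AE) auto
  have mean: "(\<integral>\<^sup>+\<omega>. ennreal (innovation k \<omega>) \<partial>M) = ennreal c" for k
  proof -
    have "(\<integral>\<^sup>+\<omega>. ennreal (innovation k \<omega>) \<partial>M) =
        (\<integral>\<^sup>+y. ennreal (\<alpha> + \<gamma> * (y - \<delta>)\<^sup>2) \<partial>distr M borel (\<epsilon> (- 1 - int k)))"
      by (subst nn_integral_distr) (auto simp: innovation_def)
    also have "\<dots> = (\<integral>\<^sup>+\<omega>. ennreal (\<alpha> + \<gamma> * (\<epsilon> 0 \<omega> - \<delta>)\<^sup>2) \<partial>M)"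
      unfolding distr_eps[of "- 1 - int k"] by (subst nn_integral_distr) auto
    also have "\<dots> = ennreal c"
      unfolding c_def using alpha_pos gamma_nonneg by (intro nn_integral_eq_integral int) auto
    finally show ?thesis .
  qed
  have "(\<integral>\<^sup>+\<omega>. ennreal (initial_variance \<omega>) \<partial>M) = (\<integral>\<^sup>+\<omega>. (\<Sum>k. ennreal (\<beta> ^ k * innovation k \<omega>)) \<partial>M)"
  proof (rule nn_integral_cong_AE)
    show "AE \<omega> in M. ennreal (initial_variance \<omega>) = (\<Sum>k. ennreal (\<beta> ^ k * innovation k \<omega>))"
      using summable_innovations
      by eventually_elim (auto simp: initial_variance_def intro!: suminf_ennreal2[symmetric] nonneg)
  qed
  also have "\<dots> = (\<Sum>k. \<integral>\<^sup>+\<omega>. ennreal (\<beta> ^ k * innovation k \<omega>) \<partial>M)"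
    by (rule nn_integral_suminf) measurable
  also have "\<dots> = (\<Sum>k. ennreal (\<beta> ^ k * c))"
  proof (rule suminf_cong)
    fix k
    have "(\<integral>\<^sup>+\<omega>. ennreal (\<beta> ^ k * innovation k \<omega>) \<partial>M) = (\<integral>\<^sup>+\<omega>. ennreal (\<beta> ^ k) * ennreal (innovation k \<omega>) \<partial>M)"
    proof (rule nn_integral_cong)
      fix \<omega>
      have "0 \<le> \<beta> ^ k" "0 \<le> innovation k \<omega>"
        using beta_pos alpha_pos innovation_ge[of k \<omega>] by auto
      then show "ennreal (\<beta> ^ k * innovation k \<omega>) = ennreal (\<beta> ^ k) * ennreal (innovation k \<omega>)"
        by (rule ennreal_mult)
    qed
    also have "\<dots> = ennreal (\<beta> ^ k) * ennreal c"
      by (subst nn_integral_cmult) (auto simp: mean)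
    also have "\<dots> = ennreal (\<beta> ^ k * c)"
      using beta_pos c_nonneg by (intro ennreal_mult[symmetric]) auto
    finally show "(\<integral>\<^sup>+\<omega>. ennreal (\<beta> ^ k * innovation k \<omega>) \<partial>M) = ennreal (\<beta> ^ k * c)" .
  qed
  also have "\<dots> = ennreal (\<Sum>k. \<beta> ^ k * c)"
    using beta_pos beta_less_1 c_nonneg by (intro suminf_ennreal2) (auto intro!: summable_mult2 summable_geometric)
  finally have "(\<integral>\<^sup>+\<omega>. ennreal (initial_variance \<omega>) \<partial>M) < \<infinity>" by simp
  moreover have "AE \<omega> in M. 0 \<le> initial_variance \<omega>"
    using initial_variance_ge by eventually_elim (use alpha_pos in linarith)
  ultimately show ?thesis by (intro integrableI_nonneg) auto
qed

abbreviation noise_law :: "real measure" where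
  "noise_law \<equiv> distr M borel (\<epsilon> 0)"

abbreviation variance_law :: "real measure" where
  "variance_law \<equiv> distr M borel initial_variance"

definition future :: "'a \<Rightarrow> nat \<Rightarrow> real" where
  "future \<omega> t = \<epsilon> (int t) \<omega>"

lemma measurable_future [measurable]: "future \<in> M \<rightarrow>\<^sub>M (\<Pi>\<^sub>M t\<in>UNIV. borel)"
  by (rule measurable_PiM_single') (auto simp: future_def)

lemma distr_future: "distr M (\<Pi>\<^sub>M t\<in>UNIV. borel) future = (\<Pi>\<^sub>M t\<in>UNIV. noise_law)"
proof -
  have all: "distr M (\<Pi>\<^sub>M t\<in>UNIV. borel) (\<lambda>\<omega> t. \<epsilon> t \<omega>) = (\<Pi>\<^sub>M t\<in>(UNIV :: int set). noise_law)"
  proof -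
    have "(\<lambda>t. distr M borel (\<epsilon> t)) = (\<lambda>_. noise_law)"
      by (rule ext) (rule distr_eps)
    then show ?thesis
      using indep_vars_iff_distr_eq_PiM[of UNIV \<epsilon> "\<lambda>_. borel"] indep_eps by (simp add: restrict_def)
  qed
  have [measurable]: "(\<lambda>\<omega> t. \<epsilon> t \<omega>) \<in> M \<rightarrow>\<^sub>M (\<Pi>\<^sub>M t\<in>UNIV. borel)"
    by (rule measurable_PiM_single') auto
  have [measurable]: "(\<lambda>x t. x (int t)) \<in> (\<Pi>\<^sub>M t\<in>UNIV. borel) \<rightarrow>\<^sub>M (\<Pi>\<^sub>M t\<in>(UNIV :: nat set). borel :: real measure)"
    by (rule measurable_PiM_single') auto
  have "(\<Pi>\<^sub>M t\<in>(UNIV :: nat set). noise_law) =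
      distr (\<Pi>\<^sub>M t\<in>(UNIV :: int set). noise_law) (\<Pi>\<^sub>M t\<in>(UNIV :: nat set). noise_law) (\<lambda>x. \<lambda>t\<in>UNIV. x (int t))"
    by (rule distr_PiM_reindex[symmetric]) (auto intro: prob_space_distr)
  also have "\<dots> = distr (\<Pi>\<^sub>M t\<in>(UNIV :: int set). noise_law) (\<Pi>\<^sub>M t\<in>(UNIV :: nat set). borel) (\<lambda>x t. x (int t))"
    by (rule distr_cong) (auto intro!: sets_PiM_cong)
  also have "\<dots> = distr M (\<Pi>\<^sub>M t\<in>UNIV. borel) future"
    unfolding all[symmetric] by (subst distr_distr) (auto simp: comp_def future_def[abs_def])
  finally show ?thesis ..
qed

text \<open>The two components depend on disjoint blocks of the noise, times below 0 and times from
  0 on.\<close>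

lemma distr_initial_future:
  "distr M (borel \<Otimes>\<^sub>M (\<Pi>\<^sub>M t\<in>UNIV. borel)) (\<lambda>\<omega>. (initial_variance \<omega>, future \<omega>)) =
    variance_law \<Otimes>\<^sub>M (\<Pi>\<^sub>M t\<in>UNIV. noise_law)"
proof -
  let ?A = "{..<0} :: int set" and ?B = "{0..} :: int set"
  let ?X = "\<lambda>\<omega>. restrict (\<lambda>i. \<epsilon> i \<omega>) ?A" and ?Y = "\<lambda>\<omega>. restrict (\<lambda>i. \<epsilon> i \<omega>) ?B"
  let ?MA = "PiM ?A (\<lambda>_. borel :: real measure)" and ?MB = "PiM ?B (\<lambda>_. borel :: real measure)"
  have "indep_var ?MA ?X ?MB ?Y"
    by (rule indep_var_restrict[OF indep_eps]) auto
  then have prod: "distr M ?MA ?X \<Otimes>\<^sub>M distr M ?MB ?Y = distr M (?MA \<Otimes>\<^sub>M ?MB) (\<lambda>\<omega>. (?X \<omega>, ?Y \<omega>))"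
    and [measurable]: "?X \<in> M \<rightarrow>\<^sub>M ?MA" "?Y \<in> M \<rightarrow>\<^sub>M ?MB"
    by (auto simp: indep_var_distribution_eq)
  define F where "F x = (\<Sum>k. \<beta> ^ k * (\<alpha> + \<gamma> * (x (- 1 - int k) - \<delta>)\<^sup>2))" for x :: "int \<Rightarrow> real"
  define H where "H y t = y (int t)" for y :: "int \<Rightarrow> real" and t :: nat
  have [measurable]: "F \<in> borel_measurable ?MA"
  proof -
    have [measurable]: "(\<lambda>x. x (- 1 - int k)) \<in> borel_measurable ?MA" for k
      by (rule measurable_component_singleton) simp
    show ?thesis unfolding F_def by measurable
  qed
  have [measurable]: "H \<in> ?MB \<rightarrow>\<^sub>M (\<Pi>\<^sub>M t\<in>UNIV. borel)"
    unfolding H_def by (rule measurable_PiM_single') (auto intro: measurable_component_singleton)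
  have FX: "F (?X \<omega>) = initial_variance \<omega>" and HY: "H (?Y \<omega>) = future \<omega>" for \<omega>
    by (auto simp: F_def H_def initial_variance_def innovation_def future_def fun_eq_iff)
  have "prob_space (distr (distr M ?MB ?Y) (\<Pi>\<^sub>M t\<in>UNIV. borel) H)"
    by (intro prob_space.prob_space_distr prob_space_distr) measurable
  then have "distr (distr M ?MA ?X) borel F \<Otimes>\<^sub>M distr (distr M ?MB ?Y) (\<Pi>\<^sub>M t\<in>UNIV. borel) H =
      distr (distr M ?MA ?X \<Otimes>\<^sub>M distr M ?MB ?Y) (borel \<Otimes>\<^sub>M (\<Pi>\<^sub>M t\<in>UNIV. borel)) (\<lambda>(x, y). (F x, H y))"
    by (intro pair_measure_distr prob_space_imp_sigma_finite) measurable
  also have "\<dots> = distr M (borel \<Otimes>\<^sub>M (\<Pi>\<^sub>M t\<in>UNIV. borel)) (\<lambda>\<omega>. (F (?X \<omega>), H (?Y \<omega>)))"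
    unfolding prod by (subst distr_distr) (auto simp: comp_def)
  also have "distr (distr M ?MA ?X) borel F = variance_law"
    by (subst distr_distr) (auto simp: comp_def FX)
  also have "distr (distr M ?MB ?Y) (\<Pi>\<^sub>M t\<in>UNIV. borel) H = (\<Pi>\<^sub>M t\<in>UNIV. noise_law)"
    by (subst distr_distr) (auto simp: comp_def HY distr_future[symmetric])
  finally show ?thesis unfolding FX HY by simp
qed

lemma distr_initial_noise:
  "distr M plane (\<lambda>\<omega>. (initial_variance \<omega>, \<epsilon> 0 \<omega>)) = variance_law \<Otimes>\<^sub>M noise_law"
proof -
  let ?S = "\<Pi>\<^sub>M t\<in>(UNIV :: nat set). borel :: real measure"
  have "distr M plane (\<lambda>\<omega>. (initial_variance \<omega>, \<epsilon> 0 \<omega>)) =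
      distr (distr M (borel \<Otimes>\<^sub>M ?S) (\<lambda>\<omega>. (initial_variance \<omega>, future \<omega>))) plane (\<lambda>(s, e). (s, e 0))"
    by (subst distr_distr) (auto simp: comp_def future_def)
  also have "\<dots> = distr (variance_law \<Otimes>\<^sub>M (\<Pi>\<^sub>M t\<in>(UNIV :: nat set). noise_law)) plane (\<lambda>(s, e). (s, e 0))"
    by (simp add: distr_initial_future)
  also have "\<dots> = distr variance_law borel (\<lambda>s. s) \<Otimes>\<^sub>M distr (\<Pi>\<^sub>M t\<in>(UNIV :: nat set). noise_law) borel (\<lambda>e. e 0)"
  proof (rule pair_measure_distr[symmetric])
    have "prob_space (distr (\<Pi>\<^sub>M t\<in>(UNIV :: nat set). noise_law) borel (\<lambda>e. e 0))"
      by (rule prob_space.prob_space_distr[OF prob_space_PiM]) (auto intro: prob_space_distr)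
    then show "sigma_finite_measure (distr (\<Pi>\<^sub>M t\<in>(UNIV :: nat set). noise_law) borel (\<lambda>e. e 0))"
      by (rule prob_space_imp_sigma_finite)
  qed auto
  also have "distr (\<Pi>\<^sub>M t\<in>(UNIV :: nat set). noise_law) borel (\<lambda>e. e 0) = noise_law"
  proof -
    have "distr (\<Pi>\<^sub>M t\<in>(UNIV :: nat set). noise_law) borel (\<lambda>e. e 0) = distr M borel (\<lambda>\<omega>. future \<omega> 0)"
      unfolding distr_future[symmetric] by (subst distr_distr) (auto simp: comp_def)
    then show ?thesis by (simp add: future_def)
  qed
  finally show ?thesis by (simp add: distr_distr comp_def)
qed

text \<open>One step from the variance at time 0 gives the squared volatility at time 1, which has
  the same law by stationarity of \<sigma>.\<close>

lemma variance_law_invariant: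
  "distr (variance_law \<Otimes>\<^sub>M noise_law) borel (\<lambda>(s, y). \<alpha> + \<beta> * max \<alpha> s + \<gamma> * (y - \<delta>)\<^sup>2) = variance_law"
proof -
  have "distr (variance_law \<Otimes>\<^sub>M noise_law) borel (\<lambda>(s, y). \<alpha> + \<beta> * max \<alpha> s + \<gamma> * (y - \<delta>)\<^sup>2) =
      distr M borel (\<lambda>\<omega>. \<alpha> + \<beta> * max \<alpha> (initial_variance \<omega>) + \<gamma> * (\<epsilon> 0 \<omega> - \<delta>)\<^sup>2)"
    unfolding distr_initial_noise[symmetric] by (subst distr_distr) (auto simp: comp_def)
  also have "\<dots> = distr M borel (\<lambda>\<omega>. (\<sigma> 1 \<omega>)\<^sup>2)"
  proof (rule distr_cong_AE)
    show "AE \<omega> in M. \<alpha> + \<beta> * max \<alpha> (initial_variance \<omega>) + \<gamma> * (\<epsilon> 0 \<omega> - \<delta>)\<^sup>2 = (\<sigma> 1 \<omega>)\<^sup>2"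
      using sigma_eq_initial_variance initial_variance_ge sigma_rec[of 1]
      by eventually_elim (simp add: max_absorb2)
  qed auto
  also have "\<dots> = distr (distr M borel (\<sigma> 1)) borel (\<lambda>x. x\<^sup>2)"
    by (subst distr_distr) (auto simp: comp_def)
  also have "\<dots> = distr M borel (\<lambda>\<omega>. (\<sigma> 0 \<omega>)\<^sup>2)"
    unfolding distr_sigma[of 1] by (subst distr_distr) (auto simp: comp_def)
  also have "\<dots> = variance_law"
    by (rule distr_cong_AE) (use sigma_eq_initial_variance in auto)
  finally show ?thesis .
qed

end

section \<open>Stationary trajectories driven by an invariant law\<close>

text \<open>For fixed u the variable q (X, u) is a function of X alone, so the rectangle
  probabilities factor; integration over u preserves this. It lets extra randomness enter the
  initial state while the noise stays independent.\<close>

lemma distr_pair_with_independent_noise: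
  assumes "prob_space M" "prob_space U" "prob_space R" and [measurable_cong]: "sets R = sets K"
    and [measurable]: "X \<in> M \<rightarrow>\<^sub>M N" "Y \<in> M \<rightarrow>\<^sub>M K" "q \<in> N \<Otimes>\<^sub>M U \<rightarrow>\<^sub>M L"
    and joint: "distr M (N \<Otimes>\<^sub>M K) (\<lambda>\<omega>. (X \<omega>, Y \<omega>)) = distr M N X \<Otimes>\<^sub>M R"
  shows "distr (M \<Otimes>\<^sub>M U) (L \<Otimes>\<^sub>M K) (\<lambda>(\<omega>, u). (q (X \<omega>, u), Y \<omega>)) = distr (distr M N X \<Otimes>\<^sub>M U) L q \<Otimes>\<^sub>M R"
proof (rule pair_measure_eqI[symmetric])
  interpret M: prob_space M by fact
  interpret U: prob_space U by fact
  interpret R: prob_space R by fact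
  interpret X: prob_space "distr M N X" by (rule M.prob_space_distr) simp
  interpret MU: pair_prob_space M U ..
  interpret XU: pair_prob_space "distr M N X" U ..
  have q': "q \<in> distr M N X \<Otimes>\<^sub>M U \<rightarrow>\<^sub>M L" by measurable
  interpret Q: prob_space "distr (distr M N X \<Otimes>\<^sub>M U) L q"
    by (rule XU.prob_space_distr[OF q'])
  show "sigma_finite_measure (distr (distr M N X \<Otimes>\<^sub>M U) L q)" "sigma_finite_measure R"
    by (rule Q.sigma_finite_measure_axioms, rule R.sigma_finite_measure_axioms)
  show "sets (distr (distr M N X \<Otimes>\<^sub>M U) L q \<Otimes>\<^sub>M R) =
      sets (distr (M \<Otimes>\<^sub>M U) (L \<Otimes>\<^sub>M K) (\<lambda>(\<omega>, u). (q (X \<omega>, u), Y \<omega>)))"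
    using assms(4) by (simp cong: sets_pair_measure_cong)
  fix A B assume "A \<in> sets (distr (distr M N X \<Otimes>\<^sub>M U) L q)" "B \<in> sets R"
  then have [measurable]: "A \<in> sets L" "B \<in> sets K" using assms(4) by auto
  let ?E = "{w \<in> space (M \<Otimes>\<^sub>M U). q (X (fst w), snd w) \<in> A \<and> Y (fst w) \<in> B}"
  have E: "?E \<in> sets (M \<Otimes>\<^sub>M U)" by measurable
  have "emeasure (distr (M \<Otimes>\<^sub>M U) (L \<Otimes>\<^sub>M K) (\<lambda>(\<omega>, u). (q (X \<omega>, u), Y \<omega>))) (A \<times> B) = emeasure (M \<Otimes>\<^sub>M U) ?E"
    by (subst emeasure_distr) (auto intro!: arg_cong[where f="emeasure (M \<Otimes>\<^sub>M U)"])
  also have "\<dots> = (\<integral>\<^sup>+u. emeasure M ((\<lambda>\<omega>. (\<omega>, u)) -` ?E) \<partial>U)"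
    by (rule MU.emeasure_pair_measure_alt2[OF E])
  also have "\<dots> = (\<integral>\<^sup>+u. emeasure (distr M N X) {s \<in> space N. q (s, u) \<in> A} * emeasure R B \<partial>U)"
  proof (rule nn_integral_cong)
    fix u assume u [measurable]: "u \<in> space U"
    have [measurable]: "(\<lambda>s. q (s, u)) \<in> N \<rightarrow>\<^sub>M L" by measurable
    have S: "{s \<in> space N. q (s, u) \<in> A} \<in> sets N" by measurable
    have "(\<lambda>\<omega>. (\<omega>, u)) -` ?E = (\<lambda>\<omega>. (X \<omega>, Y \<omega>)) -` ({s \<in> space N. q (s, u) \<in> A} \<times> B) \<inter> space M"
      using u measurable_space[OF assms(5)] by (auto simp: space_pair_measure)
    then have "emeasure M ((\<lambda>\<omega>. (\<omega>, u)) -` ?E) =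
        emeasure (distr M (N \<Otimes>\<^sub>M K) (\<lambda>\<omega>. (X \<omega>, Y \<omega>))) ({s \<in> space N. q (s, u) \<in> A} \<times> B)"
      using S by (subst emeasure_distr) auto
    also have "\<dots> = emeasure (distr M N X) {s \<in> space N. q (s, u) \<in> A} * emeasure R B"
      unfolding joint using S by (intro R.emeasure_pair_measure_Times) (auto simp: assms(4))
    finally show "emeasure M ((\<lambda>\<omega>. (\<omega>, u)) -` ?E) = emeasure (distr M N X) {s \<in> space N. q (s, u) \<in> A} * emeasure R B" .
  qed
  also have "\<dots> = (\<integral>\<^sup>+u. emeasure (distr M N X) ((\<lambda>s. (s, u)) -` (q -` A \<inter> space (distr M N X \<Otimes>\<^sub>M U))) * emeasure R B \<partial>U)"
    by (intro nn_integral_cong arg_cong2[where f="(*)"] arg_cong[where f="emeasure (distr M N X)"] refl)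
       (auto simp: space_pair_measure)
  also have "\<dots> = (\<integral>\<^sup>+u. emeasure (distr M N X) ((\<lambda>s. (s, u)) -` (q -` A \<inter> space (distr M N X \<Otimes>\<^sub>M U))) \<partial>U) * emeasure R B"
  proof (rule nn_integral_multc)
    show "(\<lambda>u. emeasure (distr M N X) ((\<lambda>s. (s, u)) -` (q -` A \<inter> space (distr M N X \<Otimes>\<^sub>M U)))) \<in> borel_measurable U"
      by (rule XU.measurable_emeasure_Pair2) (rule measurable_sets[OF q'], simp)
  qed
  also have "\<dots> = emeasure (distr M N X \<Otimes>\<^sub>M U) (q -` A \<inter> space (distr M N X \<Otimes>\<^sub>M U)) * emeasure R B"
  proof -
    have "q -` A \<inter> space (distr M N X \<Otimes>\<^sub>M U) \<in> sets (distr M N X \<Otimes>\<^sub>M U)"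
      by (rule measurable_sets[OF q']) simp
    then show ?thesis by (simp only: XU.emeasure_pair_measure_alt2)
  qed
  also have "\<dots> = emeasure (distr (distr M N X \<Otimes>\<^sub>M U) L q) A * emeasure R B"
    by (subst emeasure_distr[OF q']) auto
  finally show "emeasure (distr (distr M N X \<Otimes>\<^sub>M U) L q) A * emeasure R B =
      emeasure (distr (M \<Otimes>\<^sub>M U) (L \<Otimes>\<^sub>M K) (\<lambda>(\<omega>, u). (q (X \<omega>, u), Y \<omega>))) (A \<times> B)" by simp
qed

lemma indep_rv_if_distr_pair:
  assumes "prob_space M" and X: "X \<in> M \<rightarrow>\<^sub>M N" and Y: "Y \<in> M \<rightarrow>\<^sub>M K"
    and joint: "distr M (N \<Otimes>\<^sub>M K) (\<lambda>\<omega>. (X \<omega>, Y \<omega>)) = distr M N X \<Otimes>\<^sub>M distr M K Y"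
  shows "indep_rv M N X K Y"
proof -
  interpret prob_space M by fact
  interpret Y: prob_space "distr M K Y" by (rule prob_space_distr[OF Y])
  have "indep_set {X -` A \<inter> space M | A. A \<in> sets N} {Y -` B \<inter> space M | B. B \<in> sets K}"
  proof (rule indep_setI)
    show "{X -` A \<inter> space M | A. A \<in> sets N} \<subseteq> events" "{Y -` B \<inter> space M | B. B \<in> sets K} \<subseteq> events"
      using X Y by (auto intro: measurable_sets)
    fix a b assume "a \<in> {X -` A \<inter> space M | A. A \<in> sets N}" "b \<in> {Y -` B \<inter> space M | B. B \<in> sets K}"
    then obtain A B where A: "a = X -` A \<inter> space M" "A \<in> sets N" and B: "b = Y -` B \<inter> space M" "B \<in> sets K"
      by auto
    have "a \<inter> b = (\<lambda>\<omega>. (X \<omega>, Y \<omega>)) -` (A \<times> B) \<inter> space M" using A B by auto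
    then have "emeasure M (a \<inter> b) = emeasure (distr M (N \<Otimes>\<^sub>M K) (\<lambda>\<omega>. (X \<omega>, Y \<omega>))) (A \<times> B)"
      using A B X Y by (subst emeasure_distr) auto
    also have "\<dots> = emeasure (distr M N X) A * emeasure (distr M K Y) B"
      unfolding joint using A B by (intro Y.emeasure_pair_measure_Times) auto
    also have "\<dots> = emeasure M a * emeasure M b"
      using A B X Y by (simp add: emeasure_distr)
    finally show "prob (a \<inter> b) = prob a * prob b"
      by (simp add: measure_def enn2real_mult)
  qed
  then show ?thesis unfolding indep_rv_def using X Y by simp
qed

lemma HV_eq:
  assumes "0 < s" "0 < x"
  shows "HV (\<alpha>, \<beta>, \<gamma>, \<delta>) (sqrt s * y) x = \<alpha> + \<beta> * x + \<gamma> * (y * sqrt (s / x) - \<delta>)\<^sup>2"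
proof -
  have "x powr (- 1 / 2) = 1 / sqrt x"
    using assms powr_minus[of x "1/2"] by (simp add: powr_half_sqrt inverse_eq_divide)
  then show ?thesis
    using assms by (simp add: HV_def real_sqrt_divide mult.commute)
qed

context vgarch_chain begin

primrec trajectory :: "(real \<times> real) \<Rightarrow> (nat \<Rightarrow> real) \<Rightarrow> nat \<Rightarrow> real \<times> real" where
  "trajectory z e 0 = z"
| "trajectory z e (Suc n) = step (trajectory z e n) (e n)"

abbreviation "seq_borel \<equiv> \<Pi>\<^sub>M t\<in>(UNIV :: nat set). (borel :: real measure)"
abbreviation "path_borel \<equiv> \<Pi>\<^sub>M t\<in>(UNIV :: nat set). plane"
abbreviation "noise_seq \<equiv> \<Pi>\<^sub>M t\<in>(UNIV :: nat set). \<rho>"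

lemma sets_noise_seq [measurable_cong]: "sets noise_seq = sets seq_borel"
  by (rule sets_PiM_cong) (simp_all add: sets_rho)

lemma measurable_trajectory_at [measurable]:
  "(\<lambda>w. trajectory (fst w) (snd w) n) \<in> plane \<Otimes>\<^sub>M seq_borel \<rightarrow>\<^sub>M plane"
proof (induction n)
  case (Suc n)
  note Suc [measurable]
  have [measurable]: "(\<lambda>w. snd w n) \<in> borel_measurable (plane \<Otimes>\<^sub>M seq_borel)"
    by measurable
  have "(\<lambda>w. (\<lambda>(z, y). step z y) (trajectory (fst w) (snd w) n, snd w n)) \<in>
      plane \<Otimes>\<^sub>M seq_borel \<rightarrow>\<^sub>M plane"
    by (rule measurable_compose[OF _ measurable_step]) measurable
  then show ?case by simp
qed simp

lemma measurable_trajectory: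
  "(\<lambda>w t. trajectory (fst w) (snd w) (t + h)) \<in> plane \<Otimes>\<^sub>M seq_borel \<rightarrow>\<^sub>M path_borel"
  by (rule measurable_PiM_single') (auto simp: space_pair_measure)

lemma trajectory_Suc: "trajectory z e (Suc n) = trajectory (step z (e 0)) (\<lambda>t. e (Suc t)) n"
  by (induction n) auto

text \<open>The skew product on state and future noise. Stationarity of trajectories is invariance
  of the product law under this map.\<close>

definition shift_state :: "(real \<times> real) \<times> (nat \<Rightarrow> real) \<Rightarrow> (real \<times> real) \<times> (nat \<Rightarrow> real)" where
  "shift_state w = (step (fst w) (snd w 0), \<lambda>t. snd w (Suc t))"

lemma measurable_shift_state [measurable]:
  "shift_state \<in> plane \<Otimes>\<^sub>M seq_borel \<rightarrow>\<^sub>M plane \<Otimes>\<^sub>M seq_borel"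
proof -
  have 1: "(\<lambda>w. (\<lambda>(z, y). step z y) (fst w, snd w 0)) \<in> plane \<Otimes>\<^sub>M seq_borel \<rightarrow>\<^sub>M plane"
    by (rule measurable_compose[OF _ measurable_step]) measurable
  have 2: "(\<lambda>w t. snd w (Suc t)) \<in> plane \<Otimes>\<^sub>M seq_borel \<rightarrow>\<^sub>M seq_borel"
    by (rule measurable_PiM_single') auto
  show ?thesis unfolding shift_state_def using measurable_Pair[OF 1 2] by simp
qed

text \<open>The noise sequence is one entry followed by an independent copy of itself. The entry
  drives one transition, under which \<mu> is invariant, and the copy is the new noise.\<close>

lemma distr_shift_state:
  assumes "prob_space \<mu>" and sets_mu [measurable_cong]: "sets \<mu> = sets plane" and inv: "transition \<mu> = \<mu>"
  shows "distr (\<mu> \<Otimes>\<^sub>M noise_seq) (plane \<Otimes>\<^sub>M seq_borel) shift_state = \<mu> \<Otimes>\<^sub>M noise_seq"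
proof (rule pair_measure_eqI[symmetric])
  interpret mu: prob_space \<mu> by fact
  interpret S: prob_space noise_seq by (rule prob_space_PiM) (rule prob_rho)
  interpret seq: sequence_space \<rho> ..
  show "sigma_finite_measure \<mu>" "sigma_finite_measure noise_seq"
    by (rule mu.sigma_finite_measure_axioms, rule S.sigma_finite_measure_axioms)
  show "sets (\<mu> \<Otimes>\<^sub>M noise_seq) = sets (distr (\<mu> \<Otimes>\<^sub>M noise_seq) (plane \<Otimes>\<^sub>M seq_borel) shift_state)"
    unfolding sets_distr by (rule sets_pair_measure_cong[OF sets_mu sets_noise_seq])
  fix A B assume AB: "A \<in> sets \<mu>" "B \<in> sets noise_seq"
  then have [measurable]: "A \<in> sets plane" and B[measurable]: "B \<in> sets seq_borel"
    using sets_mu sets_noise_seq by auto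
  have [measurable]: "(\<lambda>e t. e (Suc t)) \<in> seq_borel \<rightarrow>\<^sub>M seq_borel"
    by (rule measurable_PiM_single') auto
  have "emeasure (distr (\<mu> \<Otimes>\<^sub>M noise_seq) (plane \<Otimes>\<^sub>M seq_borel) shift_state) (A \<times> B) =
      (\<integral>\<^sup>+w. indicator (A \<times> B) w \<partial>distr (\<mu> \<Otimes>\<^sub>M noise_seq) (plane \<Otimes>\<^sub>M seq_borel) shift_state)"
    by (rule nn_integral_indicator[symmetric]) simp
  also have "\<dots> = (\<integral>\<^sup>+w. indicator (A \<times> B) (shift_state w) \<partial>(\<mu> \<Otimes>\<^sub>M noise_seq))"
    by (rule nn_integral_distr) measurable
  also have "\<dots> = (\<integral>\<^sup>+z. \<integral>\<^sup>+e. indicator (A \<times> B) (shift_state (z, e)) \<partial>noise_seq \<partial>\<mu>)"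
    by (rule S.nn_integral_fst[symmetric]) measurable
  also have "\<dots> = (\<integral>\<^sup>+z. (\<integral>\<^sup>+y. indicator A (step z y) \<partial>\<rho>) * emeasure noise_seq B \<partial>\<mu>)"
  proof (rule nn_integral_cong)
    fix z
    have step_z: "(\<lambda>y. step z y) \<in> borel \<rightarrow>\<^sub>M plane"
      using measurable_compose[OF measurable_Pair1' measurable_step, of z] by (simp add: space_pair_measure)
    have A_step: "(\<lambda>y. indicator A (step z y) :: ennreal) \<in> borel_measurable \<rho>"
      unfolding measurable_cong_sets[OF sets_rho refl]
      by (rule measurable_compose[OF step_z]) measurable
    have [measurable]: "(\<lambda>e. shift_state (z, e)) \<in> seq_borel \<rightarrow>\<^sub>M plane \<Otimes>\<^sub>M seq_borel"
      by (rule measurable_compose[OF measurable_Pair1' measurable_shift_state]) (simp add: space_pair_measure)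
    have [measurable]: "(\<lambda>e. indicator (A \<times> B) (shift_state (z, e)) :: ennreal) \<in> borel_measurable noise_seq"
      by measurable
    have "(\<integral>\<^sup>+e. indicator (A \<times> B) (shift_state (z, e)) \<partial>noise_seq) =
        (\<integral>\<^sup>+e. indicator (A \<times> B) (shift_state (z, e)) \<partial>distr (\<rho> \<Otimes>\<^sub>M noise_seq) noise_seq (\<lambda>(y, e). case_nat y e))"
      by (simp only: seq.PiM_iter)
    also have "\<dots> = (\<integral>\<^sup>+w. indicator (A \<times> B) (shift_state (z, (case w of (y, e) \<Rightarrow> case_nat y e))) \<partial>(\<rho> \<Otimes>\<^sub>M noise_seq))"
      by (rule nn_integral_distr) measurable
    also have "\<dots> = (\<integral>\<^sup>+w. indicator A (step z (fst w)) * indicator B (snd w) \<partial>(\<rho> \<Otimes>\<^sub>M noise_seq))"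
      by (intro nn_integral_cong) (auto simp: shift_state_def split: split_indicator)
    also have "\<dots> = (\<integral>\<^sup>+y. \<integral>\<^sup>+e. indicator A (step z (fst (y, e))) * indicator B (snd (y, e)) \<partial>noise_seq \<partial>\<rho>)"
    proof (rule S.nn_integral_fst[symmetric])
      have "(\<lambda>w. indicator A (step z (fst w)) :: ennreal) \<in> borel_measurable (\<rho> \<Otimes>\<^sub>M noise_seq)"
        by (rule measurable_compose[OF measurable_fst A_step])
      then show "(\<lambda>w. indicator A (step z (fst w)) * indicator B (snd w) :: ennreal) \<in> borel_measurable (\<rho> \<Otimes>\<^sub>M noise_seq)"
        by measurable
    qed
    also have "\<dots> = (\<integral>\<^sup>+y. indicator A (step z y) * emeasure noise_seq B \<partial>\<rho>)"
      using AB(2) by (simp add: nn_integral_cmult)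
    also have "\<dots> = (\<integral>\<^sup>+y. indicator A (step z y) \<partial>\<rho>) * emeasure noise_seq B"
      by (rule nn_integral_multc[OF A_step])
    finally show "(\<integral>\<^sup>+e. indicator (A \<times> B) (shift_state (z, e)) \<partial>noise_seq) =
        (\<integral>\<^sup>+y. indicator A (step z y) \<partial>\<rho>) * emeasure noise_seq B" .
  qed
  also have "\<dots> = (\<integral>\<^sup>+z. \<integral>\<^sup>+y. indicator A (step z y) \<partial>\<rho> \<partial>\<mu>) * emeasure noise_seq B"
    by (rule nn_integral_multc) measurable
  also have "(\<integral>\<^sup>+z. \<integral>\<^sup>+y. indicator A (step z y) \<partial>\<rho> \<partial>\<mu>) = (\<integral>\<^sup>+z. indicator A z \<partial>transition \<mu>)"
    by (rule nn_integral_transition[OF sets_mu, symmetric]) measurable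
  also have "\<dots> = emeasure \<mu> A"
    unfolding inv using AB(1) by simp
  finally show "emeasure \<mu> A * emeasure noise_seq B =
      emeasure (distr (\<mu> \<Otimes>\<^sub>M noise_seq) (plane \<Otimes>\<^sub>M seq_borel) shift_state) (A \<times> B)" by simp
qed

lemma distr_trajectory_shift:
  assumes "prob_space \<mu>" and sets_mu [measurable_cong]: "sets \<mu> = sets plane" and inv: "transition \<mu> = \<mu>"
  shows "distr (\<mu> \<Otimes>\<^sub>M noise_seq) path_borel (\<lambda>w t. trajectory (fst w) (snd w) (t + h)) =
    distr (\<mu> \<Otimes>\<^sub>M noise_seq) path_borel (\<lambda>w t. trajectory (fst w) (snd w) t)"
proof (induction h)
  case (Suc h)
  have sets_joint [measurable_cong]: "sets (\<mu> \<Otimes>\<^sub>M noise_seq) = sets (plane \<Otimes>\<^sub>M seq_borel)"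
    by (rule sets_pair_measure_cong[OF sets_mu sets_noise_seq])
  have "distr (\<mu> \<Otimes>\<^sub>M noise_seq) path_borel (\<lambda>w t. trajectory (fst w) (snd w) (t + Suc h)) =
      distr (\<mu> \<Otimes>\<^sub>M noise_seq) path_borel ((\<lambda>w t. trajectory (fst w) (snd w) (t + h)) \<circ> shift_state)"
    by (simp only: comp_def shift_state_def fst_conv snd_conv trajectory_Suc[symmetric] add_Suc_right)
  also have "\<dots> = distr (distr (\<mu> \<Otimes>\<^sub>M noise_seq) (plane \<Otimes>\<^sub>M seq_borel) shift_state) path_borel
      (\<lambda>w t. trajectory (fst w) (snd w) (t + h))"
    by (rule distr_distr[symmetric, OF measurable_trajectory]) measurable
  also have "\<dots> = distr (\<mu> \<Otimes>\<^sub>M noise_seq) path_borel (\<lambda>w t. trajectory (fst w) (snd w) (t + h))"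
    by (simp only: distr_shift_state[OF assms])
  finally show ?case using Suc by simp
qed simp

lemma trajectory_ge:
  assumes "\<alpha> \<le> fst z" "\<alpha> \<le> snd z"
  shows "\<alpha> \<le> fst (trajectory z e n)" "\<alpha> \<le> snd (trajectory z e n)"
  using assms step_ge by (cases n; simp)+

lemma step_eq_HV:
  assumes "\<alpha> \<le> fst z" "\<alpha> \<le> snd z"
  shows "fst (step z y) = HV (\<alpha>, \<beta>, \<gamma>, \<delta>) (sqrt (fst z) * y) (fst z)"
    and "snd (step z y) = HV (\<alpha>, \<beta>, \<gamma>, \<delta>) (sqrt (fst z) * y) (snd z)"
  using assms alpha_pos by (auto simp: HV_eq step_def step1_def max_absorb2)

end

section \<open>Construction of the stationary pair\<close>

theorem theorem3p2:
  fixes M :: "'a measure"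
    and \<epsilon> \<sigma> :: "int \<Rightarrow> 'a \<Rightarrow> real"
    and \<alpha> \<beta> \<gamma> \<delta> :: real
    and g :: "real \<Rightarrow> real"
  assumes "prob_space M"
    and "\<alpha> > 0" and "\<beta> > 0" and "\<gamma> \<ge> 0"
    and "iid M borel \<epsilon>"
    and "integrable M (\<lambda>\<omega>. ln (\<alpha> + \<gamma> * (\<epsilon> 0 \<omega> - \<delta>)\<^sup>2))" and "\<beta> < 1"
    and "distributed M lborel (\<epsilon> 0) (\<lambda>x. ennreal (g x))"
    and "continuous_on UNIV g"
    and "has_bochner_integral M (\<epsilon> 0) 0"
    and "has_bochner_integral M (\<lambda>\<omega>. (\<epsilon> 0 \<omega>)\<^sup>2) 1"
    and "\<forall>x. g x > 0"
    and "bdd_above (range (\<lambda>x. (\<bar>x\<bar> + 1) * g x))"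
    and "vgarch_stationary_volatility M (\<alpha>, \<beta>, \<gamma>, \<delta>) \<epsilon> \<sigma>"
    and "lyapunov_V M (\<alpha>, \<beta>, \<gamma>, \<delta>) \<epsilon> \<sigma> > 0"
  shows "\<exists>(M' :: ('a \<times> real) measure) \<pi> S S'.
           prob_extension M M' \<pi> \<and>
           stationary_pair_solution M' \<pi> (\<alpha>, \<beta>, \<gamma>, \<delta>) \<epsilon> \<sigma> S S' \<and>
           measure M' {\<omega> \<in> space M'. S 0 \<omega> = S' 0 \<omega>} = 0"
proof -
  have eps_int: "integrable M (\<epsilon> 0)" "integrable M (\<lambda>\<omega>. (\<epsilon> 0 \<omega>)\<^sup>2)"
    using assms(10,11) by (simp_all add: has_bochner_integral_iff)
  interpret V: vgarch_process M \<epsilon> \<sigma> \<alpha> \<beta> \<gamma> \<delta>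
    by (rule vgarch_process.intro) (fact assms eps_int)+
  let ?\<rho> = "distr M borel (\<epsilon> 0)"
  let ?P = "distr M borel V.initial_variance"
  let ?l = "\<lambda>\<omega>. ln \<bar>\<beta> - \<gamma> * \<epsilon> 0 \<omega> * inverse ((\<sigma> 0 \<omega>)\<^sup>2) * (\<epsilon> 0 \<omega> - \<delta>)\<bar>"
  have lyap: "0 < (\<integral>\<omega>. ?l \<omega> \<partial>M)"
    using assms(15) by (simp add: lyapunov_V_def)
  have "\<gamma> \<noteq> 0"
  proof
    assume "\<gamma> = 0"
    then have "0 < ln \<beta>" using lyap \<open>\<beta> > 0\<close> by (simp add: V.prob_space)
    then show False using \<open>\<beta> > 0\<close> \<open>\<beta> < 1\<close> by (simp add: ln_gt_zero_iff)
  qed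
  then have gamma_pos: "0 < \<gamma>" using \<open>\<gamma> \<ge> 0\<close> by simp

  obtain B where B: "\<And>x. (\<bar>x\<bar> + 1) * g x \<le> B"
    using assms(13) by (auto simp: bdd_above_def)
  have g_le: "g x \<le> B" for x
  proof -
    have "1 * g x \<le> (\<bar>x\<bar> + 1) * g x" using assms(12) by (intro mult_right_mono) (auto simp: less_imp_le)
    then show ?thesis using B[of x] by simp
  qed
  have B_pos: "0 < B" using assms(12) g_le[of 0] by (meson less_le_trans)
  have small_ball: "emeasure ?\<rho> {y. \<bar>y - r\<bar> < t} \<le> ennreal (2 * B * t)" if "0 < t" for r t
  proof -
    have "{y. \<bar>y - r\<bar> < t} = {r - t<..<r + t}" by auto
    then have set: "{y. \<bar>y - r\<bar> < t} \<in> sets borel" "emeasure lborel {y. \<bar>y - r\<bar> < t} = ennreal (2 * t)"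
      using that by auto
    have "emeasure ?\<rho> {y. \<bar>y - r\<bar> < t} = (\<integral>\<^sup>+y\<in>{y. \<bar>y - r\<bar> < t}. ennreal (g y) \<partial>lborel)"
      using distributed_emeasure[OF assms(8), of "{y. \<bar>y - r\<bar> < t}"] set(1) by (simp add: emeasure_distr)
    also have "\<dots> \<le> (\<integral>\<^sup>+y\<in>{y. \<bar>y - r\<bar> < t}. ennreal B \<partial>lborel)"
      using g_le by (intro nn_integral_mono mult_right_mono ennreal_leI) auto
    also have "\<dots> = ennreal B * ennreal (2 * t)"
      using set by (simp add: nn_integral_cmult_indicator)
    also have "\<dots> = ennreal (2 * B * t)"
      using B_pos that by (simp add: ennreal_mult[symmetric] mult_ac)
    finally show ?thesis .
  qed
  interpret C: vgarch_chain \<alpha> \<beta> \<gamma> \<delta> "2 * B" ?\<rho>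
  proof (rule vgarch_chain.intro)
    show "prob_space ?\<rho>" by (rule V.prob_space_distr) simp
    show "integrable ?\<rho> (\<lambda>y. y)" "(\<integral>y. y \<partial>?\<rho>) = 0"
      using assms(10) by (auto simp: integrable_distr_eq integral_distr has_bochner_integral_iff)
    show "integrable ?\<rho> (\<lambda>y. y\<^sup>2)" "(\<integral>y. y\<^sup>2 \<partial>?\<rho>) = 1"
      using assms(11) by (auto simp: integrable_distr_eq integral_distr has_bochner_integral_iff)
  qed (use assms(2,3,7) gamma_pos B_pos small_ball in auto)
  interpret C: vgarch_marginal \<alpha> \<beta> \<gamma> \<delta> "2 * B" ?\<rho> ?P
  proof (intro vgarch_marginal.intro vgarch_marginal_axioms.intro C.vgarch_chain_axioms)
    show "prob_space ?P" by (rule V.prob_space_distr) simp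
    show "AE s in ?P. \<alpha> \<le> s"
      using V.initial_variance_ge by (subst AE_distr_iff) auto
    show "integrable ?P (\<lambda>s. s)"
      using V.integrable_initial_variance by (subst integrable_distr_eq) auto
    show "distr (?P \<Otimes>\<^sub>M ?\<rho>) borel (\<lambda>(s, y). C.step1 s y) = ?P"
      unfolding C.step1_def by (rule V.variance_law_invariant)
  qed simp

  have factor_diag [measurable]: "(\<lambda>(s, y). ln \<bar>C.factor (s, s) y\<bar>) \<in> borel_measurable plane"
    unfolding C.factor_def by measurable
  have l_eq: "AE \<omega> in M. ?l \<omega> = ln \<bar>C.factor (V.initial_variance \<omega>, V.initial_variance \<omega>) (\<epsilon> 0 \<omega>)\<bar>"
    using V.sigma_eq_initial_variance V.initial_variance_ge
  proof eventually_elim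
    case (elim \<omega>)
    then have "0 < V.initial_variance \<omega>" using \<open>\<alpha> > 0\<close> by linarith
    then have "C.factor (V.initial_variance \<omega>, V.initial_variance \<omega>) (\<epsilon> 0 \<omega>) =
        \<beta> - \<gamma> * \<epsilon> 0 \<omega> * inverse ((\<sigma> 0 \<omega>)\<^sup>2) * (\<epsilon> 0 \<omega> - \<delta>)"
      using elim by (simp add: C.factor_def max_absorb2 field_simps power2_eq_square[of "\<epsilon> 0 \<omega>"])
    then show ?case by simp
  qed
  let ?d = "\<lambda>\<omega>. ln \<bar>C.factor (V.initial_variance \<omega>, V.initial_variance \<omega>) (\<epsilon> 0 \<omega>)\<bar>"
  have d_measurable [measurable]: "?d \<in> borel_measurable M"
    using measurable_compose[OF measurable_Pair[OF V.measurable_initial_variance V.measurable_eps[of 0]] factor_diag]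
    by simp
  have pair_measurable: "(\<lambda>\<omega>. (V.initial_variance \<omega>, \<epsilon> 0 \<omega>)) \<in> M \<rightarrow>\<^sub>M plane" by measurable
  \<comment> \<open>A function that is not integrable has Bochner integral 0, so a positive value
    entails integrability.\<close>
  have "integrable M ?l" using lyap not_integrable_integral_eq by fastforce
  then have d_int: "integrable M ?d"
    by (subst (asm) integrable_cong_AE[OF _ _ l_eq]) auto
  have "(\<integral>\<omega>. ?l \<omega> \<partial>M) = (\<integral>\<omega>. ?d \<omega> \<partial>M)"
    by (rule integral_cong_AE[OF _ _ l_eq]) measurable
  then have d_pos: "0 < (\<integral>\<omega>. ?d \<omega> \<partial>M)" using lyap by simp
  have "integrable (?P \<Otimes>\<^sub>M ?\<rho>) (\<lambda>(s, y). ln \<bar>C.factor (s, s) y\<bar>)"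
    unfolding V.distr_initial_noise[symmetric]
    by (subst integrable_distr_eq[OF pair_measurable factor_diag]) (use d_int in simp)
  moreover have "0 < (\<integral>(s, y). ln \<bar>C.factor (s, s) y\<bar> \<partial>(?P \<Otimes>\<^sub>M ?\<rho>))"
    unfolding V.distr_initial_noise[symmetric]
    by (subst integral_distr[OF pair_measurable factor_diag]) (use d_pos in simp)
  ultimately obtain \<mu> where adm: "C.admissible \<mu>" and inv: "C.transition \<mu> = \<mu>"
    and off_diag: "AE z in \<mu>. fst z \<noteq> snd z"
    by (rule C.off_diagonal_invariant_law)
  have prob_mu: "prob_space \<mu>" and sets_mu [measurable_cong]: "sets \<mu> = sets plane"
    and fst_mu: "distr \<mu> borel fst = ?P" and mu_ge: "AE z in \<mu>. \<alpha> \<le> fst z \<and> \<alpha> \<le> snd z"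
    using adm by (auto simp: C.admissible_def)
  obtain Q where Q [measurable]: "Q \<in> borel_measurable plane"
    and Q_law: "distr (?P \<Otimes>\<^sub>M unit_uniform) plane (\<lambda>(s, u). (s, Q (s, u))) = \<mu>"
    by (rule noise_outsourcing[OF prob_mu sets_mu, unfolded fst_mu])

  interpret U: prob_space unit_uniform by (rule prob_space_unit_uniform)
  interpret MU: pair_prob_space M unit_uniform ..
  let ?M' = "M \<Otimes>\<^sub>M unit_uniform"
  let ?R = "C.noise_seq"
  \<comment> \<open>The first component is the variance living on M itself, not a fresh copy, so
    that the first process can be identified with \<sigma>; only the second component uses the
    uniform variable.\<close>
  define Z0 where "Z0 w = (V.initial_variance (fst w), Q (V.initial_variance (fst w), snd w))" for w :: "'a \<times> real"
  define E where "E w = V.future (fst w)" for w :: "'a \<times> real"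
  have [measurable]: "Z0 \<in> ?M' \<rightarrow>\<^sub>M plane" "E \<in> ?M' \<rightarrow>\<^sub>M C.seq_borel"
    unfolding Z0_def E_def by measurable
  interpret R: prob_space ?R by (rule prob_space_PiM) (rule C.prob_rho)
  \<comment> \<open>The initial pair uses past noise and the uniform variable only. This one
    identity carries its law, its independence from the noise and, later, the stationarity of the
    paths.\<close>
  have joint: "distr ?M' (plane \<Otimes>\<^sub>M C.seq_borel) (\<lambda>w. (Z0 w, E w)) = \<mu> \<Otimes>\<^sub>M ?R"
  proof -
    have "distr ?M' (plane \<Otimes>\<^sub>M C.seq_borel)
        (\<lambda>(\<omega>, u). ((\<lambda>(s, u). (s, Q (s, u))) (V.initial_variance \<omega>, u), V.future \<omega>)) =
        distr (?P \<Otimes>\<^sub>M unit_uniform) plane (\<lambda>(s, u). (s, Q (s, u))) \<Otimes>\<^sub>M ?R"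
      by (rule distr_pair_with_independent_noise[OF V.prob_M prob_space_unit_uniform R.prob_space_axioms
            C.sets_noise_seq _ _ _ V.distr_initial_future]) measurable
    then show ?thesis
      unfolding Q_law by (simp add: Z0_def[abs_def] E_def[abs_def] split_beta')
  qed
  have sets_joint [measurable_cong]: "sets (\<mu> \<Otimes>\<^sub>M ?R) = sets (plane \<Otimes>\<^sub>M C.seq_borel)"
    by (rule sets_pair_measure_cong[OF sets_mu C.sets_noise_seq])
  have Z0_law: "distr ?M' plane Z0 = \<mu>"
  proof -
    have "distr ?M' plane Z0 =
        distr (distr ?M' (plane \<Otimes>\<^sub>M C.seq_borel) (\<lambda>w. (Z0 w, E w))) plane fst"
      by (subst distr_distr) (auto simp: comp_def)
    also have "\<dots> = distr (\<mu> \<Otimes>\<^sub>M ?R) \<mu> fst"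
      unfolding joint by (rule distr_cong) (auto simp: sets_mu)
    also have "\<dots> = \<mu>" by (rule R.distr_pair_fst)
    finally show ?thesis .
  qed
  have E_law: "distr ?M' C.seq_borel E = ?R"
  proof -
    have "distr ?M' C.seq_borel E = distr (distr ?M' M fst) C.seq_borel V.future"
      by (subst distr_distr) (auto simp: comp_def E_def[abs_def])
    then show ?thesis by (simp add: U.distr_pair_fst V.distr_future)
  qed
  have AE_Z0: "AE w in ?M'. Pr (Z0 w)" if "AE z in \<mu>. Pr z" and "Measurable.pred plane Pr" for Pr
    using that unfolding Z0_law[symmetric] by (subst (asm) AE_distr_iff) auto
  have AE_M: "AE w in ?M'. Pr (fst w)" if "AE \<omega> in M. Pr \<omega>" for Pr
  proof (rule AE_distrD[of fst ?M' M])
    show "AE \<omega> in distr ?M' M fst. Pr \<omega>"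
      unfolding U.distr_pair_fst by (rule that)
  qed simp
  have Z0_ge: "AE w in ?M'. \<alpha> \<le> fst (Z0 w) \<and> \<alpha> \<le> snd (Z0 w)"
    by (rule AE_Z0[OF mu_ge]) measurable

  define S where "S t w = fst (C.trajectory (Z0 w) (E w) t)" for t w
  define S' where "S' t w = snd (C.trajectory (Z0 w) (E w) t)" for t w
  have pair: "(S t w, S' t w) = C.trajectory (Z0 w) (E w) t" for t w
    by (simp add: S_def S'_def)
  have SS [measurable]: "(\<lambda>w. (S t w, S' t w)) \<in> ?M' \<rightarrow>\<^sub>M plane" for t
    unfolding pair using measurable_compose[OF _ C.measurable_trajectory_at, of "\<lambda>w. (Z0 w, E w)" ?M' t] by simp
  have ge: "AE w in ?M'. \<forall>t. \<alpha> \<le> S t w \<and> \<alpha> \<le> S' t w"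
    using Z0_ge by eventually_elim (simp add: S_def S'_def C.trajectory_ge)
  have stationary: "strictly_stationary ?M' plane (\<lambda>t w. (S t w, S' t w))"
    unfolding strictly_stationary_def
  proof (intro conjI allI SS)
    have law: "distr ?M' C.path_borel (\<lambda>w t. (S (t + h) w, S' (t + h) w)) =
        distr (\<mu> \<Otimes>\<^sub>M ?R) C.path_borel (\<lambda>w t. C.trajectory (fst w) (snd w) (t + h))" for h
      unfolding joint[symmetric] pair
      by (subst distr_distr[OF C.measurable_trajectory]) (auto simp: comp_def)
    show "distr ?M' C.path_borel (\<lambda>w t. (S (t + h) w, S' (t + h) w)) =
        distr ?M' C.path_borel (\<lambda>w t. (S t w, S' t w))" for h
      using law[of h] law[of 0] C.distr_trajectory_shift[OF prob_mu sets_mu inv, of h] by simp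
  qed
  have rec: "AE w in ?M'.
      S (Suc t) w = HV (\<alpha>, \<beta>, \<gamma>, \<delta>) (sqrt (S t w) * \<epsilon> (int t) (fst w)) (S t w) \<and>
      S' (Suc t) w = HV (\<alpha>, \<beta>, \<gamma>, \<delta>) (sqrt (S t w) * \<epsilon> (int t) (fst w)) (S' t w)" for t
    using ge
  proof eventually_elim
    case (elim w)
    have "E w t = \<epsilon> (int t) (fst w)" by (simp add: E_def V.future_def)
    then show ?case
      using C.step_eq_HV[of "C.trajectory (Z0 w) (E w) t" "E w t"] elim[rule_format, of t]
      by (simp add: S_def S'_def)
  qed
  \<comment> \<open>Both sides agree at time 0 by the choice of \<open>Z0\<close> and follow the
    same recursion afterwards.\<close>
  have S_sigma: "AE w in ?M'. S t w = (\<sigma> (int t) (fst w))\<^sup>2" for t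
  proof (induction t)
    case 0
    show ?case
      using AE_M[OF V.sigma_eq_initial_variance] by eventually_elim (simp add: S_def Z0_def)
  next
    case (Suc t)
    show ?case
      using Suc ge AE_M[OF V.sigma_rec[of "int (Suc t)"]]
    proof eventually_elim
      case (elim w)
      have "E w t = \<epsilon> (int t) (fst w)" by (simp add: E_def V.future_def)
      then have "S (Suc t) w = \<alpha> + \<beta> * S t w + \<gamma> * (\<epsilon> (int t) (fst w) - \<delta>)\<^sup>2"
        using elim(2)[rule_format, of t] by (simp add: S_def C.step_def C.step1_def max_absorb2)
      then show ?case using elim by simp
    qed
  qed
  have indep: "indep_rv ?M' plane (\<lambda>w. (S 0 w, S' 0 w)) C.seq_borel (\<lambda>w t. \<epsilon> (int t) (fst w))"
  proof -
    have "indep_rv ?M' plane Z0 C.seq_borel E"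
      by (rule indep_rv_if_distr_pair) (simp_all add: MU.prob_space_axioms joint Z0_law E_law)
    then show ?thesis by (simp add: S_def S'_def E_def[abs_def] V.future_def[abs_def])
  qed
  have "stationary_pair_solution ?M' fst (\<alpha>, \<beta>, \<gamma>, \<delta>) \<epsilon> \<sigma> S S'"
    unfolding stationary_pair_solution_def
  proof (intro conjI allI impI stationary indep S_sigma)
    show "AE w in ?M'. S t w > 0 \<and> S' t w > 0" for t
      using ge
    proof eventually_elim
      case (elim w)
      then show ?case using \<open>\<alpha> > 0\<close> by (meson less_le_trans)
    qed
    fix t :: nat assume "1 \<le> t"
    then have t: "t = Suc (t - 1)" by simp
    show "AE w in ?M'. S t w = HV (\<alpha>, \<beta>, \<gamma>, \<delta>) (sqrt (S (t - 1) w) * \<epsilon> (int (t - 1)) (fst w)) (S (t - 1) w)"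
      and "AE w in ?M'. S' t w = HV (\<alpha>, \<beta>, \<gamma>, \<delta>) (sqrt (S (t - 1) w) * \<epsilon> (int (t - 1)) (fst w)) (S' (t - 1) w)"
      using rec[of "t - 1"] t by auto
  qed
  moreover have "prob_extension M ?M' fst"
    by (simp add: prob_extension_def MU.prob_space_axioms U.distr_pair_fst)
  moreover have "measure ?M' {w \<in> space ?M'. S 0 w = S' 0 w} = 0"
  proof -
    have "AE w in ?M'. S 0 w \<noteq> S' 0 w"
      using AE_Z0[OF off_diag] by (simp add: S_def S'_def)
    moreover have "{w \<in> space ?M'. S 0 w = S' 0 w} \<in> sets ?M'"
      using measurable_compose[OF SS measurable_fst, of 0] measurable_compose[OF SS measurable_snd, of 0]
      by (intro borel_measurable_eq) simp_all
    ultimately show ?thesis by (simp add: MU.prob_eq_0)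
  qed
  ultimately show ?thesis by blast
qed

end
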